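(* Let $n\ge1$. The set of jets (Taylor series at $0$) of smooth function germs $f\colon(\mathbb{R}^n,0)\to\mathbb{R}$ having a non cone-like critical point at $0$ is a subset of a proalgebraic set of infinite codimension in the jet space $\hat{\mathcal E}(n,1)$.
   Context: $\mathcal E(n)$ is the ring of germs at $0$ of smooth functions $\mathbb{R}^n\to\mathbb{R}$. For $0\le k<\infty$, $\hat{\mathcal E}_k(n,1)$ is the (finite-dimensional) vector space of $k$-jets, i.e. Taylor polynomials at $0$ of order $k$ of germs in $\mathcal E(n)$, and $\hat{\mathcal E}(n,1)=\hat{\mathcal E}_\infty(n,1)$ is the vector space of Taylor series at $0$. Let $\pi_k\colon\hat{\mathcal E}(n,1)\to\hat{\mathcal E}_k(n,1)$ be the truncation. A subset $X\subset\hat{\mathcal E}(n,1)$ is proalgebraic if $X=\bigcap_k\pi_k^{-1}(X_k)$ for some algebraic sets $X_k\subset\hat{\mathcal E}_k(n,1)$; its codimension is the upper limit of the codimensions of the sets $X_k$ in $\hat{\mathcal E}_k(n,1)$. Cone-like: a critical point $x_0$ of a smooth function $f$ is cone-like if it is isolated and admits a cone neighborhood in $f^{-1}(f(x_0))$, i.e. a compact neighborhood $V$ of $x_0$ in $f^{-1}(f(x_0))$ such that $V\setminus\{x_0\}$ is a smooth hypersurface with smooth boundary $\partial V$, and $V$ is homeomorphic to the cone over $\partial V$ with $x_0$ corresponding to the vertex (the cone over the empty set being a point). *)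

theory Defs
  imports "HOL-Analysis.Analysis"
begin

section \<open>Smooth maps\<close>

primrec Ck_on :: "nat \<Rightarrow> 'a::real_normed_vector set \<Rightarrow> ('a \<Rightarrow> 'b::real_normed_vector) \<Rightarrow> bool" where
  "Ck_on 0 U f \<longleftrightarrow> continuous_on U f"
| "Ck_on (Suc k) U f \<longleftrightarrow> (\<forall>x\<in>U. f differentiable (at x)) \<and>
     (\<forall>v. Ck_on k U (\<lambda>x. frechet_derivative f (at x) v))"

text \<open>Only used for open \<open>U\<close>: the derivatives are taken in the full space.\<close>

definition smooth_on :: "'a::real_normed_vector set \<Rightarrow> ('a \<Rightarrow> 'b::real_normed_vector) \<Rightarrow> bool" where
  "smooth_on U f \<longleftrightarrow> (\<forall>k. Ck_on k U f)"

definition diffeomorphism ::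
    "'a::real_normed_vector set \<Rightarrow> 'b::real_normed_vector set \<Rightarrow> ('a \<Rightarrow> 'b) \<Rightarrow> ('b \<Rightarrow> 'a) \<Rightarrow> bool" where
  "diffeomorphism N N' \<phi> \<psi> \<longleftrightarrow> open N \<and> open N' \<and> smooth_on N \<phi> \<and> smooth_on N' \<psi> \<and>
     \<phi> ` N \<subseteq> N' \<and> \<psi> ` N' \<subseteq> N \<and> (\<forall>x\<in>N. \<psi> (\<phi> x) = x) \<and> (\<forall>y\<in>N'. \<phi> (\<psi> y) = y)"

section \<open>Hypersurfaces with boundary\<close>

definition hypersurface_interior_point :: "(real^'n) set \<Rightarrow> real^'n \<Rightarrow> bool" where
  "hypersurface_interior_point M p \<longleftrightarrow>
     (\<exists>N (N' :: (real^'n) set) \<phi> \<psi> i. p \<in> N \<and> diffeomorphism N N' \<phi> \<psi> \<and>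
        \<phi> ` (N \<inter> M) = {y\<in>N'. y $ i = 0})"

definition hypersurface_boundary_point :: "(real^'n) set \<Rightarrow> real^'n \<Rightarrow> bool" where
  "hypersurface_boundary_point M p \<longleftrightarrow>
     (\<exists>N (N' :: (real^'n) set) \<phi> \<psi> i j. i \<noteq> j \<and> p \<in> N \<and> diffeomorphism N N' \<phi> \<psi> \<and>
        \<phi> ` (N \<inter> M) = {y\<in>N'. y $ i = 0 \<and> 0 \<le> y $ j} \<and> \<phi> p $ j = 0)"

definition hypersurface_with_boundary :: "(real^'n) set \<Rightarrow> bool" where
  "hypersurface_with_boundary M \<longleftrightarrow>
     (\<forall>p\<in>M. hypersurface_interior_point M p \<or> hypersurface_boundary_point M p)"

definition hypersurface_boundary :: "(real^'n) set \<Rightarrow> (real^'n) set" where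
  "hypersurface_boundary M = {p\<in>M. hypersurface_boundary_point M p}"

section \<open>The cone over a set\<close>

text \<open>
  The cone over \<open>B\<close> is the quotient of \<open>B \<times> [0,1]\<close> that collapses \<open>B \<times> {0}\<close> to the vertex.
  The vertex is \<open>None\<close>; it is present also when \<open>B\<close> is empty, so the cone over \<open>{}\<close> is a point.
\<close>

definition cone_proj :: "'a \<times> real \<Rightarrow> ('a \<times> real) option" where
  "cone_proj z = (if snd z = 0 then None else Some z)"

definition cone_points :: "'a set \<Rightarrow> ('a \<times> real) option set" where
  "cone_points B = insert None (cone_proj ` (B \<times> {0..1}))"

definition cone_topology :: "'a::topological_space set \<Rightarrow> ('a \<times> real) option topology" where
  "cone_topology B = topology (\<lambda>W. W \<subseteq> cone_points B \<and>
     openin (top_of_set (B \<times> {0..1})) {z \<in> B \<times> {0..1}. cone_proj z \<in> W})"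

lemma openin_cone_topology:
  "openin (cone_topology B) W \<longleftrightarrow> W \<subseteq> cone_points B \<and>
     openin (top_of_set (B \<times> {0..1})) {z \<in> B \<times> {0..1}. cone_proj z \<in> W}"
proof -
  let ?X = "top_of_set (B \<times> {0..1::real})"
  let ?pre = "\<lambda>W. {z \<in> B \<times> {0..1}. cone_proj z \<in> W}"
  have "istopology (\<lambda>W. W \<subseteq> cone_points B \<and> openin ?X (?pre W))"
    unfolding istopology_def
  proof (intro conjI allI impI)
    fix S T
    assume S: "S \<subseteq> cone_points B \<and> openin ?X (?pre S)"
      and T: "T \<subseteq> cone_points B \<and> openin ?X (?pre T)"
    have "?pre (S \<inter> T) = ?pre S \<inter> ?pre T" by auto
    then show "openin ?X (?pre (S \<inter> T))" using S T by (simp only: openin_Int)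
    show "S \<inter> T \<subseteq> cone_points B" using S by auto
  next
    fix K
    assume K: "\<forall>S\<in>K. S \<subseteq> cone_points B \<and> openin ?X (?pre S)"
    have "?pre (\<Union>K) = (\<Union>S\<in>K. ?pre S)" by auto
    moreover have "openin ?X (\<Union>S\<in>K. ?pre S)" 
      using K by (intro openin_Union) blast
    ultimately show "openin ?X (?pre (\<Union>K))" by (simp only:)
    show "\<Union>K \<subseteq> cone_points B" using K by auto
  qed
  then show ?thesis
    unfolding cone_topology_def by (simp only: topology_inverse')
qed

lemma topspace_cone_topology: "topspace (cone_topology B) = cone_points B"
proof (rule subset_antisym)
  show "topspace (cone_topology B) \<subseteq> cone_points B"
    using openin_topspace[of "cone_topology B"] unfolding openin_cone_topology by (rule conjunct1)
  have "{z \<in> B \<times> {0..1}. cone_proj z \<in> cone_points B} = B \<times> {0..1}"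
    by (auto simp: cone_points_def)
  then have "openin (cone_topology B) (cone_points B)"
    unfolding openin_cone_topology by simp
  then show "cone_points B \<subseteq> topspace (cone_topology B)"
    by (rule openin_subset)
qed

section \<open>Cone-like critical points\<close>

definition critical_point :: "('a::real_normed_vector \<Rightarrow> real) \<Rightarrow> 'a \<Rightarrow> bool" where
  "critical_point f x \<longleftrightarrow> (f has_derivative (\<lambda>_. 0)) (at x)"

definition isolated_critical_point ::
    "'a::real_normed_vector set \<Rightarrow> ('a \<Rightarrow> real) \<Rightarrow> 'a \<Rightarrow> bool" where
  "isolated_critical_point U f x0 \<longleftrightarrow> x0 \<in> U \<and> critical_point f x0 \<and>
     (\<exists>W. open W \<and> x0 \<in> W \<and> (\<forall>x\<in>W \<inter> U. critical_point f x \<longrightarrow> x = x0))"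

definition cone_neighborhood :: "(real^'n) set \<Rightarrow> real^'n \<Rightarrow> (real^'n) set \<Rightarrow> bool" where
  "cone_neighborhood L x0 V \<longleftrightarrow>
     compact V \<and> V \<subseteq> L \<and> (\<exists>W. open W \<and> x0 \<in> W \<and> L \<inter> W \<subseteq> V) \<and>
     hypersurface_with_boundary (V - {x0}) \<and>
     (\<exists>h. homeomorphic_map (top_of_set V) (cone_topology (hypersurface_boundary (V - {x0}))) h \<and>
          h x0 = None)"

definition cone_like :: "(real^'n) set \<Rightarrow> (real^'n \<Rightarrow> real) \<Rightarrow> real^'n \<Rightarrow> bool" where
  "cone_like U f x0 \<longleftrightarrow> isolated_critical_point U f x0 \<and>
     (\<exists>V. cone_neighborhood {x\<in>U. f x = f x0} x0 V)"

section \<open>Taylor series and jets\<close>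

text \<open>Formal power series in the variables indexed by \<open>'n\<close>: the coefficient of every multi-index.\<close>

type_synonym 'n taylor_series = "('n \<Rightarrow> nat) \<Rightarrow> real"

definition partial_deriv :: "'n::finite \<Rightarrow> (real^'n \<Rightarrow> real) \<Rightarrow> real^'n \<Rightarrow> real" where
  "partial_deriv i f = (\<lambda>x. frechet_derivative f (at x) (axis i 1))"

text \<open>
  The mixed partial derivative of multi-index \<open>\<alpha>\<close>. Any list in which each \<open>i\<close> occurs \<open>\<alpha> i\<close> times
  gives the same value, because partial derivatives of smooth functions commute.
\<close>

definition mixed_partial :: "('n::finite \<Rightarrow> nat) \<Rightarrow> (real^'n \<Rightarrow> real) \<Rightarrow> real^'n \<Rightarrow> real" where
  "mixed_partial \<alpha> f = foldr partial_deriv (SOME is. \<forall>i. count_list is i = \<alpha> i) f"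

definition taylor :: "(real^'n \<Rightarrow> real) \<Rightarrow> 'n::finite taylor_series" where
  "taylor f = (\<lambda>\<alpha>. mixed_partial \<alpha> f 0 / (\<Prod>i\<in>UNIV. fact (\<alpha> i)))"

definition jet_indices :: "nat \<Rightarrow> ('n::finite \<Rightarrow> nat) set" where
  "jet_indices k = {\<alpha>. (\<Sum>i\<in>UNIV. \<alpha> i) \<le> k}"

lemma finite_jet_indices: "finite (jet_indices k :: ('n::finite \<Rightarrow> nat) set)"
proof (rule finite_subset)
  show "jet_indices k \<subseteq> PiE (UNIV :: 'n set) (\<lambda>_. {..k})"
  proof
    fix \<alpha> :: "'n \<Rightarrow> nat"
    assume "\<alpha> \<in> jet_indices k"
    then have "\<alpha> i \<le> k" for i
      using member_le_sum[of i UNIV \<alpha>] by (simp add: jet_indices_def)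
    then show "\<alpha> \<in> PiE UNIV (\<lambda>_. {..k})" by auto
  qed
qed (simp add: finite_PiE)

definition truncate_jet :: "nat \<Rightarrow> 'n::finite taylor_series \<Rightarrow> 'n taylor_series" where
  "truncate_jet k T = (\<lambda>\<alpha>. if \<alpha> \<in> jet_indices k then T \<alpha> else 0)"

section \<open>Algebraic sets in a real coordinate space\<close>

text \<open>
  For finite \<open>I\<close>, \<open>coord_space I\<close> is the vector space of real vectors with coordinates indexed by \<open>I\<close>;
  in particular \<open>coord_space (jet_indices k)\<close> is the space of jets of order \<open>k\<close>.
\<close>

definition coord_space :: "'i set \<Rightarrow> ('i \<Rightarrow> real) set" where
  "coord_space I = {x. \<forall>i. i \<notin> I \<longrightarrow> x i = 0}"

inductive poly_fun :: "'i set \<Rightarrow> (('i \<Rightarrow> real) \<Rightarrow> real) \<Rightarrow> bool" for I where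
  const: "poly_fun I (\<lambda>x. c)"
| coord: "i \<in> I \<Longrightarrow> poly_fun I (\<lambda>x. x i)"
| add: "poly_fun I p \<Longrightarrow> poly_fun I q \<Longrightarrow> poly_fun I (\<lambda>x. p x + q x)"
| mult: "poly_fun I p \<Longrightarrow> poly_fun I q \<Longrightarrow> poly_fun I (\<lambda>x. p x * q x)"

definition algebraic :: "'i set \<Rightarrow> ('i \<Rightarrow> real) set \<Rightarrow> bool" where
  "algebraic I A \<longleftrightarrow>
     (\<exists>P. (\<forall>p\<in>P. poly_fun I p) \<and> A = {x \<in> coord_space I. \<forall>p\<in>P. p x = 0})"

definition irreducible_algebraic :: "'i set \<Rightarrow> ('i \<Rightarrow> real) set \<Rightarrow> bool" where
  "irreducible_algebraic I A \<longleftrightarrow> algebraic I A \<and> A \<noteq> {} \<and>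
     (\<forall>B C. algebraic I B \<and> algebraic I C \<and> A = B \<union> C \<longrightarrow> A = B \<or> A = C)"

text \<open>
  Krull dimension: the supremum of the lengths of chains of irreducible algebraic subsets.
  The empty set has dimension \<open>-\<infinity>\<close>, hence codimension \<open>\<infinity>\<close>.
\<close>

definition algebraic_dim :: "'i set \<Rightarrow> ('i \<Rightarrow> real) set \<Rightarrow> ereal" where
  "algebraic_dim I A = Sup {ereal (real d) | d.
     \<exists>Z. (\<forall>i\<le>d. irreducible_algebraic I (Z i) \<and> Z i \<subseteq> A) \<and> (\<forall>i<d. Z i \<subset> Z (Suc i))}"

definition algebraic_codim :: "'i set \<Rightarrow> ('i \<Rightarrow> real) set \<Rightarrow> ereal" where
  "algebraic_codim I A = ereal (real (card I)) - algebraic_dim I A"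

section \<open>Proalgebraic sets\<close>

text \<open>
  The upper limit of the codimensions can depend on the family \<open>Y\<close> representing \<open>X\<close>, so having a
  given codimension is a relation. A representation with upper limit \<open>\<infinity>\<close> forces the projection of \<open>X\<close>
  to jets of order \<open>k\<close> to lie in algebraic sets of unboundedly large codimension.
\<close>

definition proalgebraic_of_codim :: "'n::finite taylor_series set \<Rightarrow> ereal \<Rightarrow> bool" where
  "proalgebraic_of_codim X c \<longleftrightarrow>
     (\<exists>Y. (\<forall>k. algebraic (jet_indices k) (Y k)) \<and>
          X = (\<Inter>k. truncate_jet k -` Y k) \<and>
          limsup (\<lambda>k. algebraic_codim (jet_indices k) (Y k)) = c)"

end

theory Submission
  imports Defs
begin

text \<open>
  For a jet \<open>z\<close> of order \<open>k\<close> choose an even \<open>N > k + 1\<close>, let \<open>\<rho> x = (\<Sum>i. x i ^ N) / N\<close>, and let \<open>I\<close> be the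
  ideal generated by the \<open>(f - f 0) * \<partial>\<^sub>l f\<close> and the \<open>\<partial>\<^sub>i \<rho> * \<partial>\<^sub>j f - \<partial>\<^sub>j \<rho> * \<partial>\<^sub>i f\<close>. If \<open>f\<close> is the
  perturbation of \<open>z\<close> by \<open>(\<Sum>i. c i * x i ^ N) / N\<close> with distinct nonzero \<open>c i\<close>, then the
  top-degree parts of the generators yield all \<open>x i ^ (2 * N - 1)\<close>, so that \<open>\<real>[x] / I\<close> is spanned by
  \<open>s = (2 * N - 1) ^ n\<close> monomials. Spanning is an open condition, witnessed by a polynomial in a jet
  of higher order; where it holds, the powers \<open>1, x i, \<dots>, x i ^ s\<close> are dependent modulo \<open>I\<close> and terms
  of order greater than \<open>s\<close>, and hence the generators have no common zero near \<open>0\<close> besides \<open>0\<close>,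
  for every smooth \<open>f\<close> with this jet. Thus the bad jets over any fixed jet lie in a proper algebraic
  subset, and iterating this makes the codimension grow without bound.

  If the generators have no other common zero, then \<open>0\<close> is an isolated critical point and the level
  sets of \<open>\<rho>\<close> are transverse to that of \<open>f\<close>; the flow of the projection of \<open>- \<nabla>\<rho>\<close> to the level set
  of \<open>f\<close> then gives it the structure of a cone.
\<close>

section \<open>Dimension of algebraic sets\<close>

text \<open>The generators vanish together exactly at the critical points of f and at those points
  of its level set through 0 where the gradients of f and \<rho> are parallel, so a single ideal
  encodes isolatedness and transversality. Since \<rho> and the perturbation consist of the same
  powers x i ^ N, the minors have leading terms (c j - c i) * (x i * x j) ^ (N - 1): hence the
  distinct c i. That they are nonzero keeps x i ^ (2 * N - 1) alive in the remaining generators; N >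
  k + 1 keeps the given jet below the leading terms, and N even makes \<rho> positive away from 0. A
  polynomial relation helps with smooth f because a nonzero polynomial of degree at most s in one
  variable is too large near 0 to be an error of order s + 1. The obstacle on the algebraic side is
  that codimension is defined by chains of irreducible sets, while the construction controls only
  fibres over jets of lower order. A count connects the two: a chain of length d forces (D + 1) ^ d
  independent polynomial functions of degree O(D), and every fibre condition lowers by one the
  exponent with which such functions can grow.\<close>

lemma nontrivial_solution:
  fixes A :: "'b \<Rightarrow> 'a \<Rightarrow> real"
  assumes "finite B" "finite S" "card B < card S"
  shows "\<exists>c. (\<exists>s\<in>S. c s \<noteq> 0) \<and> (\<forall>b\<in>B. (\<Sum>s\<in>S. A b s * c s) = 0)"
  using assms
proof (induction B arbitrary: S A rule: finite_induct)
  case empty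
  then have "S \<noteq> {}" by auto
  then show ?case by (intro exI[of _ "\<lambda>_. 1"]) auto
next
  case (insert b B)
  show ?case
  proof (cases "\<forall>s\<in>S. A b s = 0")
    case True
    have "card B < card S" using insert by auto
    from insert.IH[OF insert.prems(1) this, of A] True show ?thesis
      by auto
  next
    case False
    then obtain s0 where s0: "s0 \<in> S" "A b s0 \<noteq> 0" by blast
    let ?S = "S - {s0}"
    \<comment> \<open>Row b serves as pivot: each remaining row is reduced by the multiple of row b
      that cancels its entry in column s0.\<close>
    let ?A = "\<lambda>b' s. A b' s - A b' s0 * A b s / A b s0"
    have "card B < card ?S" using insert s0 by auto
    then obtain c where c: "\<exists>s\<in>?S. c s \<noteq> 0" "\<forall>b'\<in>B. (\<Sum>s\<in>?S. ?A b' s * c s) = 0"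
      using insert.IH[of ?S ?A] insert.prems(1) by auto
    define t where "t = (\<Sum>s\<in>?S. A b s * c s)"
    define c' where "c' = c(s0 := - t / A b s0)"
    have split: "(\<Sum>s\<in>S. A b' s * c' s) = A b' s0 * (- t / A b s0) + (\<Sum>s\<in>?S. A b' s * c s)" for b'
    proof -
      have "(\<Sum>s\<in>S. A b' s * c' s) = A b' s0 * c' s0 + (\<Sum>s\<in>?S. A b' s * c' s)"
        using insert.prems(1) s0(1) by (simp add: sum.remove)
      also have "(\<Sum>s\<in>?S. A b' s * c' s) = (\<Sum>s\<in>?S. A b' s * c s)"
        by (rule sum.cong) (auto simp: c'_def)
      finally show ?thesis by (simp add: c'_def)
    qed
    have "(\<Sum>s\<in>S. A b' s * c' s) = 0" if "b' \<in> B" for b'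
    proof -
      have "0 = (\<Sum>s\<in>?S. A b' s * c s - (A b' s0 / A b s0) * (A b s * c s))"
        using c(2) that by (simp add: algebra_simps)
      also have "\<dots> = (\<Sum>s\<in>?S. A b' s * c s) - (A b' s0 / A b s0) * t"
        by (simp add: sum_subtractf sum_distrib_left t_def)
      finally show ?thesis by (simp add: split)
    qed
    moreover have "(\<Sum>s\<in>S. A b s * c' s) = 0"
      using s0(2) by (simp add: split t_def)
    moreover have "\<exists>s\<in>S. c' s \<noteq> 0" using c(1) by (auto simp: c'_def)
    ultimately show ?thesis by (intro exI[of _ c']) auto
  qed
qed

section \<open>Polynomial functions with a degree bound\<close>

lemma poly_fun_mono: "poly_fun I p \<Longrightarrow> I \<subseteq> J \<Longrightarrow> poly_fun J p"
  by (induction rule: poly_fun.induct) (auto intro: poly_fun.intros)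

lemma poly_fun_sum: "(\<And>a. a \<in> A \<Longrightarrow> poly_fun I (f a)) \<Longrightarrow> poly_fun I (\<lambda>x. \<Sum>a\<in>A. f a x)"
  by (induction A rule: infinite_finite_induct) (auto intro: poly_fun.intros)

lemma poly_fun_power: "poly_fun I p \<Longrightarrow> poly_fun I (\<lambda>x. p x ^ n)"
  by (induction n) (auto intro: poly_fun.intros)

lemma poly_fun_cmult: "poly_fun I p \<Longrightarrow> poly_fun I (\<lambda>x. c * p x)"
  by (rule poly_fun.mult[OF poly_fun.const])

lemma poly_fun_diff: "poly_fun I p \<Longrightarrow> poly_fun I q \<Longrightarrow> poly_fun I (\<lambda>x. p x - q x)"
  using poly_fun.add[OF _ poly_fun_cmult[of I q "-1"]] by simp

text \<open>The number D is an upper bound for the total degree and can be raised at will.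
  Dimensions are measured below by counting polynomial functions within such a bound.\<close>

inductive poly_deg :: "'i set \<Rightarrow> nat \<Rightarrow> (('i \<Rightarrow> real) \<Rightarrow> real) \<Rightarrow> bool" for I where
  const: "poly_deg I D (\<lambda>x. c)"
| coord: "i \<in> I \<Longrightarrow> 1 \<le> D \<Longrightarrow> poly_deg I D (\<lambda>x. x i)"
| add: "poly_deg I D p \<Longrightarrow> poly_deg I D q \<Longrightarrow> poly_deg I D (\<lambda>x. p x + q x)"
| mult: "poly_deg I D p \<Longrightarrow> poly_deg I E q \<Longrightarrow> poly_deg I (D + E) (\<lambda>x. p x * q x)"

lemma poly_deg_mono: "poly_deg I D p \<Longrightarrow> D \<le> D' \<Longrightarrow> poly_deg I D' p"
proof (induction arbitrary: D' rule: poly_deg.induct)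
  case (mult D p E q)
  then have "poly_deg I ((D' - E) + E) (\<lambda>x. p x * q x)"
    by (intro poly_deg.mult) auto
  then show ?case using mult.prems by simp
qed (auto intro: poly_deg.intros)

lemma poly_deg_imp_poly_fun: "poly_deg I D p \<Longrightarrow> poly_fun I p"
  by (induction rule: poly_deg.induct) (auto intro: poly_fun.intros)

lemma poly_fun_imp_poly_deg: "poly_fun I p \<Longrightarrow> \<exists>D. poly_deg I D p"
proof (induction rule: poly_fun.induct)
  case (add p q)
  then obtain D E where "poly_deg I D p" "poly_deg I E q" by auto
  then have "poly_deg I (D + E) p" "poly_deg I (D + E) q"
    by (auto intro: poly_deg_mono)
  then show ?case by (auto intro: poly_deg.intros)
qed (auto intro: poly_deg.intros)

lemma poly_deg_sum: "(\<And>a. a \<in> A \<Longrightarrow> poly_deg I D (f a)) \<Longrightarrow> poly_deg I D (\<lambda>x. \<Sum>a\<in>A. f a x)"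
  by (induction A rule: infinite_finite_induct) (auto intro: poly_deg.intros)

lemma poly_deg_power: "poly_deg I D p \<Longrightarrow> poly_deg I (n * D) (\<lambda>x. p x ^ n)"
proof (induction n)
  case (Suc n)
  then show ?case using poly_deg.mult[OF Suc.prems Suc.IH] by simp
qed (simp add: poly_deg.const)

text \<open>Expansion in powers of the last variable. The coefficients keep the bound D instead of D
  - j, which leaves the growth exponents below unchanged. The clause on j > D is what the Cauchy
  product \<open>polynomial_product\<close> asks for in the case of a product.\<close>

lemma poly_deg_decompose:
  assumes "poly_deg (insert t J) D p"
  shows "\<exists>q. (\<forall>j. poly_deg J D (q j)) \<and> (\<forall>j>D. q j = (\<lambda>_. 0)) \<and>
    (\<forall>x. p x = (\<Sum>j\<le>D. q j x * x t ^ j))"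
  using assms
proof (induction rule: poly_deg.induct)
  case (const D c)
  show ?case
    by (intro exI[of _ "\<lambda>j x. if j = 0 then c else 0"])
      (auto intro: poly_deg.const simp: if_distrib[of "\<lambda>u. u * _"] sum.delta cong: if_cong)
next
  case (coord i D)
  show ?case
  proof (cases "i = t")
    case True
    with coord show ?thesis
      by (intro exI[of _ "\<lambda>j x. if j = 1 then 1 else 0"])
        (auto intro: poly_deg.const simp: if_distrib[of "\<lambda>u. u * _"] sum.delta cong: if_cong)
  next
    case False
    with coord have i: "poly_deg J D (\<lambda>x. x i)" by (auto intro: poly_deg.coord)
    show ?thesis
    proof (intro exI[of _ "\<lambda>j x. if j = 0 then x i else 0"] conjI allI impI)
      show "poly_deg J D (\<lambda>x. if j = 0 then x i else 0)" for j
        using i by (cases "j = 0") (auto intro: poly_deg.const)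
    qed (auto simp: if_distrib[of "\<lambda>u. u * _"] sum.delta cong: if_cong)
  qed
next
  case (add D p q)
  then obtain a b where a: "\<forall>j. poly_deg J D (a j)" "\<forall>j>D. a j = (\<lambda>_. 0)" "\<forall>x. p x = (\<Sum>j\<le>D. a j x * x t ^ j)"
    and b: "\<forall>j. poly_deg J D (b j)" "\<forall>j>D. b j = (\<lambda>_. 0)" "\<forall>x. q x = (\<Sum>j\<le>D. b j x * x t ^ j)"
    by blast
  then show ?case
    by (intro exI[of _ "\<lambda>j x. a j x + b j x"])
      (auto intro: poly_deg.add simp: algebra_simps sum.distrib)
next
  case (mult D p E q)
  then obtain a b where a: "\<forall>j. poly_deg J D (a j)" "\<forall>j>D. a j = (\<lambda>_. 0)" "\<forall>x. p x = (\<Sum>j\<le>D. a j x * x t ^ j)"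
    and b: "\<forall>j. poly_deg J E (b j)" "\<forall>j>E. b j = (\<lambda>_. 0)" "\<forall>x. q x = (\<Sum>j\<le>E. b j x * x t ^ j)"
    by blast
  let ?c = "\<lambda>r x. \<Sum>k\<le>r. a k x * b (r - k) x"
  have 1: "p x * q x = (\<Sum>r\<le>D + E. ?c r x * x t ^ r)" for x
    using polynomial_product[of D "\<lambda>j. a j x" E "\<lambda>j. b j x" "x t"] a b by simp
  have 2: "poly_deg J (D + E) (?c r)" for r
    by (intro poly_deg_sum poly_deg.mult) (use a b in auto)
  have 3: "?c r = (\<lambda>_. 0)" if "r > D + E" for r
  proof
    fix x
    have "a k x * b (r - k) x = 0" if "k \<le> r" for k
      using a(2) b(2) \<open>r > D + E\<close> by (cases "k > D") auto
    then show "?c r x = 0" by (intro sum.neutral) auto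
  qed
  show ?case
    by (intro exI[of _ ?c] conjI allI impI, rule 2, rule 3, assumption, rule 1)
qed

lemma poly_fun_decompose:
  assumes "poly_fun (insert t J) p"
  shows "\<exists>D q. (\<forall>j. poly_fun J (q j)) \<and> (\<forall>x. p x = (\<Sum>j\<le>D. q j x * x t ^ j))"
proof -
  obtain D where "poly_deg (insert t J) D p" using poly_fun_imp_poly_deg[OF assms] by blast
  from poly_deg_decompose[OF this] obtain q where
    "\<forall>j. poly_deg J D (q j)" "\<forall>x. p x = (\<Sum>j\<le>D. q j x * x t ^ j)" by blast
  then show ?thesis by (blast intro: poly_deg_imp_poly_fun)
qed

text \<open>The vanishing ideal of Z is prime, so the polynomial functions on Z form an integral
  domain. Nothing else about irreducible sets enters the counting.\<close>

definition prime_set :: "'i set \<Rightarrow> ('i \<Rightarrow> real) set \<Rightarrow> bool" where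
  "prime_set I Z \<longleftrightarrow> Z \<noteq> {} \<and> (\<forall>p q. poly_fun I p \<longrightarrow> poly_fun I q \<longrightarrow> (\<forall>x\<in>Z. p x * q x = 0) \<longrightarrow>
     (\<forall>x\<in>Z. p x = 0) \<or> (\<forall>x\<in>Z. q x = 0))"

lemma prime_set_mult:
  assumes "prime_set I Z" "poly_fun I p" "poly_fun I q" "\<exists>x\<in>Z. p x \<noteq> 0" "\<exists>x\<in>Z. q x \<noteq> 0"
  shows "\<exists>x\<in>Z. p x * q x \<noteq> 0"
  using assms unfolding prime_set_def by meson

lemma algebraic_Int_zero:
  assumes "algebraic I A" "poly_fun I p"
  shows "algebraic I {x \<in> A. p x = 0}"
proof -
  from assms(1) obtain P where P: "\<forall>p\<in>P. poly_fun I p" "A = {x \<in> coord_space I. \<forall>p\<in>P. p x = 0}"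
    unfolding algebraic_def by blast
  then show ?thesis unfolding algebraic_def
    by (intro exI[of _ "insert p P"]) (use assms(2) in auto)
qed

lemma irreducible_imp_prime_set:
  assumes "irreducible_algebraic I Z"
  shows "prime_set I Z"
  unfolding prime_set_def
proof (intro conjI allI impI)
  show "Z \<noteq> {}" using assms unfolding irreducible_algebraic_def by blast
next
  fix p q assume p: "poly_fun I p" and q: "poly_fun I q" and pq: "\<forall>x\<in>Z. p x * q x = 0"
  let ?B = "{x\<in>Z. p x = 0}" and ?C = "{x\<in>Z. q x = 0}"
  have "algebraic I ?B" "algebraic I ?C"
    using assms p q unfolding irreducible_algebraic_def by (auto intro: algebraic_Int_zero)
  moreover have "Z = ?B \<union> ?C" using pq by auto
  moreover have "\<forall>B C. algebraic I B \<and> algebraic I C \<and> Z = B \<union> C \<longrightarrow> Z = B \<or> Z = C"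
    using assms unfolding irreducible_algebraic_def by (elim conjE)
  ultimately have "Z = ?B \<or> Z = ?C" by (elim allE[of _ ?B] allE[of _ ?C]) simp
  then show "(\<forall>x\<in>Z. p x = 0) \<or> (\<forall>x\<in>Z. q x = 0)" by auto
qed

text \<open>For prime Z: in the function field of Z, the coordinate t is algebraic over the subfield
  generated by the coordinates in J. The last clause makes the relation nontrivial.\<close>

definition algebraic_over :: "('i \<Rightarrow> real) set \<Rightarrow> 'i set \<Rightarrow> 'i \<Rightarrow> bool" where
  "algebraic_over Z J t \<longleftrightarrow> (\<exists>e q. (\<forall>j\<le>e. poly_fun J (q j)) \<and>
     (\<forall>x\<in>Z. (\<Sum>j\<le>e. q j x * x t ^ j) = 0) \<and> (\<exists>x\<in>Z. q e x \<noteq> 0))"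

section \<open>Growth of the space of polynomial functions on a set\<close>

definition in_span_on :: "'a set \<Rightarrow> ('a \<Rightarrow> real) set \<Rightarrow> ('a \<Rightarrow> real) \<Rightarrow> bool" where
  "in_span_on Z B f \<longleftrightarrow> (\<exists>c. \<forall>x\<in>Z. f x = (\<Sum>b\<in>B. c b * b x))"

lemma in_span_on_zero: "in_span_on Z B (\<lambda>_. 0)"
  unfolding in_span_on_def by (intro exI[of _ "\<lambda>_. 0"]) simp

lemma in_span_on_add: "in_span_on Z B f \<Longrightarrow> in_span_on Z B g \<Longrightarrow> in_span_on Z B (\<lambda>x. f x + g x)"
  unfolding in_span_on_def
proof (elim exE)
  fix c d assume "\<forall>x\<in>Z. f x = (\<Sum>b\<in>B. c b * b x)" "\<forall>x\<in>Z. g x = (\<Sum>b\<in>B. d b * b x)"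
  then show "\<exists>c. \<forall>x\<in>Z. f x + g x = (\<Sum>b\<in>B. c b * b x)"
    by (intro exI[of _ "\<lambda>b. c b + d b"]) (auto simp: algebra_simps sum.distrib)
qed

lemma in_span_on_cmult: "in_span_on Z B f \<Longrightarrow> in_span_on Z B (\<lambda>x. a * f x)"
  unfolding in_span_on_def
proof (elim exE)
  fix c assume "\<forall>x\<in>Z. f x = (\<Sum>b\<in>B. c b * b x)"
  then show "\<exists>c. \<forall>x\<in>Z. a * f x = (\<Sum>b\<in>B. c b * b x)"
    by (intro exI[of _ "\<lambda>b. a * c b"]) (auto simp: algebra_simps sum_distrib_left)
qed

lemma in_span_on_sum: "(\<And>a. a \<in> A \<Longrightarrow> in_span_on Z B (f a)) \<Longrightarrow> in_span_on Z B (\<lambda>x. \<Sum>a\<in>A. f a x)"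
  by (induction A rule: infinite_finite_induct) (auto intro: in_span_on_add in_span_on_zero)

lemma in_span_on_member: "finite B \<Longrightarrow> b \<in> B \<Longrightarrow> in_span_on Z B b"
  unfolding in_span_on_def
  by (intro exI[of _ "\<lambda>b'. if b' = b then 1 else 0"])
    (auto simp: if_distrib[of "\<lambda>u. u * _"] sum.delta cong: if_cong)

lemma in_span_on_cong: "in_span_on Z B f \<Longrightarrow> (\<And>x. x \<in> Z \<Longrightarrow> g x = f x) \<Longrightarrow> in_span_on Z B g"
  unfolding in_span_on_def by simp

lemma in_span_on_trans:
  assumes "in_span_on Z B f" "\<And>b. b \<in> B \<Longrightarrow> in_span_on Z B' (\<lambda>x. b x * h x)"
  shows "in_span_on Z B' (\<lambda>x. f x * h x)"
proof -
  obtain c where "\<forall>x\<in>Z. f x = (\<Sum>b\<in>B. c b * b x)" using assms(1) unfolding in_span_on_def by blast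
  moreover have "in_span_on Z B' (\<lambda>x. \<Sum>b\<in>B. c b * (b x * h x))"
    by (intro in_span_on_sum in_span_on_cmult assms(2))
  ultimately show ?thesis
    by (elim in_span_on_cong) (simp add: sum_distrib_right mult.assoc)
qed

text \<open>
  The common factor \<open>u\<close> clears the denominators that come from solving an algebraic equation for a
  variable.
\<close>

definition growth :: "'i set \<Rightarrow> ('i \<Rightarrow> real) set \<Rightarrow> 'i set \<Rightarrow> nat \<Rightarrow> bool" where
  "growth I Z J r \<longleftrightarrow> (\<exists>C. \<forall>D. \<exists>u B. poly_fun I u \<and> (\<exists>x\<in>Z. u x \<noteq> 0) \<and> finite B \<and>
     card B \<le> C * (D + 1) ^ r \<and> (\<forall>p. poly_deg J D p \<longrightarrow> in_span_on Z B (\<lambda>x. u x * p x)))"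

lemma poly_deg_empty: "poly_deg {} D p \<Longrightarrow> \<exists>c. p = (\<lambda>_. c)"
  by (induction rule: poly_deg.induct) auto

lemma growth_empty:
  assumes "Z \<noteq> {}"
  shows "growth I Z {} 0"
  unfolding growth_def
proof (intro exI[of _ 1] allI exI[of _ "\<lambda>_. 1"] exI[of _ "{\<lambda>_. 1}"] conjI impI)
  fix D p assume "poly_deg {} D (p :: ('a \<Rightarrow> real) \<Rightarrow> real)"
  then obtain c where "p = (\<lambda>_. c)" using poly_deg_empty by blast
  then show "in_span_on Z {\<lambda>_. 1} (\<lambda>x. 1 * p x)"
    unfolding in_span_on_def by (intro exI[of _ "\<lambda>_. c"]) simp
qed (use assms in \<open>auto intro: poly_fun.const\<close>)

text \<open>Each basis function may be multiplied by one of the D + 1 powers of the new variable,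
  which raises the exponent by one; the denominator u stays the same.\<close>

lemma growth_insert:
  assumes "growth I Z J r"
  shows "growth I Z (insert t J) (Suc r)"
proof -
  from assms obtain C where C: "\<And>D. \<exists>u B. poly_fun I u \<and> (\<exists>x\<in>Z. u x \<noteq> 0) \<and> finite B \<and>
     card B \<le> C * (D + 1) ^ r \<and> (\<forall>p. poly_deg J D p \<longrightarrow> in_span_on Z B (\<lambda>x. u x * p x))"
    unfolding growth_def by blast
  show ?thesis unfolding growth_def
  proof (intro exI[of _ C] allI)
    fix D
    from C[of D] obtain u B where u: "poly_fun I u" "\<exists>x\<in>Z. u x \<noteq> 0" and B: "finite B"
      "card B \<le> C * (D + 1) ^ r" and span: "\<And>p. poly_deg J D p \<Longrightarrow> in_span_on Z B (\<lambda>x. u x * p x)"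
      by blast
    let ?B = "(\<lambda>(b, j) x. b x * x t ^ j) ` (B \<times> {..D})"
    have "card ?B \<le> card (B \<times> {..D})" using B(1) by (intro card_image_le) auto
    also have "\<dots> = card B * (D + 1)" by (simp add: card_cartesian_product)
    also have "\<dots> \<le> C * (D + 1) ^ r * (D + 1)" using B(2) by (rule mult_le_mono1)
    also have "\<dots> = C * (D + 1) ^ Suc r" by (simp only: power_Suc mult_ac)
    finally have card: "card ?B \<le> C * (D + 1) ^ Suc r" .
    have "in_span_on Z ?B (\<lambda>x. u x * p x)" if p: "poly_deg (insert t J) D p" for p
    proof -
      from poly_deg_decompose[OF p] obtain q where q: "\<forall>j. poly_deg J D (q j)"
        "\<forall>x. p x = (\<Sum>j\<le>D. q j x * x t ^ j)" by blast
      have "in_span_on Z ?B (\<lambda>x. \<Sum>j\<le>D. (u x * q j x) * x t ^ j)"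
      proof (intro in_span_on_sum)
        fix j assume j: "j \<in> {..D}"
        show "in_span_on Z ?B (\<lambda>x. (u x * q j x) * x t ^ j)"
        proof (rule in_span_on_trans[OF span])
          show "poly_deg J D (q j)" using q by blast
          show "in_span_on Z ?B (\<lambda>x. b x * x t ^ j)" if "b \<in> B" for b
            using that j B(1) by (intro in_span_on_member) (auto intro!: image_eqI[of _ _ "(b, j)"])
        qed
      qed
      then show ?thesis
        by (rule in_span_on_cong) (simp add: q(2) sum_distrib_left mult.assoc)
    qed
    then show "\<exists>u B. poly_fun I u \<and> (\<exists>x\<in>Z. u x \<noteq> 0) \<and> finite B \<and> card B \<le> C * (D + 1) ^ Suc r \<and>
       (\<forall>p. poly_deg (insert t J) D p \<longrightarrow> in_span_on Z B (\<lambda>x. u x * p x))"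
      using u B(1) card by (intro exI[of _ u] exI[of _ ?B]) auto
  qed
qed

text \<open>An algebraic variable does not raise the exponent: its powers reduce to those below e.
  Each reduction costs a factor q e, collected in the denominator, and increases the degree in J by
  at most E, so degrees grow only linearly in D. Primeness of Z keeps the new denominator from
  vanishing identically.\<close>

lemma growth_insert_algebraic:
  assumes g: "growth I Z J r" and Z: "prime_set I Z" and alg: "algebraic_over Z J t" and "J \<subseteq> I"
  shows "growth I Z (insert t J) r"
proof -
  from g obtain C where C: "\<And>D. \<exists>u B. poly_fun I u \<and> (\<exists>x\<in>Z. u x \<noteq> 0) \<and> finite B \<and>
     card B \<le> C * (D + 1) ^ r \<and> (\<forall>p. poly_deg J D p \<longrightarrow> in_span_on Z B (\<lambda>x. u x * p x))"
    unfolding growth_def by blast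
  from alg obtain e q where q: "\<forall>j\<le>e. poly_fun J (q j)"
    and rel: "\<forall>x\<in>Z. (\<Sum>j\<le>e. q j x * x t ^ j) = 0" and qe: "\<exists>x\<in>Z. q e x \<noteq> 0"
    unfolding algebraic_over_def by blast
  have e: "e > 0" using rel qe by (cases e) auto
  have "\<exists>E. \<forall>j\<le>e. poly_deg J E (q j)"
  proof -
    have "\<forall>j. \<exists>E. j \<le> e \<longrightarrow> poly_deg J E (q j)" using q poly_fun_imp_poly_deg by blast
    then obtain E where E: "\<And>j. j \<le> e \<Longrightarrow> poly_deg J (E j) (q j)" by metis
    have "poly_deg J (\<Sum>i\<le>e. E i) (q j)" if "j \<le> e" for j
      using E[OF that] by (rule poly_deg_mono) (use that in \<open>auto intro!: member_le_sum\<close>)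
    then show ?thesis by blast
  qed
  then obtain E where E: "\<And>j. j \<le> e \<Longrightarrow> poly_deg J E (q j)" by blast
  have lead: "q e x * x t ^ e = - (\<Sum>j<e. q j x * x t ^ j)" if "x \<in> Z" for x
    using rel that by (simp add: lessThan_Suc_atMost[symmetric] add_eq_0_iff2 algebra_simps)
  \<comment> \<open>One factor of the leading coefficient q e pays for lowering the power of x t
    once, hence m \<le> n.\<close>
  have red: "\<exists>w. (\<forall>j. poly_deg J (n * E) (w j)) \<and>
      (\<forall>x\<in>Z. q e x ^ n * x t ^ m = (\<Sum>j<e. w j x * x t ^ j))" if "m \<le> n" for n m
    using that
  proof (induction m arbitrary: n)
    case 0
    show ?case
    proof (intro exI[of _ "\<lambda>j x. if j = 0 then q e x ^ n else 0"] conjI allI ballI)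
      fix j show "poly_deg J (n * E) (\<lambda>x. if j = 0 then q e x ^ n else 0)"
        using poly_deg_power[OF E[OF order_refl], of n] by (cases "j = 0") (auto intro: poly_deg.const)
    qed (use e in \<open>auto simp: if_distrib[of "\<lambda>u. u * _"] sum.delta cong: if_cong\<close>)
  next
    case (Suc m)
    then obtain n' where n': "n = Suc n'" "m \<le> n'" by (cases n) auto
    from Suc.IH[OF n'(2)] obtain w where w: "\<And>j. poly_deg J (n' * E) (w j)"
      "\<And>x. x \<in> Z \<Longrightarrow> q e x ^ n' * x t ^ m = (\<Sum>j<e. w j x * x t ^ j)" by blast
    obtain e' where e': "e = Suc e'" using e by (cases e) auto
    \<comment> \<open>Multiplication by x t shifts the coefficients up by one; the overflow w e' * x
      t ^ e is rewritten with \<open>lead\<close>.\<close>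
    let ?w = "\<lambda>j x. (if j = 0 then 0 else q e x * w (j - 1) x) + (- 1) * (w e' x * q j x)"
    have dw1: "poly_deg J (n * E) (\<lambda>x. q e x * w j x)" for j
      using poly_deg.mult[OF E[OF order_refl] w(1)] n' by simp
    have dw2: "poly_deg J (n * E) (\<lambda>x. w e' x * q j x)" if "j \<le> e" for j
      using poly_deg.mult[OF w(1) E[OF that]] n' by (simp add: add.commute)
    have dw: "poly_deg J (n * E) (?w j)" if "j \<le> e" for j
    proof (rule poly_deg.add)
      show "poly_deg J (n * E) (\<lambda>x. if j = 0 then 0 else q e x * w (j - 1) x)"
        using dw1
        by (cases "j = 0") (auto intro: poly_deg.const)
      show "poly_deg J (n * E) (\<lambda>x. (- 1) * (w e' x * q j x))"
        using poly_deg.mult[OF poly_deg.const[of _ 0 "-1"] dw2[OF that]] by simp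
    qed
    define w' where "w' = (\<lambda>j. if j \<le> e then ?w j else (\<lambda>_. 0))"
    have "q e x ^ n * x t ^ Suc m = (\<Sum>j<e. w' j x * x t ^ j)" if x: "x \<in> Z" for x
    proof -
      have "q e x ^ n * x t ^ Suc m = q e x * x t * (q e x ^ n' * x t ^ m)"
        by (simp add: n' algebra_simps)
      also have "\<dots> = (\<Sum>j<e. q e x * w j x * x t ^ Suc j)"
        using w(2)[OF x] by (simp add: sum_distrib_left algebra_simps)
      also have "\<dots> = (\<Sum>j<e'. q e x * w j x * x t ^ Suc j) + w e' x * (q e x * x t ^ e)"
        by (simp add: e')
      also have "\<dots> = (\<Sum>j<e'. q e x * w j x * x t ^ Suc j) - (\<Sum>j<e. w e' x * q j x * x t ^ j)"
        by (simp add: lead[OF x] sum_distrib_left mult.assoc)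
      also have "(\<Sum>j<e'. q e x * w j x * x t ^ Suc j) =
          (\<Sum>j<e. (if j = 0 then 0 else q e x * w (j - 1) x) * x t ^ j)"
        unfolding e' sum.lessThan_Suc_shift by simp
      also have "\<dots> - (\<Sum>j<e. w e' x * q j x * x t ^ j) = (\<Sum>j<e. w' j x * x t ^ j)"
        unfolding sum_subtractf[symmetric]
        by (rule sum.cong) (auto simp: w'_def algebra_simps)
      finally show ?thesis .
    qed
    moreover have "poly_deg J (n * E) (w' j)" for j
      using dw by (auto simp: w'_def intro: poly_deg.const)
    ultimately show ?case by (intro exI[of _ w']) auto
  qed
  show ?thesis unfolding growth_def
  \<comment> \<open>The factor e counts the surviving powers of x t, and (E + 1) ^ r comes from D +
    D * E + 1 \<le> (E + 1) * (D + 1).\<close>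
  proof (intro exI[of _ "e * C * (E + 1) ^ r"] allI)
    fix D
    let ?D = "D + D * E"
    from C[of ?D] obtain u B where u: "poly_fun I u" "\<exists>x\<in>Z. u x \<noteq> 0" and B: "finite B"
      "card B \<le> C * (?D + 1) ^ r" and span: "\<And>p. poly_deg J ?D p \<Longrightarrow> in_span_on Z B (\<lambda>x. u x * p x)"
      by blast
    let ?B = "(\<lambda>(b, j) x. b x * x t ^ j) ` (B \<times> {..<e})"
    let ?u = "\<lambda>x. u x * q e x ^ D"
    have qI: "poly_fun I (\<lambda>x. q e x ^ D)"
      using q \<open>J \<subseteq> I\<close> by (intro poly_fun_power) (auto intro: poly_fun_mono)
    have u': "poly_fun I ?u" "\<exists>x\<in>Z. ?u x \<noteq> 0"
      using prime_set_mult[OF Z u(1) qI u(2)] qe u(1) qI by (auto intro: poly_fun.mult)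
    have "card ?B \<le> card (B \<times> {..<e})" using B(1) by (intro card_image_le) auto
    also have "\<dots> = e * card B" by (simp add: card_cartesian_product)
    also have "\<dots> \<le> e * (C * (?D + 1) ^ r)" using B(2) by simp
    also have "\<dots> \<le> e * (C * ((E + 1) * (D + 1)) ^ r)"
      by (intro mult_le_mono2 power_mono) (auto simp: algebra_simps)
    also have "\<dots> = e * C * (E + 1) ^ r * (D + 1) ^ r" by (simp only: power_mult_distrib mult.assoc)
    finally have card: "card ?B \<le> e * C * (E + 1) ^ r * (D + 1) ^ r" .
    have "in_span_on Z ?B (\<lambda>x. ?u x * p x)" if p: "poly_deg (insert t J) D p" for p
    proof -
      from poly_deg_decompose[OF p] obtain a where a: "\<forall>j. poly_deg J D (a j)"
        "\<forall>x. p x = (\<Sum>j\<le>D. a j x * x t ^ j)" by blast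
      have "in_span_on Z ?B (\<lambda>x. \<Sum>m\<le>D. u x * a m x * (q e x ^ D * x t ^ m))"
      proof (intro in_span_on_sum)
        fix m assume "m \<in> {..D}"
        then obtain w where w: "\<forall>j. poly_deg J (D * E) (w j)"
          "\<forall>x\<in>Z. q e x ^ D * x t ^ m = (\<Sum>j<e. w j x * x t ^ j)" using red by blast
        have "in_span_on Z ?B (\<lambda>x. \<Sum>j<e. (u x * (a m x * w j x)) * x t ^ j)"
        proof (intro in_span_on_sum in_span_on_trans[OF span])
          show "poly_deg J ?D (\<lambda>x. a m x * w j x)" for j
            using a w by (intro poly_deg.mult) auto
          show "in_span_on Z ?B (\<lambda>x. b x * x t ^ j)" if "b \<in> B" "j \<in> {..<e}" for b j
            using that B(1) by (intro in_span_on_member) (auto intro!: image_eqI[of _ _ "(b, j)"])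
        qed
        then show "in_span_on Z ?B (\<lambda>x. u x * a m x * (q e x ^ D * x t ^ m))"
          by (rule in_span_on_cong) (simp add: w(2) sum_distrib_left mult.assoc)
      qed
      then show ?thesis
        by (rule in_span_on_cong) (simp add: a(2) sum_distrib_left mult_ac)
    qed
    then show "\<exists>u B. poly_fun I u \<and> (\<exists>x\<in>Z. u x \<noteq> 0) \<and> finite B \<and>
       card B \<le> e * C * (E + 1) ^ r * (D + 1) ^ r \<and>
       (\<forall>p. poly_deg (insert t J) D p \<longrightarrow> in_span_on Z B (\<lambda>x. u x * p x))"
      using u' B(1) card by (intro exI[of _ ?u] exI[of _ ?B]) auto
  qed
qed

text \<open>The products of the p i with all exponents at most D are linearly independent on Z d. In
  a relation among them, the lowest power of the last p can be cancelled by primeness, and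
  restriction to the previous set of the chain, where this p vanishes, leaves a relation among
  products of the other ones. The exponents are the digits of k in base D + 1.\<close>

lemma chain_imp_independent_family:
  assumes "\<forall>i\<le>d. prime_set I (Z i)" "\<forall>i<d. Z i \<subseteq> Z (Suc i)"
    and "\<forall>i<d. poly_deg I E (p i) \<and> (\<forall>x\<in>Z i. p i x = 0) \<and> (\<exists>x\<in>Z (Suc i). p i x \<noteq> 0)"
  shows "\<exists>F. (\<forall>k. poly_deg I (d * (D * E)) (F k)) \<and>
    (\<forall>c. (\<forall>x\<in>Z d. (\<Sum>k<(D + 1) ^ d. c k * F k x) = 0) \<longrightarrow> (\<forall>k<(D + 1) ^ d. c k = (0::real)))"
  using assms
proof (induction d)
  case 0
  then have "Z 0 \<noteq> {}" by (simp add: prime_set_def)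
  then show ?case by (intro exI[of _ "\<lambda>_ _. 1"]) (auto intro: poly_deg.const)
next
  case (Suc d)
  let ?M = "(D + 1) ^ d"
  obtain F where F: "\<And>k. poly_deg I (d * (D * E)) (F k)"
    and ind: "\<And>c. (\<forall>x\<in>Z d. (\<Sum>k<?M. c k * F k x) = 0) \<Longrightarrow> (\<forall>k<?M. c k = (0::real))"
    using Suc.IH Suc.prems by auto
  have M: "?M > 0" by simp
  have pd: "poly_deg I E (p d)" and pd0: "\<And>x. x \<in> Z d \<Longrightarrow> p d x = 0" and pd1: "\<exists>x\<in>Z (Suc d). p d x \<noteq> 0"
    and sub: "Z d \<subseteq> Z (Suc d)" and pr: "prime_set I (Z (Suc d))"
    using Suc.prems by auto
  \<comment> \<open>The leading digit of k is the exponent of p d. Capping it at D makes the degree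
    bound hold for every k, also beyond the range of the sum.\<close>
  let ?F = "\<lambda>k x. F (k mod ?M) x * p d x ^ min D (k div ?M)"
  show ?case
  proof (intro exI[of _ ?F] conjI allI impI)
    fix k
    have "poly_deg I (D * E) (\<lambda>x. p d x ^ min D (k div ?M))"
      using poly_deg_power[OF pd, of "min D (k div ?M)"]
      by (rule poly_deg_mono) (simp add: mult_le_mono1)
    then show "poly_deg I (Suc d * (D * E)) (?F k)"
      using poly_deg.mult[OF F] by (simp add: add.commute)
  next
    fix c :: "nat \<Rightarrow> real" and k
    assume c: "\<forall>x\<in>Z (Suc d). (\<Sum>k<(D + 1) ^ Suc d. c k * ?F k x) = 0" and k: "k < (D + 1) ^ Suc d"
    define A where "A m x = (\<Sum>k<?M. c (m * ?M + k) * F k x)" for m x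
    have A: "poly_fun I (A m)" for m
      unfolding A_def by (intro poly_fun_sum poly_fun_cmult poly_deg_imp_poly_fun[OF F])
    have total: "(\<Sum>m<D + 1. A m x * p d x ^ m) = 0" if "x \<in> Z (Suc d)" for x
    proof -
      have "(\<Sum>k<(D + 1) * ?M. c k * ?F k x) = (\<Sum>m<D + 1. \<Sum>k\<in>{m * ?M..<m * ?M + ?M}. c k * ?F k x)"
        by (rule sum.nat_group[symmetric])
      also have "\<dots> = (\<Sum>m<D + 1. A m x * p d x ^ m)"
      proof (rule sum.cong[OF refl])
        fix m assume m: "m \<in> {..<D + 1}"
        have "(\<Sum>k\<in>{m * ?M..<m * ?M + ?M}. c k * ?F k x) = (\<Sum>k\<in>{0..<?M}. c (k + m * ?M) * ?F (k + m * ?M) x)"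
          using sum.shift_bounds_nat_ivl[of "\<lambda>k. c k * ?F k x" 0 "m * ?M" ?M] by (simp add: add.commute)
        also have "\<dots> = (\<Sum>k\<in>{0..<?M}. c (m * ?M + k) * F k x * p d x ^ m)"
        proof (rule sum.cong[OF refl])
          fix k assume "k \<in> {0..<?M}"
          then have k: "(k + m * ?M) mod ?M = k" "(k + m * ?M) div ?M = m" using M by auto
          have "min D m = m" using m by auto
          then show "c (k + m * ?M) * ?F (k + m * ?M) x = c (m * ?M + k) * F k x * p d x ^ m"
            unfolding k by (simp add: add.commute)
        qed
        also have "\<dots> = A m x * p d x ^ m"
          by (simp add: A_def sum_distrib_right atLeast0LessThan)
        finally show "(\<Sum>k\<in>{m * ?M..<m * ?M + ?M}. c k * ?F k x) = A m x * p d x ^ m" .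
      qed
      finally show ?thesis using c that by simp
    qed
    have zero: "\<forall>k<?M. c (m * ?M + k) = 0" if "m \<le> D" for m
      using that
    proof (induction m rule: less_induct)
      case (less m)
      have A0: "A m' x = 0" if "m' < m" for m' x
        using less.IH[OF that] less.prems that by (simp add: A_def)
      \<comment> \<open>The relation divided by p d ^ m; the truncated differences m' - m with m' <
        m come with a coefficient A m' that is already zero. Primeness yields that ?S vanishes on Z
        (Suc d), and on Z d only its term A m remains.\<close>
      let ?S = "\<lambda>x. \<Sum>m'<D + 1. A m' x * p d x ^ (m' - m)"
      have "p d x ^ m * ?S x = 0" if "x \<in> Z (Suc d)" for x
      proof -
        have "p d x ^ m * ?S x = (\<Sum>m'<D + 1. A m' x * p d x ^ m')"
          unfolding sum_distrib_left
        proof (rule sum.cong[OF refl])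
          fix m'
          show "p d x ^ m * (A m' x * p d x ^ (m' - m)) = A m' x * p d x ^ m'"
          proof (cases "m' < m")
            case False
            then have "p d x ^ m' = p d x ^ m * p d x ^ (m' - m)" by (simp add: power_add[symmetric])
            then show ?thesis by simp
          qed (simp add: A0)
        qed
        then show ?thesis using total[OF that] by simp
      qed
      moreover have "poly_fun I ?S"
        by (intro poly_fun_sum poly_fun.mult A poly_fun_power poly_deg_imp_poly_fun[OF pd])
      moreover have "poly_fun I (\<lambda>x. p d x ^ m)"
        by (intro poly_fun_power poly_deg_imp_poly_fun[OF pd])
      moreover have "\<exists>x\<in>Z (Suc d). p d x ^ m \<noteq> 0" using pd1 by auto
      ultimately have S: "\<forall>x\<in>Z (Suc d). ?S x = 0" using prime_set_mult[OF pr] by blast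
      have "A m x = 0" if "x \<in> Z d" for x
      proof -
        have "?S x = (\<Sum>m'<D + 1. if m' = m then A m x else 0)"
        proof (rule sum.cong[OF refl])
          fix m'
          show "A m' x * p d x ^ (m' - m) = (if m' = m then A m x else 0)"
            using pd0[OF that] by (cases m' m rule: linorder_cases) (auto simp: A0)
        qed
        also have "\<dots> = A m x" using less.prems by simp
        finally show ?thesis using S that sub by auto
      qed
      then show ?case by (intro ind) (auto simp: A_def)
    qed
    have "k div ?M \<le> D" using k M by (simp add: less_mult_imp_div_less flip: less_Suc_eq_le)
    moreover have "k mod ?M < ?M" using M by simp
    ultimately show "c k = 0" using zero[of "k div ?M"] by (metis div_mult_mod_eq)
  qed
qed

lemma algebraic_subset: "algebraic I A \<Longrightarrow> A \<subseteq> coord_space I"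
  unfolding algebraic_def by auto

lemma algebraic_separates:
  assumes "algebraic I A" "x \<in> coord_space I" "x \<notin> A"
  shows "\<exists>p. poly_fun I p \<and> (\<forall>y\<in>A. p y = 0) \<and> p x \<noteq> 0"
  using assms unfolding algebraic_def by auto

text \<open>Comparison of two counts for large D: the chain provides (D + 1) ^ d independent
  functions of degree O(D), while after multiplication by u these lie in a space of dimension O((D +
  1) ^ r). If d > r, some combination becomes zero after multiplication by u, and u can be cancelled
  because Z d is prime.\<close>

lemma chain_length_le_growth:
  assumes irr: "\<forall>i\<le>d. irreducible_algebraic I (Z i)" and strict: "\<forall>i<d. Z i \<subset> Z (Suc i)"
    and g: "growth I (Z d) I r"
  shows "d \<le> r"
proof (rule ccontr)
  assume "\<not> d \<le> r"
  then have rd: "Suc r \<le> d" by simp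
  have pr: "\<forall>i\<le>d. prime_set I (Z i)" using irr irreducible_imp_prime_set by blast
  have "\<exists>p. poly_fun I p \<and> (\<forall>x\<in>Z i. p x = 0) \<and> (\<exists>x\<in>Z (Suc i). p x \<noteq> 0)" if i: "i < d" for i
  proof -
    have "algebraic I (Z i)" "algebraic I (Z (Suc i))" using irr i unfolding irreducible_algebraic_def by auto
    moreover obtain x where "x \<in> Z (Suc i)" "x \<notin> Z i" using strict i by blast
    ultimately show ?thesis
      using algebraic_separates[of I "Z i" x] algebraic_subset[of I "Z (Suc i)"] by blast
  qed
  note ex = this
  define p where "p i = (SOME p. poly_fun I p \<and> (\<forall>x\<in>Z i. p x = 0) \<and> (\<exists>x\<in>Z (Suc i). p x \<noteq> 0))" for i
  have p: "poly_fun I (p i) \<and> (\<forall>x\<in>Z i. p i x = 0) \<and> (\<exists>x\<in>Z (Suc i). p i x \<noteq> 0)" if "i < d" for i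
    unfolding p_def by (rule someI_ex[OF ex[OF that]])
  define E where "E i = (SOME E. poly_deg I E (p i))" for i
  have E: "poly_deg I (E i) (p i)" if "i < d" for i
    unfolding E_def by (rule someI_ex[OF poly_fun_imp_poly_deg]) (use p[OF that] in \<open>rule conjunct1\<close>)
  define E' where "E' = (\<Sum>i<d. E i)"
  have E': "poly_deg I E' (p i)" if "i < d" for i
    using E[OF that] by (rule poly_deg_mono) (use that in \<open>auto simp: E'_def intro!: member_le_sum\<close>)
  from g obtain C where C: "\<And>D. \<exists>u B. poly_fun I u \<and> (\<exists>x\<in>Z d. u x \<noteq> 0) \<and> finite B \<and>
     card B \<le> C * (D + 1) ^ r \<and> (\<forall>p. poly_deg I D p \<longrightarrow> in_span_on (Z d) B (\<lambda>x. u x * p x))"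
    unfolding growth_def by blast
  \<comment> \<open>With this D the bound on card B becomes D * (D + 1) ^ r, which is less than (D +
    1) ^ Suc r.\<close>
  define D where "D = C * (d * E' + 1) ^ r"
  have "\<exists>F. (\<forall>k. poly_deg I (d * (D * E')) (F k)) \<and>
    (\<forall>c. (\<forall>x\<in>Z d. (\<Sum>k<(D + 1) ^ d. c k * F k x) = 0) \<longrightarrow> (\<forall>k<(D + 1) ^ d. c k = (0::real)))"
    by (rule chain_imp_independent_family[OF pr, of E' p]) (use strict p E' in auto)
  then obtain F where F: "\<And>k. poly_deg I (d * (D * E')) (F k)"
    and ind: "\<And>c. (\<forall>x\<in>Z d. (\<Sum>k<(D + 1) ^ d. c k * F k x) = 0) \<Longrightarrow> (\<forall>k<(D + 1) ^ d. c k = (0::real))"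
    by blast
  from C[of "d * (D * E')"] obtain u B where u: "poly_fun I u" "\<exists>x\<in>Z d. u x \<noteq> 0" and B: "finite B"
      "card B \<le> C * (d * (D * E') + 1) ^ r"
      and span: "\<And>p. poly_deg I (d * (D * E')) p \<Longrightarrow> in_span_on (Z d) B (\<lambda>x. u x * p x)"
      by blast
  have "card B \<le> C * ((d * E' + 1) * (D + 1)) ^ r"
    using B(2) by (rule order_trans) (intro mult_le_mono2 power_mono, auto simp: algebra_simps)
  also have "\<dots> = D * (D + 1) ^ r" by (simp only: D_def power_mult_distrib mult.assoc)
  also have "\<dots> < (D + 1) ^ Suc r" by simp
  also have "\<dots> \<le> (D + 1) ^ d" using rd by (intro power_increasing) auto
  finally have card: "card B < card {..<(D + 1) ^ d}" by simp
  define a where "a k = (SOME a. \<forall>x\<in>Z d. u x * F k x = (\<Sum>b\<in>B. a b * b x))" for k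
  have ex: "\<exists>a. \<forall>x\<in>Z d. u x * F k x = (\<Sum>b\<in>B. a b * b x)" for k
    by (rule span[OF F, unfolded in_span_on_def])
  have "\<forall>x\<in>Z d. u x * F k x = (\<Sum>b\<in>B. a k b * b x)" for k
    unfolding a_def by (rule someI_ex[OF ex])
  then have a: "u x * F k x = (\<Sum>b\<in>B. a k b * b x)" if "x \<in> Z d" for k x using that by simp
  obtain c where c: "\<exists>k<(D + 1) ^ d. c k \<noteq> 0" "\<And>b. b \<in> B \<Longrightarrow> (\<Sum>k<(D + 1) ^ d. a k b * c k) = 0"
    using nontrivial_solution[OF B(1) _ card, of "\<lambda>b k. a k b"] by auto
  let ?S = "\<lambda>x. \<Sum>k<(D + 1) ^ d. c k * F k x"
  have "u x * ?S x = 0" if x: "x \<in> Z d" for x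
  proof -
    have "u x * ?S x = (\<Sum>k<(D + 1) ^ d. c k * (u x * F k x))"
      unfolding sum_distrib_left by (simp only: mult.left_commute)
    also have "\<dots> = (\<Sum>k<(D + 1) ^ d. \<Sum>b\<in>B. (a k b * c k) * b x)"
      unfolding a[OF x] sum_distrib_left by (simp only: mult_ac)
    also have "\<dots> = (\<Sum>b\<in>B. (\<Sum>k<(D + 1) ^ d. a k b * c k) * b x)"
      unfolding sum_distrib_right by (rule sum.swap)
    also have "\<dots> = 0" using c(2) by simp
    finally show ?thesis .
  qed
  moreover have "poly_fun I ?S"
    by (intro poly_fun_sum poly_fun_cmult poly_deg_imp_poly_fun[OF F])
  ultimately have S0: "\<forall>x\<in>Z d. ?S x = 0"
    using prime_set_mult[of I "Z d" u ?S] pr u by auto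
  show False using ind[OF S0] c(1) by auto
qed

section \<open>Conditions on the fibres over lower coordinates\<close>

lemma poly_fun_cong:
  assumes "poly_fun J p" "\<And>i. i \<in> J \<Longrightarrow> x i = y i"
  shows "p x = p y"
  using assms by (induction rule: poly_fun.induct) auto

lemma growth_union:
  assumes "finite V" "growth I Z J r"
  shows "growth I Z (J \<union> V) (r + card V)"
  using assms by (induction V rule: finite_induct) (auto dest: growth_insert)

text \<open>If some variable of V is algebraic over J and the variables adjoined before it,
  adjoining V costs one exponent less than card V. Otherwise the variables of V are independent over
  J, so every relation valid on Z has coefficients vanishing on Z and therefore holds on the entire
  fibre over the J-coordinates of any point of Z.\<close>

lemma growth_union_or_free:
  assumes "finite V" "J \<inter> V = {}" "growth I Z J r" "prime_set I Z" "J \<union> V \<subseteq> I"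
  shows "(V \<noteq> {} \<and> growth I Z (J \<union> V) (r + card V - 1)) \<or>
    (\<forall>p x y. poly_fun (J \<union> V) p \<longrightarrow> (\<forall>x\<in>Z. p x = 0) \<longrightarrow> x \<in> Z \<longrightarrow> (\<forall>i\<in>J. y i = x i) \<longrightarrow> p y = 0)"
  using assms
proof (induction V rule: finite_induct)
  case empty
  have "p y = 0" if "poly_fun J p" "\<forall>x\<in>Z. p x = 0" "x \<in> Z" "\<forall>i\<in>J. y i = x i" for p x y
    using poly_fun_cong[OF that(1), of y x] that by auto
  then show ?case by auto
next
  case (insert t V)
  let ?free = "\<lambda>V. \<forall>p x y. poly_fun (J \<union> V) p \<longrightarrow> (\<forall>x\<in>Z. p x = 0) \<longrightarrow> x \<in> Z \<longrightarrow> (\<forall>i\<in>J. y i = x i) \<longrightarrow> p y = 0"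
  consider (grow) "V \<noteq> {}" "growth I Z (J \<union> V) (r + card V - 1)"
    | (alg) "algebraic_over Z (J \<union> V) t" | (free) "\<not> algebraic_over Z (J \<union> V) t" "?free V"
    using insert by blast
  then show ?case
  proof cases
    case grow
    then have "card V > 0" using insert by (simp add: card_gt_0_iff)
    then have "Suc (r + card V - 1) = r + card (insert t V) - 1" using insert by simp
    then show ?thesis using growth_insert[OF grow(2), of t] by auto
  next
    case alg
    have "growth I Z (insert t (J \<union> V)) (r + card V)"
      by (rule growth_insert_algebraic[OF growth_union]) (use insert alg in auto)
    then show ?thesis using insert by simp
  next
    case free
    have "p y = 0" if p: "poly_fun (J \<union> insert t V) p" "\<forall>x\<in>Z. p x = 0" and x: "x \<in> Z" "\<forall>i\<in>J. y i = x i" for p x y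
    proof -
      have "poly_fun (insert t (J \<union> V)) p" using p(1) by simp
      from poly_fun_decompose[OF this]
      obtain D q where q: "\<forall>j. poly_fun (J \<union> V) (q j)" "\<forall>x. p x = (\<Sum>j\<le>D. q j x * x t ^ j)"
        by blast
      \<comment> \<open>Since t is not algebraic, the top coefficient of a vanishing sum vanishes on
        Z and can be removed; induction on e clears the others.\<close>
      have "(\<forall>x\<in>Z. (\<Sum>j\<le>e. q j x * x t ^ j) = 0) \<Longrightarrow> \<forall>j\<le>e. \<forall>x\<in>Z. q j x = 0" for e
      proof (induction e)
        case 0
        then show ?case by simp
      next
        case (Suc e)
        have top: "\<forall>x\<in>Z. q (Suc e) x = 0"
          using free(1) Suc.prems q(1) unfolding algebraic_over_def by blast
        then have "\<forall>x\<in>Z. (\<Sum>j\<le>e. q j x * x t ^ j) = 0" using Suc.prems by simp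
        from Suc.IH[OF this] top show ?case using le_Suc_eq by auto
      qed
      then have "\<forall>j\<le>D. \<forall>x\<in>Z. q j x = 0" using p(2) q(2) by auto
      then have "q j y = 0" if "j \<le> D" for j using free(2) q(1) x that by blast
      then show ?thesis using q(2) by simp
    qed
    then show ?thesis by blast
  qed
qed

text \<open>Every block of variables \<open>J (Suc j) - J j\<close> contains one that is algebraic over its predecessors.\<close>

lemma growth_tower:
  assumes "finite I" "\<And>j. j \<le> m \<Longrightarrow> J j \<subseteq> I" "\<And>j. j < m \<Longrightarrow> J j \<subseteq> J (Suc j)"
    and P: "\<And>j p. j < m \<Longrightarrow> p \<in> P j \<Longrightarrow> poly_fun (J (Suc j)) p"
    and fib: "\<And>j x. j < m \<Longrightarrow> \<exists>y. \<exists>p\<in>P j. (\<forall>i\<in>J j. y i = x i) \<and> p y \<noteq> 0"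
    and Z: "prime_set I Z" and van: "\<And>j p x. j < m \<Longrightarrow> p \<in> P j \<Longrightarrow> x \<in> Z \<Longrightarrow> p x = 0"
  shows "m \<le> card I \<and> growth I Z I (card I - m)"
proof -
  have step: "m' \<le> card (J m') \<and> growth I Z (J m') (card (J m') - m')" if "m' \<le> m" for m'
    using that
  proof (induction m')
    case 0
    have "Z \<noteq> {}" using Z by (simp add: prime_set_def)
    then show ?case
      using growth_union[of "J 0" I Z "{}" 0] growth_empty assms(1) assms(2)[of 0]
      by (auto intro: finite_subset)
  next
    case (Suc m')
    then have IH: "m' \<le> card (J m')" "growth I Z (J m') (card (J m') - m')" and m': "m' < m" by auto
    let ?V = "J (Suc m') - J m'"
    have fin: "finite (J (Suc m'))" using Suc.prems assms(1,2) finite_subset by metis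
    have un: "J m' \<union> ?V = J (Suc m')" using assms(3)[OF m'] by blast
    have cardV: "card (J (Suc m')) = card (J m') + card ?V"
      using fin assms(3)[OF m'] by (metis card_Un_disjoint Diff_disjoint finite_Diff finite_subset un)
    have "J (Suc m') \<subseteq> I" using assms(2) Suc.prems by blast
    obtain x where x: "x \<in> Z" using Z by (auto simp: prime_set_def)
    obtain y p where "p \<in> P m'" "\<forall>i\<in>J m'. y i = x i" "p y \<noteq> 0" using fib[OF m'] by blast
    \<comment> \<open>The given p vanishes on Z but not on the fibre over x, which excludes the free
      alternative and forces the saving of one exponent.\<close>
    then have "\<not> (\<forall>p x y. poly_fun (J m' \<union> ?V) p \<longrightarrow> (\<forall>x\<in>Z. p x = 0) \<longrightarrow> x \<in> Z \<longrightarrow> (\<forall>i\<in>J m'. y i = x i) \<longrightarrow> p y = 0)"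
      using x P[OF m'] van[OF m'] un by metis
    then have "?V \<noteq> {}" "growth I Z (J (Suc m')) (card (J m') - m' + card ?V - 1)"
      using growth_union_or_free[of ?V "J m'" I Z "card (J m') - m'"] fin IH(2) Z \<open>J (Suc m') \<subseteq> I\<close> un by auto
    moreover have "card ?V > 0" using \<open>?V \<noteq> {}\<close> fin by (simp add: card_gt_0_iff)
    ultimately show ?case using cardV IH(1) by (simp add: Suc_diff_le)
  qed
  have "finite (J m)" using assms(1,2) finite_subset by blast
  have un: "J m \<union> (I - J m) = I" using assms(2)[of m] by auto
  have "card I = card (J m) + card (I - J m)"
    using assms(1) assms(2)[of m] by (simp add: card_Diff_subset card_mono \<open>finite (J m)\<close>)
  then show ?thesis
    using growth_union[of "I - J m" I Z "J m" "card (J m) - m"] step[of m] assms(1) un by auto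
qed

text \<open>The last member of a chain of irreducible subsets of A is itself a prime set inside A,
  so its growth exponent bounds the length of the chain.\<close>

lemma algebraic_codim_ge:
  assumes "finite I"
    and "\<And>Z. prime_set I Z \<Longrightarrow> Z \<subseteq> A \<Longrightarrow> m \<le> card I \<and> growth I Z I (card I - m)"
  shows "ereal (real m) \<le> algebraic_codim I A"
proof -
  have "algebraic_dim I A \<le> ereal (real (card I) - real m)"
    unfolding algebraic_dim_def
  proof (rule Sup_least, clarify)
    fix d Z
    assume Z: "\<forall>i\<le>d. irreducible_algebraic I (Z i) \<and> Z i \<subseteq> A" and s: "\<forall>i<d. Z i \<subset> Z (Suc i)"
    then have pr: "prime_set I (Z d)" "Z d \<subseteq> A" using irreducible_imp_prime_set[of I "Z d"] by blast+
    from assms(2)[OF pr] have "m \<le> card I" "growth I (Z d) I (card I - m)" by auto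
    moreover have "d \<le> card I - m"
      using chain_length_le_growth[of d I Z] Z s calculation by auto
    ultimately show "ereal (real d) \<le> ereal (real (card I) - real m)" by simp
  qed
  then have "ereal (real (card I)) - ereal (real (card I) - real m) \<le> algebraic_codim I A"
    unfolding algebraic_codim_def by (rule ereal_minus_mono[OF order_refl])
  then show ?thesis by simp
qed

lemma truncate_in_coord_space: "truncate_jet k z \<in> coord_space (jet_indices k)"
  by (simp add: coord_space_def truncate_jet_def)

text \<open>Each stage is nontrivial on every fibre over jets of order \<open>kk j\<close>, and so
  contributes at least one to the codimension by \<open>growth_tower\<close>.\<close>

lemma proalgebraic_of_codim_infinity:
  fixes kk :: "nat \<Rightarrow> nat" and P :: "nat \<Rightarrow> ('n::finite taylor_series \<Rightarrow> real) set"
  assumes kk: "strict_mono kk"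
    and P: "\<And>j p. p \<in> P j \<Longrightarrow> poly_fun (jet_indices (kk (Suc j))) p"
    and fib: "\<And>j x. \<exists>y. \<exists>p\<in>P j. (\<forall>i\<in>jet_indices (kk j). y i = x i) \<and> p y \<noteq> 0"
  shows "proalgebraic_of_codim {z. \<forall>j. \<forall>p\<in>P j. p z = 0} \<infinity>"
proof -
  \<comment> \<open>Only the stages expressible in jets of order k. For k \<ge> \<open>kk m\<close>
    these include the first m stages, so the codimension of \<open>Y k\<close> is at least m and
    tends to infinity.\<close>
  define Q where "Q k = {p. \<exists>j. kk (Suc j) \<le> k \<and> p \<in> P j}" for k
  define Y where "Y k = {z \<in> coord_space (jet_indices k). \<forall>p\<in>Q k. p z = 0}" for k
  have mono: "jet_indices a \<subseteq> jet_indices b" if "a \<le> b" for a b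
    using that by (auto simp: jet_indices_def)
  have alg: "algebraic (jet_indices k) (Y k)" for k
    unfolding algebraic_def
  proof (intro exI[of _ "Q k"] conjI ballI)
    fix p assume "p \<in> Q k"
    then obtain j where "kk (Suc j) \<le> k" "p \<in> P j" by (auto simp: Q_def)
    then show "poly_fun (jet_indices k) p" using poly_fun_mono[OF P mono] by blast
  qed (simp add: Y_def)
  have trunc: "p (truncate_jet k z) = p z" if "p \<in> P j" "kk (Suc j) \<le> k" for p j k z
    by (rule poly_fun_cong[OF P[OF that(1)]]) (use mono[OF that(2)] in \<open>auto simp: truncate_jet_def\<close>)
  have "{z. \<forall>j. \<forall>p\<in>P j. p z = 0} = (\<Inter>k. truncate_jet k -` Y k)"
  proof (intro set_eqI iffI)
    fix z assume z: "z \<in> {z. \<forall>j. \<forall>p\<in>P j. p z = 0}"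
    have "p (truncate_jet k z) = 0" if "p \<in> P j" "kk (Suc j) \<le> k" for p j k
      using trunc[OF that] that(1) z by simp
    then show "z \<in> (\<Inter>k. truncate_jet k -` Y k)"
      by (auto simp: Y_def Q_def truncate_in_coord_space)
  next
    fix z assume z: "z \<in> (\<Inter>k. truncate_jet k -` Y k)"
    have "p z = 0" if "p \<in> P j" for p j
    proof -
      have "truncate_jet (kk (Suc j)) z \<in> Y (kk (Suc j))" using z by blast
      then have "p (truncate_jet (kk (Suc j)) z) = 0" using that unfolding Y_def Q_def by blast
      then show ?thesis using trunc[OF that order_refl] by simp
    qed
    then show "z \<in> {z. \<forall>j. \<forall>p\<in>P j. p z = 0}" by blast
  qed
  moreover have "limsup (\<lambda>k. algebraic_codim (jet_indices k) (Y k)) = \<infinity>"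
  proof -
    have ge: "ereal (real m) \<le> algebraic_codim (jet_indices k) (Y k)" if k: "kk m \<le> k" for m k
    proof (rule algebraic_codim_ge[OF finite_jet_indices])
      fix Z assume Z: "prime_set (jet_indices k) Z" "Z \<subseteq> Y k"
      have le: "kk j \<le> k" if "j \<le> m" for j
        using k that kk by (meson order_trans strict_mono_less_eq)
      show "m \<le> card (jet_indices k :: ('n \<Rightarrow> nat) set) \<and> growth (jet_indices k) Z (jet_indices k) (card (jet_indices k :: ('n \<Rightarrow> nat) set) - m)"
      proof (rule growth_tower[where J = "\<lambda>j. jet_indices (kk j)" and P = P])
        show "jet_indices (kk j) \<subseteq> jet_indices k" if "j \<le> m" for j
          by (rule mono[OF le[OF that]])
        show "jet_indices (kk j) \<subseteq> jet_indices (kk (Suc j))" for j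
          using kk by (intro mono) (simp add: strict_mono_less_eq)
        fix j p x assume *: "j < m" "p \<in> P j" "x \<in> Z"
        then have "x \<in> Y k" "p \<in> Q k" using Z(2) le[of "Suc j"] by (auto simp: Q_def)
        then show "p x = 0" by (simp add: Y_def)
      qed (use Z(1) P fib finite_jet_indices in auto)
    qed
    have "(\<lambda>k. algebraic_codim (jet_indices k) (Y k)) \<longlonglongrightarrow> \<infinity>"
      unfolding tendsto_PInfty
    proof
      fix r :: real
      obtain m :: nat where m: "r < real m" using reals_Archimedean2 by blast
      show "\<forall>\<^sub>F k in sequentially. ereal r < algebraic_codim (jet_indices k) (Y k)"
        unfolding eventually_sequentially
      proof (intro exI[of _ "kk m"] allI impI)
        fix k assume "kk m \<le> k"
        from ge[OF this] show "ereal r < algebraic_codim (jet_indices k) (Y k)"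
          using m by (metis less_ereal.simps(1) less_le_trans)
      qed
    qed
    then show ?thesis by (simp add: lim_imp_Limsup)
  qed
  ultimately show ?thesis unfolding proalgebraic_of_codim_def using alg by blast
qed

section \<open>Calculus of smooth maps\<close>

lemma frechet_derivative_cong_open:
  assumes "open U" "x \<in> U" "\<And>y. y \<in> U \<Longrightarrow> f y = g y"
  shows "frechet_derivative f (at x) = frechet_derivative g (at x)"
proof -
  have "(f has_derivative D) (at x) = (g has_derivative D) (at x)" for D
    using has_derivative_transform_within_open[OF _ assms(1,2), of f D UNIV g]
      has_derivative_transform_within_open[OF _ assms(1,2), of g D UNIV f] assms(3) by auto
  then show ?thesis by (simp add: frechet_derivative_def)
qed

lemma differentiable_cong_open:
  assumes "open U" "x \<in> U" "\<And>y. y \<in> U \<Longrightarrow> f y = g y" "f differentiable (at x)"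
  shows "g differentiable (at x)"
  using has_derivative_transform_within_open[OF _ assms(1,2), of f _ UNIV g] assms(3,4)
  unfolding differentiable_def by auto

lemma Ck_on_cong:
  assumes "open U" "\<And>x. x \<in> U \<Longrightarrow> f x = g x" "Ck_on k U f"
  shows "Ck_on k U g"
  using assms(2,3)
proof (induction k arbitrary: f g)
  case 0
  then show ?case using continuous_on_cong[of U U f g] by simp
next
  case (Suc k)
  have "g differentiable (at x)" if "x \<in> U" for x
    using differentiable_cong_open[OF assms(1) that, of f g] Suc.prems that by auto
  moreover have "Ck_on k U (\<lambda>x. frechet_derivative g (at x) v)" for v
  proof (rule Suc.IH)
    show "Ck_on k U (\<lambda>x. frechet_derivative f (at x) v)" using Suc.prems by simp
    show "frechet_derivative f (at x) v = frechet_derivative g (at x) v" if "x \<in> U" for x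
      using frechet_derivative_cong_open[OF assms(1) that, of f g] Suc.prems by simp
  qed
  ultimately show ?case by simp
qed

text \<open>Allows any explicit formula for the derivative in place of the choice operator behind
  \<open>frechet_derivative\<close>.\<close>

lemma Ck_on_SucI:
  assumes "open U" "\<And>x. x \<in> U \<Longrightarrow> (f has_derivative f' x) (at x)" "\<And>v. Ck_on k U (\<lambda>x. f' x v)"
  shows "Ck_on (Suc k) U f"
proof -
  have "f differentiable (at x)" if "x \<in> U" for x
    using assms(2)[OF that] by (auto simp: differentiable_def)
  moreover have "Ck_on k U (\<lambda>x. frechet_derivative f (at x) v)" for v
    by (rule Ck_on_cong[OF assms(1) _ assms(3)]) (simp add: frechet_derivative_at[OF assms(2)])
  ultimately show ?thesis by simp
qed

lemma Ck_on_SucD: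
  assumes "Ck_on (Suc k) U f"
  shows "x \<in> U \<Longrightarrow> (f has_derivative frechet_derivative f (at x)) (at x)"
    and "Ck_on k U (\<lambda>x. frechet_derivative f (at x) v)"
  using assms by (auto simp: frechet_derivative_works)

lemma Ck_on_Suc_imp: "Ck_on (Suc k) U f \<Longrightarrow> Ck_on k U f"
proof (induction k arbitrary: f)
  case 0
  then show ?case
    by (auto intro!: continuous_at_imp_continuous_on differentiable_imp_continuous_within)
next
  case (Suc k)
  then show ?case by (metis Ck_on.simps(2))
qed

lemma Ck_on_imp_continuous_on: "Ck_on k U f \<Longrightarrow> continuous_on U f"
  by (induction k) (auto intro: Ck_on_Suc_imp simp del: Ck_on.simps(2))

lemma Ck_on_subset: "Ck_on k U f \<Longrightarrow> V \<subseteq> U \<Longrightarrow> Ck_on k V f"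
  by (induction k arbitrary: f) (auto intro: continuous_on_subset)

lemma Ck_on_const:
  assumes "open U"
  shows "Ck_on k U (\<lambda>_. c)"
proof (induction k arbitrary: c)
  case (Suc k)
  show ?case by (rule Ck_on_SucI[OF assms has_derivative_const Suc.IH])
qed simp

lemma Ck_on_linear_compose:
  assumes "open U" "bounded_linear h" "Ck_on k U f"
  shows "Ck_on k U (\<lambda>x. h (f x))"
  using assms(3)
proof (induction k arbitrary: f)
  case 0
  then show ?case using assms(2) by (simp add: bounded_linear.continuous_on)
next
  case (Suc k)
  show ?case
    by (rule Ck_on_SucI[OF assms(1) bounded_linear.has_derivative[OF assms(2) Ck_on_SucD(1)[OF Suc.prems]]
      Suc.IH[OF Ck_on_SucD(2)[OF Suc.prems]]])
qed

lemma Ck_on_linear: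
  assumes "open U" "bounded_linear h"
  shows "Ck_on k U h"
proof -
  have "Ck_on k U (\<lambda>x. x)"
  proof (cases k)
    case (Suc k')
    show ?thesis
      unfolding Suc by (rule Ck_on_SucI[OF assms(1) has_derivative_ident Ck_on_const[OF assms(1)]])
  qed simp
  from Ck_on_linear_compose[OF assms this] show ?thesis by simp
qed

lemma Ck_on_add:
  assumes "open U" "Ck_on k U f" "Ck_on k U g"
  shows "Ck_on k U (\<lambda>x. f x + g x)"
  using assms(2,3)
proof (induction k arbitrary: f g)
  case 0
  then show ?case by (auto intro: continuous_intros)
next
  case (Suc k)
  show ?case
    by (rule Ck_on_SucI[OF assms(1) has_derivative_add[OF Ck_on_SucD(1)[OF Suc.prems(1)] Ck_on_SucD(1)[OF Suc.prems(2)]]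
      Suc.IH[OF Ck_on_SucD(2)[OF Suc.prems(1)] Ck_on_SucD(2)[OF Suc.prems(2)]]])
qed

lemma Ck_on_sum:
  assumes "open U" "\<And>a. a \<in> A \<Longrightarrow> Ck_on k U (f a)"
  shows "Ck_on k U (\<lambda>x. \<Sum>a\<in>A. f a x)"
  using assms(2) by (induction A rule: infinite_finite_induct) (auto intro: Ck_on_const Ck_on_add assms(1))

lemma Ck_on_scaleR:
  fixes f :: "'a::real_normed_vector \<Rightarrow> real"
  assumes "open U" "Ck_on k U f" "Ck_on k U g"
  shows "Ck_on k U (\<lambda>x. f x *\<^sub>R g x)"
  using assms(2,3)
proof (induction k arbitrary: f g)
  case 0
  then show ?case by (auto intro: continuous_intros)
next
  case (Suc k)
  show ?case
  proof (rule Ck_on_SucI[OF assms(1) has_derivative_scaleR[OF Ck_on_SucD(1)[OF Suc.prems(1)] Ck_on_SucD(1)[OF Suc.prems(2)]]])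
    fix v
    show "Ck_on k U (\<lambda>x. f x *\<^sub>R frechet_derivative g (at x) v + frechet_derivative f (at x) v *\<^sub>R g x)"
      by (intro Ck_on_add[OF assms(1)] Suc.IH Ck_on_SucD(2)[OF Suc.prems(1)] Ck_on_SucD(2)[OF Suc.prems(2)]
        Ck_on_Suc_imp[OF Suc.prems(1)] Ck_on_Suc_imp[OF Suc.prems(2)])
  qed
qed

lemma Ck_on_mult:
  fixes f g :: "'a::real_normed_vector \<Rightarrow> real"
  assumes "open U" "Ck_on k U f" "Ck_on k U g"
  shows "Ck_on k U (\<lambda>x. f x * g x)"
  using Ck_on_scaleR[OF assms] by simp

lemma Ck_on_diff:
  assumes "open U" "Ck_on k U f" "Ck_on k U g"
  shows "Ck_on k U (\<lambda>x. f x - g x)"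
  using Ck_on_add[OF assms(1,2) Ck_on_linear_compose[OF assms(1) _ assms(3), of uminus]]
  by (simp add: bounded_linear_minus[OF bounded_linear_ident])

lemma Ck_on_prod:
  fixes f :: "'b \<Rightarrow> 'a::real_normed_vector \<Rightarrow> real"
  assumes "open U" "\<And>a. a \<in> A \<Longrightarrow> Ck_on k U (f a)"
  shows "Ck_on k U (\<lambda>x. \<Prod>a\<in>A. f a x)"
  using assms(2) by (induction A rule: infinite_finite_induct) (auto intro: Ck_on_const Ck_on_mult assms(1))

lemma Ck_on_power:
  fixes f :: "'a::real_normed_vector \<Rightarrow> real"
  assumes "open U" "Ck_on k U f"
  shows "Ck_on k U (\<lambda>x. f x ^ n)"
  by (induction n) (auto intro: Ck_on_const Ck_on_mult assms)

lemma Ck_on_inverse: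
  fixes f :: "'a::real_normed_vector \<Rightarrow> real"
  assumes "open U" "Ck_on k U f" "\<And>x. x \<in> U \<Longrightarrow> f x \<noteq> 0"
  shows "Ck_on k U (\<lambda>x. inverse (f x))"
  using assms(2,3)
proof (induction k)
  case 0
  then show ?case by (auto intro!: continuous_intros)
next
  case (Suc k)
  have IH: "Ck_on k U (\<lambda>x. inverse (f x))" using Suc Ck_on_Suc_imp by blast
  show ?case
  proof (rule Ck_on_SucI[OF assms(1) Deriv.has_derivative_inverse[OF Suc.prems(2) Ck_on_SucD(1)[OF Suc.prems(1)]]])
    fix v
    have "Ck_on k U (\<lambda>x. 0 - (inverse (f x) * frechet_derivative f (at x) v * inverse (f x)))"
      by (intro Ck_on_diff[OF assms(1)] Ck_on_mult[OF assms(1)] IH Ck_on_SucD(2)[OF Suc.prems(1)] Ck_on_const assms(1))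
    then show "Ck_on k U (\<lambda>x. - (inverse (f x) * frechet_derivative f (at x) v * inverse (f x)))" by simp
  qed
qed

lemma Ck_on_divide:
  fixes f g :: "'a::real_normed_vector \<Rightarrow> real"
  assumes "open U" "Ck_on k U f" "Ck_on k U g" "\<And>x. x \<in> U \<Longrightarrow> g x \<noteq> 0"
  shows "Ck_on k U (\<lambda>x. f x / g x)"
  using Ck_on_mult[OF assms(1,2) Ck_on_inverse[OF assms(1,3,4)]] by (simp add: divide_inverse)

lemma vec_sum_axis: "(\<Sum>i\<in>UNIV. (v $ i) *\<^sub>R axis i 1) = (v :: real^'n)"
  by (simp add: vec_eq_iff sum_component axis_def if_distrib cong: if_cong)

lemma Ck_on_component: "open U \<Longrightarrow> Ck_on k U f \<Longrightarrow> Ck_on k U (\<lambda>x. f x $ i)"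
  by (rule Ck_on_linear_compose[OF _ bounded_linear_vec_nth])

lemma Ck_on_vec_lambda:
  fixes f :: "'n::finite \<Rightarrow> 'a::real_normed_vector \<Rightarrow> real"
  assumes "open U" "\<And>i. Ck_on k U (f i)"
  shows "Ck_on k U (\<lambda>x. \<chi> i. f i x)"
proof (rule Ck_on_cong[OF assms(1)])
  show "Ck_on k U (\<lambda>x. \<Sum>i\<in>UNIV. f i x *\<^sub>R axis i 1)"
    by (intro Ck_on_sum Ck_on_scaleR Ck_on_const assms)
  show "(\<Sum>i\<in>UNIV. f i x *\<^sub>R axis i 1) = (\<chi> i. f i x)" for x
    using vec_sum_axis[of "\<chi> i. f i x"] by simp
qed

lemma linear_sum_axis:
  fixes D :: "real^'n \<Rightarrow> 'b::real_vector"
  assumes "linear D"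
  shows "D v = (\<Sum>i\<in>UNIV. v $ i *\<^sub>R D (axis i 1))"
proof -
  have "D v = D (\<Sum>i\<in>UNIV. (v $ i) *\<^sub>R axis i 1)" by (simp add: vec_sum_axis)
  also have "\<dots> = (\<Sum>i\<in>UNIV. v $ i *\<^sub>R D (axis i 1))"
    using assms by (simp add: linear_sum linear_cmul)
  finally show ?thesis .
qed

text \<open>The chain rule gives g' at h x applied to a vector that varies with x, to which the
  induction hypothesis does not apply directly. Expanding this vector along the axes leaves sums of
  products with the derivatives of g in fixed directions, to which it does apply; this is why the
  middle space has coordinates.\<close>

lemma Ck_on_compose:
  fixes g :: "real^'n \<Rightarrow> 'b::real_normed_vector" and h :: "'a::real_normed_vector \<Rightarrow> real^'n"
  assumes "open U" "Ck_on k U h" "Ck_on k V g" "h ` U \<subseteq> V"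
  shows "Ck_on k U (\<lambda>x. g (h x))"
  using assms(2,3)
proof (induction k arbitrary: g)
  case 0
  then show ?case using continuous_on_compose2[of V g U h] assms(4) by auto
next
  case (Suc k)
  have D: "((\<lambda>x. g (h x)) has_derivative (\<lambda>v. frechet_derivative g (at (h x)) (frechet_derivative h (at x) v))) (at x)"
    if "x \<in> U" for x
    using has_derivative_compose[OF Ck_on_SucD(1)[OF Suc.prems(1) that] Ck_on_SucD(1)[OF Suc.prems(2)]] that assms(4)
    by auto
  show ?case
  proof (rule Ck_on_SucI[OF assms(1) D])
    fix v
    have "Ck_on k U (\<lambda>x. \<Sum>i\<in>UNIV. (frechet_derivative h (at x) v) $ i *\<^sub>R frechet_derivative g (at (h x)) (axis i 1))"
      by (intro Ck_on_sum Ck_on_scaleR Ck_on_component Suc.IH Ck_on_SucD(2)[OF Suc.prems(1)] Ck_on_SucD(2)[OF Suc.prems(2)]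
          assms(1) Ck_on_Suc_imp[OF Suc.prems(1)])
    then show "Ck_on k U (\<lambda>x. frechet_derivative g (at (h x)) (frechet_derivative h (at x) v))"
    proof (rule Ck_on_cong[OF assms(1), rotated])
      fix x assume "x \<in> U"
      then have "linear (frechet_derivative g (at (h x)))"
        using Ck_on_SucD(1)[OF Suc.prems(2)] assms(4) has_derivative_linear by blast
      from linear_sum_axis[OF this, of "frechet_derivative h (at x) v"]
      show "(\<Sum>i\<in>UNIV. (frechet_derivative h (at x) v) $ i *\<^sub>R frechet_derivative g (at (h x)) (axis i 1)) =
        frechet_derivative g (at (h x)) (frechet_derivative h (at x) v)" by simp
    qed
  qed
qed

lemma Ck_on_det:
  fixes A :: "'n::finite \<Rightarrow> 'n \<Rightarrow> 'a::real_normed_vector \<Rightarrow> real"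
  assumes "open U" "\<And>i j. Ck_on k U (A i j)"
  shows "Ck_on k U (\<lambda>x. det (\<chi> i j. A i j x))"
proof -
  have "Ck_on k U (\<lambda>x. \<Sum>p\<in>{p. p permutes (UNIV :: 'n set)}. of_int (sign p) * (\<Prod>i\<in>UNIV. A i (p i) x))"
    by (intro Ck_on_sum Ck_on_mult Ck_on_prod Ck_on_const assms)
  then show ?thesis by (simp add: det_def)
qed

section \<open>Smooth maps and the inverse function theorem\<close>

lemma smooth_on_frechet_derivative: "smooth_on U f \<Longrightarrow> smooth_on U (\<lambda>x. frechet_derivative f (at x) v)"
  unfolding smooth_on_def using Ck_on_SucD(2) by blast

lemma smooth_on_has_derivative:
  "smooth_on U f \<Longrightarrow> x \<in> U \<Longrightarrow> (f has_derivative frechet_derivative f (at x)) (at x)"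
  unfolding smooth_on_def using Ck_on_SucD(1) by blast

lemma smooth_on_continuous_on: "smooth_on U f \<Longrightarrow> continuous_on U f"
  unfolding smooth_on_def using Ck_on_imp_continuous_on by blast

lemma smooth_on_subset: "smooth_on U f \<Longrightarrow> V \<subseteq> U \<Longrightarrow> smooth_on V f"
  unfolding smooth_on_def using Ck_on_subset by blast

text \<open>The inverse function theorem provides a homeomorphism with a differentiable inverse. Its
  smoothness is bootstrapped: the derivative of \<psi> is rational in the entries of the Jacobian of
  \<phi> along \<psi>, so \<psi> of class k implies \<psi> of class k + 1.\<close>

theorem smooth_inverse_function:
  fixes \<phi> :: "real^'n \<Rightarrow> real^'n"
  assumes "open U" "smooth_on U \<phi>" "p \<in> U"
    and inj: "\<And>v. frechet_derivative \<phi> (at p) v = 0 \<Longrightarrow> v = 0"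
  obtains N N' \<psi> where "p \<in> N" "N \<subseteq> U" "diffeomorphism N N' \<phi> \<psi>" "\<phi> ` N = N'"
proof -
  let ?D = "\<lambda>x. frechet_derivative \<phi> (at x)"
  note D = smooth_on_has_derivative[OF assms(2)]
  have bl: "bounded_linear (?D x)" if "x \<in> U" for x
    using D[OF that] by (rule has_derivative_bounded_linear)
  define f' where "f' x = Blinfun (?D x)" for x
  have f': "blinfun_apply (f' x) = ?D x" if "x \<in> U" for x
    unfolding f'_def using bl[OF that] by (rule bounded_linear_Blinfun_apply)
  have "continuous_on U (\<lambda>x. ?D x v)" for v
    using smooth_on_continuous_on[OF smooth_on_frechet_derivative[OF assms(2)]] .
  then have "continuous_on U (\<lambda>x. blinfun_apply (f' x) v)" for v
    by (rule continuous_on_eq) (simp add: f')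
  then have contf: "continuous_on U f'" by (rule continuous_on_blinfun_componentwise)
  have lin: "linear (?D p)" using bl[OF assms(3)] by (rule bounded_linear.linear)
  then have "inj (?D p)" using inj linear_injective_0 by blast
  then obtain g where g: "linear g" "g \<circ> ?D p = id" using linear_injective_left_inverse[OF lin] by blast
  have "Blinfun g o\<^sub>L f' p = id_blinfun"
    by (rule blinfun_eqI)
      (use g in \<open>simp add: f'[OF assms(3)] bounded_linear_Blinfun_apply linear_conv_bounded_linear fun_eq_iff\<close>)
  moreover have "(\<phi> has_derivative blinfun_apply (f' x)) (at x)" if "x \<in> U" for x
    using D[OF that] f'[OF that] by simp
  ultimately obtain N N' \<psi> \<psi>' where N: "open N" "N \<subseteq> U" "p \<in> N" "open N'" "homeomorphism N N' \<phi> \<psi>"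
    and d\<psi>: "\<And>y. y \<in> N' \<Longrightarrow> (\<psi> has_derivative \<psi>' y) (at y)"
    and \<psi>': "\<And>y. y \<in> N' \<Longrightarrow> \<psi>' y = inv (blinfun_apply (f' (\<psi> y)))"
    and bij: "\<And>y. y \<in> N' \<Longrightarrow> bij (blinfun_apply (f' (\<psi> y)))"
    using inverse_function_theorem[OF assms(1) _ contf assms(3), of \<phi> "Blinfun g"] by metis
  have \<psi>N: "\<psi> y \<in> N" if "y \<in> N'" for y using N(5) that by (auto simp: homeomorphism_def)
  have \<psi>U: "\<psi> ` N' \<subseteq> U" using \<psi>N N(2) by blast
  define A where "A y = matrix (?D (\<psi> y))" for y
  have A: "det (A y) \<noteq> 0" "A y *v \<psi>' y v = v" if "y \<in> N'" for y v
  proof -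
    have U: "\<psi> y \<in> U" using \<psi>U that by blast
    have l: "linear (?D (\<psi> y))" using bl[OF U] by (rule bounded_linear.linear)
    have b: "bij (?D (\<psi> y))" using bij[OF that] f'[OF U] by simp
    show "det (A y) \<noteq> 0" unfolding A_def using det_nz_iff_inj[OF l] b bij_is_inj by blast
    have "A y *v \<psi>' y v = ?D (\<psi> y) (\<psi>' y v)"
      unfolding A_def using matrix_works[of "?D (\<psi> y)"] l by (simp add: linear_matrix_vector_mul_eq)
    also have "\<dots> = v" using \<psi>'[OF that] f'[OF U] b by (simp add: bij_is_surj surj_f_inv_f)
    finally show "A y *v \<psi>' y v = v" .
  qed
  have "Ck_on k N' \<psi>" for k
  proof (induction k)
    case 0
    then show ?case using N(5) by (simp add: homeomorphism_def)
  next
    case (Suc k)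
    have entry: "Ck_on k N' (\<lambda>y. ?D (\<psi> y) w $ i)" for w i
    proof (rule Ck_on_component[OF N(4)], rule Ck_on_compose[OF N(4) Suc.IH _ \<psi>U])
      show "Ck_on k U (\<lambda>x. ?D x w)"
        using smooth_on_frechet_derivative[OF assms(2)] unfolding smooth_on_def by blast
    qed
    have detA: "Ck_on k N' (\<lambda>y. det (\<chi> i j. ?D (\<psi> y) (axis j 1) $ i))"
      by (rule Ck_on_det[OF N(4) entry])
    show ?case
    proof (rule Ck_on_SucI[OF N(4) d\<psi>])
      fix v :: "real^'n"
      \<comment> \<open>The Jacobian with column l replaced by v, as in Cramer's rule for the
        component l of \<psi>' y v.\<close>
      let ?M = "\<lambda>l i j y. if j = l then v $ i else ?D (\<psi> y) (axis j 1) $ i"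
      have M: "Ck_on k N' (?M l i j)" for l i j
        using entry Ck_on_const[OF N(4)] by (cases "j = l") auto
      have "Ck_on k N' (\<lambda>y. \<chi> l. det (\<chi> i j. ?M l i j y) / det (\<chi> i j. ?D (\<psi> y) (axis j 1) $ i))"
      proof (intro Ck_on_vec_lambda Ck_on_divide N(4) Ck_on_det M entry)
        fix y assume "y \<in> N'"
        then show "det (\<chi> i j. ?D (\<psi> y) (axis j 1) $ i) \<noteq> 0" using A(1) by (simp add: A_def matrix_def)
      qed
      then show "Ck_on k N' (\<lambda>y. \<psi>' y v)"
      proof (rule Ck_on_cong[OF N(4), rotated])
        fix y assume y: "y \<in> N'"
        have "\<psi>' y v = (\<chi> l. det (\<chi> i j. if j = l then v $ i else A y $ i $ j) / det (A y))"
          using cramer[OF A(1)[OF y]] A(2)[OF y] by blast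
        then show "(\<chi> l. det (\<chi> i j. ?M l i j y) / det (\<chi> i j. ?D (\<psi> y) (axis j 1) $ i)) = \<psi>' y v"
          by (simp add: A_def matrix_def cong: if_cong)
      qed
    qed
  qed
  then have "smooth_on N' \<psi>" by (simp add: smooth_on_def)
  moreover have "smooth_on N \<phi>" using smooth_on_subset[OF assms(2) N(2)] .
  ultimately have "diffeomorphism N N' \<phi> \<psi>"
    using N unfolding diffeomorphism_def homeomorphism_def by auto
  moreover have "\<phi> ` N = N'" using N(5) by (simp add: homeomorphism_def)
  ultimately show ?thesis using that N by blast
qed

section \<open>Taylor's theorem\<close>

lemma has_derivative_partial_deriv:
  fixes f :: "real^'n \<Rightarrow> real"
  assumes "(f has_derivative D) (at x)"
  shows "D v = (\<Sum>i\<in>UNIV. v $ i * partial_deriv i f x)"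
proof -
  have "linear D" using assms by (rule has_derivative_linear)
  then show ?thesis
    using linear_sum_axis[of D v] frechet_derivative_at[OF assms] by (simp add: partial_deriv_def)
qed

lemma smooth_on_partial_deriv: "smooth_on U f \<Longrightarrow> smooth_on U (partial_deriv i f)"
  unfolding partial_deriv_def by (rule smooth_on_frechet_derivative)

lemma DERIV_along_axis:
  fixes f :: "real^'n \<Rightarrow> real"
  assumes "smooth_on U f" "p + s *\<^sub>R axis i 1 \<in> U"
  shows "((\<lambda>s. f (p + s *\<^sub>R axis i 1)) has_real_derivative partial_deriv i f (p + s *\<^sub>R axis i 1)) (at s)"
proof -
  let ?x = "p + s *\<^sub>R axis i 1"
  have f: "(f has_derivative frechet_derivative f (at ?x)) (at ?x)"
    by (rule smooth_on_has_derivative[OF assms])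
  have "((\<lambda>s. p + s *\<^sub>R axis i (1::real)) has_derivative (\<lambda>t. t *\<^sub>R axis i 1)) (at s)"
    by (auto intro!: derivative_eq_intros)
  from has_derivative_compose[OF this f]
  have "((\<lambda>s. f (p + s *\<^sub>R axis i 1)) has_derivative (\<lambda>t. frechet_derivative f (at ?x) (t *\<^sub>R axis i 1))) (at s)" .
  moreover have "frechet_derivative f (at ?x) (t *\<^sub>R axis i 1) = partial_deriv i f ?x * t" for t
    using linear_cmul[OF has_derivative_linear[OF f]] by (simp add: partial_deriv_def)
  ultimately show ?thesis by (simp add: has_field_derivative_def)
qed

text \<open>The mean value theorem along axis i and then along axis j. The left side is symmetric in
  i and j, so using it in both orders and letting h tend to 0 identifies the two mixed
  derivatives.\<close>

lemma second_difference:
  fixes f :: "real^'n \<Rightarrow> real"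
  assumes f: "smooth_on U f" and r: "cball x (2 * h) \<subseteq> U" and h: "0 < h"
  shows "\<exists>y\<in>cball x (2 * h). f (x + h *\<^sub>R axis i 1 + h *\<^sub>R axis j 1) - f (x + h *\<^sub>R axis i 1)
     - f (x + h *\<^sub>R axis j 1) + f x = h * h * partial_deriv j (partial_deriv i f) y"
proof -
  have near: "x + s *\<^sub>R axis i 1 + t *\<^sub>R axis j 1 \<in> cball x (2 * h)" if "0 \<le> s" "s \<le> h" "0 \<le> t" "t \<le> h" for s t
  proof -
    have "norm (s *\<^sub>R axis i 1 + t *\<^sub>R axis j (1::real)) \<le> s + t"
      using that norm_triangle_ineq[of "s *\<^sub>R axis i (1::real)" "t *\<^sub>R axis j 1"] by simp
    moreover have "dist x (x + s *\<^sub>R axis i 1 + t *\<^sub>R axis j 1) = norm (s *\<^sub>R axis i 1 + t *\<^sub>R axis j (1::real))"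
    proof -
      have "x - (x + s *\<^sub>R axis i 1 + t *\<^sub>R axis j 1) = - (s *\<^sub>R axis i 1 + t *\<^sub>R axis j (1::real))" by simp
      then show ?thesis unfolding dist_norm by (simp only: norm_minus_cancel)
    qed
    ultimately show ?thesis using that by simp
  qed
  let ?g = "\<lambda>s. f ((x + h *\<^sub>R axis j 1) + s *\<^sub>R axis i 1) - f (x + s *\<^sub>R axis i 1)"
  let ?g' = "\<lambda>s. partial_deriv i f ((x + h *\<^sub>R axis j 1) + s *\<^sub>R axis i 1) - partial_deriv i f (x + s *\<^sub>R axis i 1)"
  have "(?g has_real_derivative ?g' s) (at s)" if "0 \<le> s" "s \<le> h" for s
  proof (intro DERIV_diff DERIV_along_axis[OF f])
    show "x + h *\<^sub>R axis j 1 + s *\<^sub>R axis i 1 \<in> U" "x + s *\<^sub>R axis i 1 \<in> U"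
      using near[of s h] near[of s 0] that h r by (auto simp: algebra_simps)
  qed
  from MVT2[OF h this] obtain s where s: "0 < s" "s < h" "?g h - ?g 0 = h * ?g' s" by auto
  let ?k = "\<lambda>t. partial_deriv i f ((x + s *\<^sub>R axis i 1) + t *\<^sub>R axis j 1)"
  have "(?k has_real_derivative partial_deriv j (partial_deriv i f) ((x + s *\<^sub>R axis i 1) + t *\<^sub>R axis j 1)) (at t)"
    if "0 \<le> t" "t \<le> h" for t
    by (rule DERIV_along_axis[OF smooth_on_partial_deriv[OF f]]) (use near[of s t] that s r in auto)
  from MVT2[OF h this] obtain t where t: "0 < t" "t < h"
    "?k h - ?k 0 = h * partial_deriv j (partial_deriv i f) ((x + s *\<^sub>R axis i 1) + t *\<^sub>R axis j 1)" by auto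
  have "?g' s = ?k h - ?k 0" by (simp add: algebra_simps)
  then have "?g h - ?g 0 = h * h * partial_deriv j (partial_deriv i f) ((x + s *\<^sub>R axis i 1) + t *\<^sub>R axis j 1)"
    using s(3) t(3) by simp
  moreover have "?g h - ?g 0 = f (x + h *\<^sub>R axis i 1 + h *\<^sub>R axis j 1) - f (x + h *\<^sub>R axis i 1)
     - f (x + h *\<^sub>R axis j 1) + f x" by (simp add: algebra_simps)
  ultimately show ?thesis using near[of s t] s t by (intro bexI) auto
qed

lemma partial_deriv_commute:
  fixes f :: "real^'n \<Rightarrow> real"
  assumes U: "open U" "x \<in> U" and f: "smooth_on U f"
  shows "partial_deriv i (partial_deriv j f) x = partial_deriv j (partial_deriv i f) x"
proof (rule ccontr)
  let ?a = "partial_deriv i (partial_deriv j f)" and ?b = "partial_deriv j (partial_deriv i f)"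
  assume ne: "?a x \<noteq> ?b x"
  define e where "e = \<bar>?a x - ?b x\<bar> / 2"
  have e: "e > 0" using ne by (simp add: e_def)
  have cont: "isCont ?a x" "isCont ?b x"
    using smooth_on_continuous_on[OF smooth_on_partial_deriv[OF smooth_on_partial_deriv[OF f]]] U
    by (auto simp: continuous_on_eq_continuous_at)
  obtain d1 where d1: "d1 > 0" "\<And>y. dist y x < d1 \<Longrightarrow> dist (?a y) (?a x) < e"
    using cont(1) e unfolding continuous_at_eps_delta by blast
  obtain d2 where d2: "d2 > 0" "\<And>y. dist y x < d2 \<Longrightarrow> dist (?b y) (?b x) < e"
    using cont(2) e unfolding continuous_at_eps_delta by blast
  obtain d3 where d3: "d3 > 0" "ball x d3 \<subseteq> U" using U open_contains_ball by blast
  define h where "h = min d1 (min d2 d3) / 4"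
  have h: "h > 0" "2 * h < d1" "2 * h < d2" "2 * h < d3" using d1(1) d2(1) d3(1) by (auto simp: h_def)
  have sub: "cball x (2 * h) \<subseteq> U" using d3 h by (auto simp: subset_iff)
  obtain y where y: "y \<in> cball x (2 * h)" "f (x + h *\<^sub>R axis i 1 + h *\<^sub>R axis j 1) - f (x + h *\<^sub>R axis i 1)
     - f (x + h *\<^sub>R axis j 1) + f x = h * h * ?b y" using second_difference[OF f sub h(1)] by blast
  obtain z where z: "z \<in> cball x (2 * h)" "f (x + h *\<^sub>R axis j 1 + h *\<^sub>R axis i 1) - f (x + h *\<^sub>R axis j 1)
     - f (x + h *\<^sub>R axis i 1) + f x = h * h * ?a z" using second_difference[OF f sub h(1)] by blast
  have "h * h * ?b y = h * h * ?a z" using y(2) z(2) by (simp add: algebra_simps)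
  then have "?b y = ?a z" using h(1) by simp
  moreover have "dist (?a z) (?a x) < e" using d1(2)[of z] z(1) h by (simp add: dist_commute)
  moreover have "dist (?b y) (?b x) < e" using d2(2)[of y] y(1) h by (simp add: dist_commute)
  ultimately have "dist (?a x) (?b x) < e + e"
    using dist_triangle3[of "?a x" "?b x" "?a z"] by simp
  then show False by (simp add: e_def dist_real_def)
qed

lemma smooth_on_foldr_partial_deriv: "smooth_on U f \<Longrightarrow> smooth_on U (foldr partial_deriv is f)"
  by (induction "is") (auto intro: smooth_on_partial_deriv)

lemma partial_deriv_cong:
  "open U \<Longrightarrow> (\<And>y. y \<in> U \<Longrightarrow> f y = g y) \<Longrightarrow> x \<in> U \<Longrightarrow> partial_deriv i f x = partial_deriv i g x"
  unfolding partial_deriv_def using frechet_derivative_cong_open by metis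

lemma foldr_partial_deriv_move:
  assumes U: "open U" and f: "smooth_on U f"
  shows "x \<in> U \<Longrightarrow> foldr partial_deriv (us @ a # vs) f x = foldr partial_deriv (a # us @ vs) f x"
proof (induction us arbitrary: x)
  case (Cons u us)
  have "foldr partial_deriv ((u # us) @ a # vs) f x = partial_deriv u (foldr partial_deriv (us @ a # vs) f) x"
    by simp
  also have "\<dots> = partial_deriv u (foldr partial_deriv (a # us @ vs) f) x"
    by (rule partial_deriv_cong[OF U Cons.IH Cons.prems])
  also have "\<dots> = partial_deriv a (partial_deriv u (foldr partial_deriv (us @ vs) f)) x"
    using partial_deriv_commute[OF U Cons.prems smooth_on_foldr_partial_deriv[OF f, of "us @ vs"], of u a] by simp
  finally show ?case by simp
qed simp

lemma foldr_partial_deriv_mset: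
  assumes U: "open U" and f: "smooth_on U f"
  shows "mset xs = mset ys \<Longrightarrow> x \<in> U \<Longrightarrow> foldr partial_deriv xs f x = foldr partial_deriv ys f x"
proof (induction xs arbitrary: ys x)
  case (Cons a xs)
  then have "a \<in> set ys" by (metis list.set_intros(1) mset_eq_setD)
  then obtain us vs where ys: "ys = us @ a # vs" using split_list by metis
  then have m: "mset xs = mset (us @ vs)" using Cons.prems by simp
  have "partial_deriv a (foldr partial_deriv xs f) x = partial_deriv a (foldr partial_deriv (us @ vs) f) x"
    by (rule partial_deriv_cong[OF U Cons.IH[OF m] Cons.prems(2)])
  then have "foldr partial_deriv (a # xs) f x = partial_deriv a (foldr partial_deriv (us @ vs) f) x"
    by simp
  also have "\<dots> = foldr partial_deriv ys f x"
    using foldr_partial_deriv_move[OF U f Cons.prems(2), of us a vs] ys by simp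
  finally show ?case .
qed simp

lemma ex_list_count: "\<exists>is. \<forall>i. count_list is i = (\<alpha> :: 'n::finite \<Rightarrow> nat) i"
proof -
  obtain xs where "mset xs = Abs_multiset \<alpha>" using ex_mset by blast
  then have "count (mset xs) = \<alpha>" by (simp add: Abs_multiset_inverse)
  then show ?thesis by (metis count_mset)
qed

text \<open>Replaces the list picked by the choice operator with any convenient list having the same
  multiplicities.\<close>

lemma mixed_partial_eq:
  assumes U: "open U" "x \<in> U" and f: "smooth_on U f" and "\<And>i. count_list is i = \<alpha> i"
  shows "mixed_partial \<alpha> f x = foldr partial_deriv is f x"
proof -
  let ?is = "SOME is. \<forall>i. count_list is i = \<alpha> i"
  have "\<forall>i. count_list ?is i = \<alpha> i" by (rule someI_ex[OF ex_list_count])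
  then have "mset ?is = mset is" using assms(4) by (intro multiset_eqI) (simp add: count_mset)
  then show ?thesis
    unfolding mixed_partial_def by (rule foldr_partial_deriv_mset[OF U(1) f _ U(2)])
qed

section \<open>Formal derivatives and Taylor polynomials\<close>

definition inc :: "'n \<Rightarrow> ('n \<Rightarrow> nat) \<Rightarrow> 'n \<Rightarrow> nat" where
  "inc i \<alpha> = \<alpha>(i := Suc (\<alpha> i))"

lemma inc_inject: "inc i \<alpha> = inc i \<beta> \<longleftrightarrow> \<alpha> = \<beta>"
  by (auto simp: inc_def fun_eq_iff split: if_splits)

lemma sum_inc: "(\<Sum>j\<in>UNIV. inc i \<alpha> j) = Suc (\<Sum>j\<in>UNIV. (\<alpha> :: 'n::finite \<Rightarrow> nat) j)"
proof -
  have "(\<Sum>j\<in>UNIV. inc i \<alpha> j) = (\<Sum>j\<in>UNIV. \<alpha> j + (if j = i then 1 else 0))"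
    by (rule sum.cong) (auto simp: inc_def)
  then show ?thesis by (simp add: sum.distrib)
qed

text \<open>The formal partial derivative of a power series with respect to the variable i.\<close>

definition dcoeff :: "'n \<Rightarrow> 'n taylor_series \<Rightarrow> 'n taylor_series" where
  "dcoeff i T = (\<lambda>\<alpha>. real (Suc (\<alpha> i)) * T (inc i \<alpha>))"

lemma taylor_partial_deriv:
  fixes f :: "real^'n \<Rightarrow> real"
  assumes "open U" "0 \<in> U" "smooth_on U f"
  shows "taylor (partial_deriv i f) = dcoeff i (taylor f)"
proof
  fix \<alpha> :: "'n \<Rightarrow> nat"
  obtain xs where xs: "\<And>j. count_list xs j = \<alpha> j" using ex_list_count by blast
  have "mixed_partial \<alpha> (partial_deriv i f) 0 = foldr partial_deriv xs (partial_deriv i f) 0"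
    by (rule mixed_partial_eq[OF assms(1,2) smooth_on_partial_deriv[OF assms(3)] xs])
  also have "\<dots> = foldr partial_deriv (xs @ [i]) f 0" by simp
  also have "\<dots> = mixed_partial (inc i \<alpha>) f 0"
    by (rule mixed_partial_eq[OF assms, symmetric]) (auto simp: xs inc_def)
  finally have m: "mixed_partial \<alpha> (partial_deriv i f) 0 = mixed_partial (inc i \<alpha>) f 0" .
  have "(\<Prod>j\<in>UNIV. fact (inc i \<alpha> j) :: real) = (\<Prod>j\<in>UNIV. fact (\<alpha> j) * (if j = i then real (Suc (\<alpha> i)) else 1))"
    by (rule prod.cong) (auto simp: inc_def)
  also have "\<dots> = (\<Prod>j\<in>UNIV. fact (\<alpha> j)) * real (Suc (\<alpha> i))" by (simp add: prod.distrib)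
  finally have p: "(\<Prod>j\<in>UNIV. fact (inc i \<alpha> j) :: real) = (\<Prod>j\<in>UNIV. fact (\<alpha> j)) * real (Suc (\<alpha> i))" .
  show "taylor (partial_deriv i f) \<alpha> = dcoeff i (taylor f) \<alpha>"
    unfolding taylor_def dcoeff_def m p by (simp del: of_nat_Suc)
qed

definition xpow :: "('n::finite \<Rightarrow> nat) \<Rightarrow> real^'n \<Rightarrow> real" where
  "xpow \<alpha> x = (\<Prod>i\<in>UNIV. x $ i ^ \<alpha> i)"

text \<open>The strict bound makes \<open>peval 0\<close> the empty sum and lets differentiation
  lead from \<open>peval (Suc m)\<close> to \<open>peval m\<close>, which suits inductions on m.
  Jets of order k correspond to the bound Suc k.\<close>

definition indices_below :: "nat \<Rightarrow> ('n::finite \<Rightarrow> nat) set" where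
  "indices_below m = {\<alpha>. (\<Sum>i\<in>UNIV. \<alpha> i) < m}"

definition peval :: "nat \<Rightarrow> 'n::finite taylor_series \<Rightarrow> real^'n \<Rightarrow> real" where
  "peval m c x = (\<Sum>\<alpha>\<in>indices_below m. c \<alpha> * xpow \<alpha> x)"

lemma jet_indices_eq: "jet_indices k = indices_below (Suc k)"
  by (auto simp: jet_indices_def indices_below_def)

lemma finite_indices_below: "finite (indices_below m :: ('n::finite \<Rightarrow> nat) set)"
  by (rule finite_subset[OF _ finite_jet_indices[of m]]) (auto simp: indices_below_def jet_indices_def)

text \<open>The subtraction in the exponent is truncated; for \<alpha> i = 0 the factor
  \<open>real (\<alpha> i)\<close> removes the term.\<close>

lemma has_derivative_xpow:
  "(xpow \<alpha> has_derivative (\<lambda>v. \<Sum>i\<in>UNIV. v $ i * (real (\<alpha> i) * xpow (\<alpha>(i := \<alpha> i - 1)) x))) (at x)"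
proof -
  have 1: "((\<lambda>x. \<Prod>i\<in>UNIV. x $ i ^ \<alpha> i) has_derivative
     (\<lambda>v. \<Sum>i\<in>UNIV. (real (\<alpha> i) * v $ i * x $ i ^ (\<alpha> i - 1)) * (\<Prod>j\<in>UNIV - {i}. x $ j ^ \<alpha> j))) (at x)"
    by (rule has_derivative_prod)
      (rule has_derivative_power[OF bounded_linear_imp_has_derivative[OF bounded_linear_vec_nth], THEN has_derivative_eq_rhs], simp add: fun_eq_iff)
  have 2: "(real (\<alpha> i) * v $ i * x $ i ^ (\<alpha> i - 1)) * (\<Prod>j\<in>UNIV - {i}. x $ j ^ \<alpha> j) =
     v $ i * (real (\<alpha> i) * xpow (\<alpha>(i := \<alpha> i - 1)) x)" for i v
  proof -
    have "xpow (\<alpha>(i := \<alpha> i - 1)) x = x $ i ^ (\<alpha> i - 1) * (\<Prod>j\<in>UNIV - {i}. x $ j ^ (\<alpha>(i := \<alpha> i - 1)) j)"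
      unfolding xpow_def by (subst prod.remove[of UNIV i]) auto
    also have "(\<Prod>j\<in>UNIV - {i}. x $ j ^ (\<alpha>(i := \<alpha> i - 1)) j) = (\<Prod>j\<in>UNIV - {i}. x $ j ^ \<alpha> j)"
      by (rule prod.cong) auto
    finally have e: "xpow (\<alpha>(i := \<alpha> i - 1)) x = x $ i ^ (\<alpha> i - 1) * (\<Prod>j\<in>UNIV - {i}. x $ j ^ \<alpha> j)" .
    show ?thesis unfolding e by (simp only: mult_ac)
  qed
  have 3: "xpow \<alpha> = (\<lambda>x. \<Prod>i\<in>UNIV. x $ i ^ \<alpha> i)" by (simp add: fun_eq_iff xpow_def)
  show ?thesis using 1 unfolding 2 3[symmetric] .
qed

text \<open>Monomials free of x i drop out, and the others are enumerated by \<open>inc i\<close>;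
  this reindexing turns the sum into the one with coefficients \<open>dcoeff i c\<close>.\<close>

lemma has_derivative_peval:
  "(peval (Suc m) c has_derivative (\<lambda>v. \<Sum>i\<in>UNIV. v $ i * peval m (dcoeff i c) x)) (at x)"
proof -
  have 1: "(peval (Suc m) c has_derivative (\<lambda>v. \<Sum>\<alpha>\<in>indices_below (Suc m). c \<alpha> *
     (\<Sum>i\<in>UNIV. v $ i * (real (\<alpha> i) * xpow (\<alpha>(i := \<alpha> i - 1)) x)))) (at x)"
    unfolding peval_def[abs_def]
    by (intro has_derivative_sum has_derivative_mult_right has_derivative_xpow)
  have 2: "(\<Sum>\<alpha>\<in>indices_below (Suc m). c \<alpha> * (\<Sum>i\<in>UNIV. v $ i * (real (\<alpha> i) * xpow (\<alpha>(i := \<alpha> i - 1)) x))) =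
    (\<Sum>i\<in>UNIV. v $ i * peval m (dcoeff i c) x)" for v
  proof -
    have swap: "(\<Sum>\<alpha>\<in>indices_below (Suc m). c \<alpha> * (\<Sum>i\<in>UNIV. v $ i * (real (\<alpha> i) * xpow (\<alpha>(i := \<alpha> i - 1)) x)))
       = (\<Sum>i\<in>UNIV. v $ i * (\<Sum>\<alpha>\<in>indices_below (Suc m). real (\<alpha> i) * c \<alpha> * xpow (\<alpha>(i := \<alpha> i - 1)) x))"
      unfolding sum_distrib_left by (subst sum.swap) (simp only: mult_ac)
    have inner: "(\<Sum>\<alpha>\<in>indices_below (Suc m). real (\<alpha> i) * c \<alpha> * xpow (\<alpha>(i := \<alpha> i - 1)) x) = peval m (dcoeff i c) x" for i
    proof -
      have "(\<Sum>\<alpha>\<in>indices_below (Suc m). real (\<alpha> i) * c \<alpha> * xpow (\<alpha>(i := \<alpha> i - 1)) x) =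
         (\<Sum>\<alpha>\<in>inc i ` indices_below m. real (\<alpha> i) * c \<alpha> * xpow (\<alpha>(i := \<alpha> i - 1)) x)"
      proof (rule sum.mono_neutral_right[OF finite_indices_below])
        show "inc i ` indices_below m \<subseteq> indices_below (Suc m)"
          by (auto simp: indices_below_def sum_inc)
        show "\<forall>\<alpha>\<in>indices_below (Suc m) - inc i ` indices_below m. real (\<alpha> i) * c \<alpha> * xpow (\<alpha>(i := \<alpha> i - 1)) x = 0"
        proof
          fix \<alpha> :: "'a \<Rightarrow> nat" assume \<alpha>: "\<alpha> \<in> indices_below (Suc m) - inc i ` indices_below m"
          have "\<alpha> i = 0"
          proof (rule ccontr)
            assume "\<alpha> i \<noteq> 0"
            then have e: "\<alpha> = inc i (\<alpha>(i := \<alpha> i - 1))" by (auto simp: inc_def)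
            have "\<alpha>(i := \<alpha> i - 1) \<in> indices_below m"
              using \<alpha> sum_inc[of i "\<alpha>(i := \<alpha> i - 1)"] unfolding e[symmetric] by (simp add: indices_below_def)
            then show False using \<alpha> e by blast
          qed
          then show "real (\<alpha> i) * c \<alpha> * xpow (\<alpha>(i := \<alpha> i - 1)) x = 0" by simp
        qed
      qed
      also have "\<dots> = (\<Sum>\<alpha>\<in>indices_below m. real (inc i \<alpha> i) * c (inc i \<alpha>) * xpow ((inc i \<alpha>)(i := inc i \<alpha> i - 1)) x)"
        by (subst sum.reindex) (auto simp: inj_on_def inc_inject)
      also have "\<dots> = peval m (dcoeff i c) x"
        unfolding peval_def dcoeff_def by (rule sum.cong) (auto simp: inc_def)
      finally show ?thesis .
    qed
    show ?thesis unfolding swap inner ..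
  qed
  show ?thesis using 1 unfolding 2 .
qed

lemma partial_deriv_peval: "partial_deriv i (peval (Suc m) c) x = peval m (dcoeff i c) x"
  unfolding partial_deriv_def frechet_derivative_at[OF has_derivative_peval[of m c x], symmetric]
  by (simp add: axis_def if_distrib[of "\<lambda>u. u * _"] cong: if_cong)

lemma xpow_zero: "xpow \<alpha> 0 = (if \<alpha> = (\<lambda>_. 0) then 1 else 0)"
  unfolding xpow_def by (auto simp: fun_eq_iff power_0_left)

lemma peval_at_zero: "peval (Suc m) c 0 = c (\<lambda>_. 0)"
proof -
  have "peval (Suc m) c 0 = (\<Sum>\<alpha>\<in>indices_below (Suc m). if \<alpha> = (\<lambda>_. 0) then c \<alpha> else 0)"
    unfolding peval_def by (rule sum.cong) (auto simp: xpow_zero)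
  also have "\<dots> = c (\<lambda>_. 0)"
    by (subst sum.delta[OF finite_indices_below]) (simp add: indices_below_def)
  finally show ?thesis .
qed

lemma taylor_zero: "taylor f (\<lambda>_. 0) = f 0"
proof -
  have "(SOME is. \<forall>i. count_list is i = (0::nat)) = ([] :: 'a list)"
  proof (rule some_equality)
    fix xs :: "'a list" assume "\<forall>i. count_list xs i = 0"
    then show "xs = []" by (cases xs) (auto dest: spec[of _ "hd xs"])
  qed simp
  then show ?thesis by (simp add: taylor_def mixed_partial_def)
qed

text \<open>Induction on m for all smooth f at once: the hypothesis is applied to the partial
  derivatives, whose Taylor series are the formal derivatives, and the mean value theorem on the
  segment from 0 to x gains one power of norm x.\<close>

lemma taylor_remainder:
  fixes f :: "real^'n \<Rightarrow> real"
  assumes U: "open U" "0 \<in> U" and "smooth_on U f"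
  shows "\<exists>C \<delta>. 0 < \<delta> \<and> 0 \<le> C \<and> (\<forall>x. norm x < \<delta> \<longrightarrow> \<bar>f x - peval m (taylor f) x\<bar> \<le> C * norm x ^ m)"
  using assms(3)
proof (induction m arbitrary: f)
  case 0
  have "isCont f 0" using smooth_on_continuous_on[OF 0] U by (simp add: continuous_on_eq_continuous_at)
  then obtain d where d: "d > 0" "\<And>y. dist y 0 < d \<Longrightarrow> dist (f y) (f 0) < 1"
    unfolding continuous_at_eps_delta using zero_less_one by blast
  show ?case
  proof (rule exI[of _ "\<bar>f 0\<bar> + 1"], rule exI[of _ d], intro conjI allI impI)
    fix x :: "real^'n" assume "norm x < d"
    then have "\<bar>f x - f 0\<bar> < 1" using d(2)[of x] by (simp add: dist_real_def)
    then show "\<bar>f x - peval 0 (taylor f) x\<bar> \<le> (\<bar>f 0\<bar> + 1) * norm x ^ 0"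
      by (simp add: peval_def indices_below_def)
  qed (use d in auto)
next
  case (Suc m)
  obtain r where r: "r > 0" "ball 0 r \<subseteq> U" using U open_contains_ball by blast
  have "\<forall>i. \<exists>C \<delta>. 0 < \<delta> \<and> 0 \<le> C \<and> (\<forall>x. norm x < \<delta> \<longrightarrow>
      \<bar>partial_deriv i f x - peval m (dcoeff i (taylor f)) x\<bar> \<le> C * norm x ^ m)"
    using Suc.IH[OF smooth_on_partial_deriv[OF Suc.prems]] taylor_partial_deriv[OF U Suc.prems] by simp
  then obtain C \<delta> where C: "\<And>i. 0 < \<delta> i" "\<And>i. 0 \<le> C i" "\<And>i x. norm x < \<delta> i \<Longrightarrow>
      \<bar>partial_deriv i f x - peval m (dcoeff i (taylor f)) x\<bar> \<le> C i * norm x ^ m" by metis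
  define d where "d = Min (insert r (range \<delta>))"
  have d: "d > 0" "d \<le> r" "\<And>i. d \<le> \<delta> i" using C(1) r(1) by (auto simp: d_def intro!: min.coboundedI2 Min_le)
  define K where "K = (\<Sum>i\<in>UNIV. C i)"
  have K: "0 \<le> K" using C(2) by (auto simp: K_def intro: sum_nonneg)
  let ?g = "\<lambda>x. f x - peval (Suc m) (taylor f) x"
  have g: "(?g has_derivative (\<lambda>v. \<Sum>i\<in>UNIV. v $ i * (partial_deriv i f x - peval m (dcoeff i (taylor f)) x))) (at x)"
    if "norm x < d" for x
  proof -
    have "x \<in> U" using that d r by auto
    then have f: "(f has_derivative frechet_derivative f (at x)) (at x)" by (rule smooth_on_has_derivative[OF Suc.prems])
    from has_derivative_diff[OF f has_derivative_peval[of m "taylor f" x]] show ?thesis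
      by (rule has_derivative_eq_rhs)
        (auto simp: fun_eq_iff has_derivative_partial_deriv[OF f] right_diff_distrib sum_subtractf)
  qed
  have "\<bar>?g x\<bar> \<le> K * norm x ^ Suc m" if x: "norm x < d" for x
  proof -
    have lt: "norm (t *\<^sub>R x) < d" if "0 \<le> t" "t \<le> 1" for t
      using that x mult_left_le_one_le[of "norm x" t] by simp
    let ?h' = "\<lambda>t. \<Sum>i\<in>UNIV. x $ i * (partial_deriv i f (t *\<^sub>R x) - peval m (dcoeff i (taylor f)) (t *\<^sub>R x))"
    have D: "((\<lambda>t. ?g (t *\<^sub>R x)) has_real_derivative ?h' t) (at t)" if "0 \<le> t" "t \<le> 1" for t
    proof -
      have "((\<lambda>t. t *\<^sub>R x) has_derivative (\<lambda>s. s *\<^sub>R x)) (at t)" by (auto intro!: derivative_eq_intros)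
      from has_derivative_compose[OF this g[OF lt[OF that]]] show ?thesis
        unfolding has_field_derivative_def
        by (rule has_derivative_eq_rhs) (auto simp: fun_eq_iff sum_distrib_left mult_ac)
    qed
    obtain t where t: "0 < t" "t < 1" "?g (1 *\<^sub>R x) - ?g (0 *\<^sub>R x) = (1 - 0) * ?h' t"
      using MVT2[OF zero_less_one D] by auto
    have "?g (0 *\<^sub>R x) = 0" by (simp add: peval_at_zero taylor_zero)
    then have "\<bar>?g x\<bar> = \<bar>?h' t\<bar>" using t(3) by simp
    also have "\<dots> \<le> (\<Sum>i\<in>UNIV. norm x * (C i * norm x ^ m))"
    proof (rule order_trans[OF sum_abs], rule sum_mono)
      fix i
      have "\<bar>partial_deriv i f (t *\<^sub>R x) - peval m (dcoeff i (taylor f)) (t *\<^sub>R x)\<bar> \<le> C i * norm (t *\<^sub>R x) ^ m"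
        using lt[of t] t d(3)[of i] by (intro C(3)) auto
      also have "\<dots> \<le> C i * norm x ^ m"
        using t mult_left_le_one_le[of "norm x" t] by (intro mult_left_mono power_mono C(2)) auto
      finally have "\<bar>partial_deriv i f (t *\<^sub>R x) - peval m (dcoeff i (taylor f)) (t *\<^sub>R x)\<bar> \<le> C i * norm x ^ m" .
      then show "\<bar>x $ i * (partial_deriv i f (t *\<^sub>R x) - peval m (dcoeff i (taylor f)) (t *\<^sub>R x))\<bar> \<le> norm x * (C i * norm x ^ m)"
        unfolding abs_mult by (intro mult_mono component_le_norm_cart) auto
    qed
    also have "\<dots> = K * norm x ^ Suc m"
      by (simp add: K_def sum_distrib_left sum_distrib_right mult_ac)
    finally show ?thesis .
  qed
  then show ?case using d(1) K by - (rule exI[of _ K], rule exI[of _ d], auto)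
qed

section \<open>Polynomials depending polynomially on a jet\<close>

text \<open>The number d bounds the degree in x only; the coefficients are polynomials in z of any
  degree. With I = {} this expresses a degree bound for an ordinary polynomial in x.\<close>

definition jpoly :: "'i set \<Rightarrow> nat \<Rightarrow> (('i \<Rightarrow> real) \<Rightarrow> real^'n::finite \<Rightarrow> real) \<Rightarrow> bool" where
  "jpoly I d F \<longleftrightarrow> (\<exists>c. (\<forall>\<alpha>. poly_fun I (c \<alpha>)) \<and> (\<forall>z x. F z x = peval (Suc d) (\<lambda>\<alpha>. c \<alpha> z) x))"

lemma jpolyI: "(\<And>\<alpha>. poly_fun I (c \<alpha>)) \<Longrightarrow> (\<And>z x. F z x = peval (Suc d) (\<lambda>\<alpha>. c \<alpha> z) x) \<Longrightarrow> jpoly I d F"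
  unfolding jpoly_def by blast

lemma jpolyE:
  assumes "jpoly I d F"
  obtains c where "\<And>\<alpha>. poly_fun I (c \<alpha>)" "\<And>z x. F z x = peval (Suc d) (\<lambda>\<alpha>. c \<alpha> z) x"
proof -
  obtain c where "(\<forall>\<alpha>. poly_fun I (c \<alpha>)) \<and> (\<forall>z x. F z x = peval (Suc d) (\<lambda>\<alpha>. c \<alpha> z) x)"
    using assms unfolding jpoly_def by (rule exE)
  then have "\<And>\<alpha>. poly_fun I (c \<alpha>)" "\<And>z x. F z x = peval (Suc d) (\<lambda>\<alpha>. c \<alpha> z) x" by auto
  then show ?thesis by (rule that)
qed

lemma indices_below_mono: "m \<le> n \<Longrightarrow> indices_below m \<subseteq> indices_below n"
  by (auto simp: indices_below_def)

lemma peval_extend: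
  assumes "m \<le> n"
  shows "peval m c x = peval n (\<lambda>\<alpha>. if \<alpha> \<in> indices_below m then c \<alpha> else 0) x"
  unfolding peval_def
  by (rule sum.mono_neutral_cong_left[OF finite_indices_below indices_below_mono[OF assms]]) auto

lemma peval_cong: "(\<And>\<alpha>. \<alpha> \<in> indices_below m \<Longrightarrow> c \<alpha> = c' \<alpha>) \<Longrightarrow> peval m c x = peval m c' x"
  unfolding peval_def by (rule sum.cong) auto

lemma jpoly_mono:
  assumes "jpoly I d F" "d \<le> e"
  shows "jpoly I e F"
proof -
  obtain c where c: "\<And>\<alpha>. poly_fun I (c \<alpha>)" "\<And>z x. F z x = peval (Suc d) (\<lambda>\<alpha>. c \<alpha> z) x"
    by (rule jpolyE[OF assms(1)]) (rule that)
  show ?thesis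
  proof (rule jpolyI)
    show "poly_fun I (\<lambda>z. if \<alpha> \<in> indices_below (Suc d) then c \<alpha> z else 0)" for \<alpha>
      using c(1) by (cases "\<alpha> \<in> indices_below (Suc d)") (auto intro: poly_fun.const)
    show "F z x = peval (Suc e) (\<lambda>\<alpha>. if \<alpha> \<in> indices_below (Suc d) then c \<alpha> z else 0) x" for z x
      unfolding c(2) by (rule peval_extend) (use assms(2) in simp)
  qed
qed

lemma jpoly_add:
  assumes "jpoly I d F" "jpoly I d G"
  shows "jpoly I d (\<lambda>z x. F z x + G z x)"
proof -
  obtain c where c: "\<And>\<alpha>. poly_fun I (c \<alpha>)" "\<And>z x. F z x = peval (Suc d) (\<lambda>\<alpha>. c \<alpha> z) x"
    by (rule jpolyE[OF assms(1)]) (rule that)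
  obtain c' where c': "\<And>\<alpha>. poly_fun I (c' \<alpha>)" "\<And>z x. G z x = peval (Suc d) (\<lambda>\<alpha>. c' \<alpha> z) x"
    by (rule jpolyE[OF assms(2)]) (rule that)
  show ?thesis
    by (rule jpolyI[where c = "\<lambda>\<alpha> z. c \<alpha> z + c' \<alpha> z"])
      (simp_all add: c c' poly_fun.add peval_def sum.distrib algebra_simps)
qed

lemma jpoly_mult:
  fixes F G :: "('i \<Rightarrow> real) \<Rightarrow> real^'n::finite \<Rightarrow> real"
  assumes "jpoly I d F" "jpoly I e G"
  shows "jpoly I (d + e) (\<lambda>z x. F z x * G z x)"
proof -
  obtain c where c: "\<And>\<alpha>. poly_fun I (c \<alpha>)" "\<And>z x. F z x = peval (Suc d) (\<lambda>\<alpha>. c \<alpha> z) x"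
    by (rule jpolyE[OF assms(1)]) (rule that)
  obtain c' where c': "\<And>\<alpha>. poly_fun I (c' \<alpha>)" "\<And>z x. G z x = peval (Suc e) (\<lambda>\<alpha>. c' \<alpha> z) x"
    by (rule jpolyE[OF assms(2)]) (rule that)
  let ?S = "indices_below (Suc d) \<times> indices_below (Suc e) :: (('n \<Rightarrow> nat) \<times> ('n \<Rightarrow> nat)) set"
  let ?g = "\<lambda>(\<alpha>, \<beta>) i. \<alpha> i + \<beta> i :: nat"
  let ?C = "\<lambda>\<gamma> z. \<Sum>s\<in>{s \<in> ?S. ?g s = \<gamma>}. c (fst s) z * c' (snd s) z"
  show ?thesis
  proof (rule jpolyI[where c = ?C])
    show "poly_fun I (?C \<gamma>)" for \<gamma> by (intro poly_fun_sum poly_fun.mult c c')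
    fix z and x :: "real^'n"
    have xp: "xpow (?g s) x = xpow (fst s) x * xpow (snd s) x" for s
      by (cases s) (simp add: xpow_def power_add prod.distrib)
    have "F z x * G z x = (\<Sum>s\<in>?S. c (fst s) z * c' (snd s) z * xpow (?g s) x)"
      unfolding c(2) c'(2) peval_def sum_product sum.cartesian_product
      by (rule sum.cong) (auto simp: xp simp del: split_paired_All)
    also have "\<dots> = (\<Sum>\<gamma>\<in>indices_below (Suc (d + e)). \<Sum>s\<in>{s \<in> ?S. ?g s = \<gamma>}. c (fst s) z * c' (snd s) z * xpow (?g s) x)"
      by (rule sum.group[symmetric])
        (auto simp: indices_below_def sum.distrib finite_indices_below[unfolded indices_below_def])
    also have "\<dots> = peval (Suc (d + e)) (\<lambda>\<gamma>. ?C \<gamma> z) x"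
      unfolding peval_def sum_distrib_right by (intro sum.cong refl) auto
    finally show "F z x * G z x = peval (Suc (d + e)) (\<lambda>\<gamma>. ?C \<gamma> z) x" .
  qed
qed

lemma jpoly_const:
  assumes "poly_fun I p"
  shows "jpoly I d (\<lambda>z (x :: real^'n::finite). p z)"
proof (rule jpolyI)
  show "poly_fun I (\<lambda>z. if \<alpha> = (\<lambda>_. 0) then p z else 0)" for \<alpha> :: "'n \<Rightarrow> nat"
    using assms by (cases "\<alpha> = (\<lambda>_. 0)") (auto intro: poly_fun.const)
  fix z and x :: "real^'n"
  have "peval (Suc d) (\<lambda>\<alpha>. if \<alpha> = (\<lambda>_. 0) then p z else 0) x =
      (\<Sum>\<alpha>\<in>indices_below (Suc d). if \<alpha> = (\<lambda>_. 0) then p z * xpow \<alpha> x else 0)"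
    unfolding peval_def by (rule sum.cong) auto
  also have "\<dots> = p z * xpow (\<lambda>_. 0) x"
    by (subst sum.delta[OF finite_indices_below]) (simp add: indices_below_def)
  finally show "p z = peval (Suc d) (\<lambda>\<alpha>. if \<alpha> = (\<lambda>_. 0) then p z else 0) x"
    by (simp add: xpow_def)
qed

lemma jpoly_xpow:
  fixes \<alpha> :: "'n::finite \<Rightarrow> nat"
  assumes "(\<Sum>i\<in>UNIV. \<alpha> i) \<le> d"
  shows "jpoly I d (\<lambda>z. xpow \<alpha>)"
proof (rule jpolyI)
  show "poly_fun I (\<lambda>z. if \<beta> = \<alpha> then 1 else 0)" for \<beta> by (rule poly_fun.const)
  fix z and x :: "real^'n"
  have "peval (Suc d) (\<lambda>\<beta>. if \<beta> = \<alpha> then 1 else 0) x =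
      (\<Sum>\<beta>\<in>indices_below (Suc d). if \<beta> = \<alpha> then xpow \<beta> x else 0)"
    unfolding peval_def by (rule sum.cong) auto
  also have "\<dots> = xpow \<alpha> x"
    by (subst sum.delta[OF finite_indices_below]) (use assms in \<open>simp add: indices_below_def\<close>)
  finally show "xpow \<alpha> x = peval (Suc d) (\<lambda>\<beta>. if \<beta> = \<alpha> then 1 else 0) x" by simp
qed

definition single :: "'n \<Rightarrow> nat \<Rightarrow> 'n \<Rightarrow> nat" where
  "single i m = (\<lambda>j. if j = i then m else 0)"

lemma sum_single: "(\<Sum>j\<in>UNIV. single i m j) = m" for i :: "'n::finite"
  by (simp add: single_def)

lemma xpow_single: "xpow (single i m) x = x $ i ^ m"
  by (simp add: xpow_def single_def if_distrib[of "\<lambda>u. _ ^ u"] cong: if_cong)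

lemma jpoly_coord_power: "m \<le> d \<Longrightarrow> jpoly I d (\<lambda>z x. x $ i ^ m)"
  using jpoly_xpow[of "single i m" d I] unfolding sum_single xpow_single by simp

lemma jpoly_cmult: "jpoly I d F \<Longrightarrow> jpoly I d (\<lambda>z x. a * F z x)"
  using jpoly_mult[OF jpoly_const[OF poly_fun.const[of I a], of 0], of d F] by simp

lemma jpoly_diff: "jpoly I d F \<Longrightarrow> jpoly I d G \<Longrightarrow> jpoly I d (\<lambda>z x. F z x - G z x)"
  using jpoly_add[OF _ jpoly_cmult[of I d G "-1"], of F] by simp

lemma jpoly_sum: "(\<And>a. a \<in> A \<Longrightarrow> jpoly I d (F a)) \<Longrightarrow> jpoly I d (\<lambda>z x. \<Sum>a\<in>A. F a z x)"
proof (induction A rule: infinite_finite_induct)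
  case (insert a A)
  then show ?case using jpoly_add[of I d "F a" "\<lambda>z x. \<Sum>a\<in>A. F a z x"] by simp
qed (simp_all add: jpoly_const poly_fun.const)

text \<open>The constant coefficient is the value at 0; every other coefficient is, up to a nonzero
  factor, a coefficient of a formal derivative, which has a smaller degree bound and vanishes as
  well.\<close>

lemma peval_eq_zero_imp:
  assumes "\<And>x. peval m c x = 0" "\<alpha> \<in> indices_below m"
  shows "c \<alpha> = 0"
  using assms
proof (induction m arbitrary: c \<alpha>)
  case 0
  then show ?case by (simp add: indices_below_def)
next
  case (Suc m)
  show ?case
  proof (cases "\<alpha> = (\<lambda>_. 0)")
    case True
    then show ?thesis using Suc.prems(1)[of 0] by (simp add: peval_at_zero)
  next
    case False
    then obtain i where i: "\<alpha> i \<noteq> 0" by (auto simp: fun_eq_iff)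
    define \<beta> where "\<beta> = \<alpha>(i := \<alpha> i - 1)"
    have \<alpha>: "\<alpha> = inc i \<beta>" using i by (auto simp: \<beta>_def inc_def)
    have \<beta>: "\<beta> \<in> indices_below m" using Suc.prems(2) sum_inc[of i \<beta>] by (simp add: \<alpha> indices_below_def)
    have z: "peval (Suc m) c = (\<lambda>_. 0)" using Suc.prems(1) by (simp add: fun_eq_iff)
    have "peval m (dcoeff i c) x = 0" for x
    proof -
      have "(peval (Suc m) c has_derivative (\<lambda>_. 0)) (at x)" unfolding z by simp
      then have "partial_deriv i (peval (Suc m) c) x = 0"
        unfolding partial_deriv_def using frechet_derivative_at by metis
      then show ?thesis by (simp add: partial_deriv_peval)
    qed
    then have "dcoeff i c \<beta> = 0" using Suc.IH \<beta> by blast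
    then show ?thesis by (simp add: dcoeff_def \<alpha> del: of_nat_Suc)
  qed
qed

text \<open>
  Gaussian elimination over polynomials, with pivots that are nonzero where the matrix is the
  identity. The polynomial found plays the role of the determinant.
\<close>

lemma generic_solvability:
  fixes M :: "'a \<Rightarrow> 'a \<Rightarrow> ('i \<Rightarrow> real) \<Rightarrow> real"
  assumes "finite S" "\<And>a b. poly_fun I (M a b)" "\<And>a b. a \<in> S \<Longrightarrow> b \<in> S \<Longrightarrow> M a b z0 = (if a = b then 1 else 0)"
  shows "\<exists>p. poly_fun I p \<and> p z0 \<noteq> 0 \<and>
    (\<forall>z. p z \<noteq> 0 \<longrightarrow> (\<forall>y. \<exists>w. \<forall>a\<in>S. (\<Sum>b\<in>S. M a b z * w b) = y a))"
  using assms
proof (induction S arbitrary: M rule: finite_induct)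
  case empty
  show ?case by (rule exI[of _ "\<lambda>_. 1"]) (auto intro: poly_fun.const)
next
  case (insert s S)
  \<comment> \<open>The elimination step is multiplied by the pivot rather than divided by it, so
    the entries stay polynomial in z; at z0 it is again the identity.\<close>
  let ?M = "\<lambda>a b z. M s s z * M a b z - M a s z * M s b z"
  have pM: "poly_fun I (?M a b)" for a b
    by (intro poly_fun_diff poly_fun.mult insert.prems)
  have idM: "?M a b z0 = (if a = b then 1 else 0)" if "a \<in> S" "b \<in> S" for a b
    using insert.prems(2) insert.hyps(2) that by auto
  obtain p where p: "poly_fun I p" "p z0 \<noteq> 0"
    "\<And>z y. p z \<noteq> 0 \<Longrightarrow> \<exists>w. \<forall>a\<in>S. (\<Sum>b\<in>S. ?M a b z * w b) = y a"
    using insert.IH[OF pM idM] by auto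
  show ?case
  proof (rule exI[of _ "\<lambda>z. M s s z * p z"], intro conjI allI impI)
    show "poly_fun I (\<lambda>z. M s s z * p z)" by (intro poly_fun.mult insert.prems p)
    show "M s s z0 * p z0 \<noteq> 0" using insert.prems(2) p(2) by simp
    fix z y assume "M s s z * p z \<noteq> 0"
    then have ss: "M s s z \<noteq> 0" and pz: "p z \<noteq> 0" by auto
    obtain w where w: "\<And>a. a \<in> S \<Longrightarrow> (\<Sum>b\<in>S. ?M a b z * w b) = M s s z * y a - M a s z * y s"
      using p(3)[OF pz, of "\<lambda>a. M s s z * y a - M a s z * y s"] by blast
    define t where "t = (\<Sum>b\<in>S. M s b z * w b)"
    define w' where "w' = w(s := (y s - t) / M s s z)"
    have split: "(\<Sum>b\<in>insert s S. M a b z * w' b) = M a s z * ((y s - t) / M s s z) + (\<Sum>b\<in>S. M a b z * w b)" for a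
    proof -
      have "(\<Sum>b\<in>S. M a b z * w' b) = (\<Sum>b\<in>S. M a b z * w b)"
        by (rule sum.cong) (use insert.hyps in \<open>auto simp: w'_def\<close>)
      then show ?thesis using insert.hyps by (simp add: w'_def)
    qed
    have "(\<Sum>b\<in>insert s S. M a b z * w' b) = y a" if "a \<in> insert s S" for a
    proof (cases "a = s")
      case True
      then show ?thesis using ss by (simp only: split) (simp add: t_def)
    next
      case False
      then have a: "a \<in> S" using that by simp
      have "M s s z * (\<Sum>b\<in>S. M a b z * w b) - M a s z * t = (\<Sum>b\<in>S. ?M a b z * w b)"
        unfolding t_def sum_distrib_left sum_subtractf[symmetric] by (rule sum.cong) (auto simp: algebra_simps)
      then have "M s s z * (\<Sum>b\<in>S. M a b z * w b) = M s s z * y a - M a s z * (y s - t)"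
        using w[OF a] by (simp add: algebra_simps)
      then have "(\<Sum>b\<in>S. M a b z * w b) = y a - M a s z * ((y s - t) / M s s z)"
        using ss by (simp add: field_simps)
      then show ?thesis by (simp only: split)
    qed
    then show "\<exists>w. \<forall>a\<in>insert s S. (\<Sum>b\<in>insert s S. M a b z * w b) = y a" by blast
  qed
qed

section \<open>Generic finiteness of an ideal\<close>

definition xpoly :: "(real^'n::finite \<Rightarrow> real) \<Rightarrow> bool" where
  "xpoly F \<longleftrightarrow> (\<exists>m c. F = peval m c)"

lemma xpoly_imp_jpoly:
  assumes "xpoly F"
  shows "\<exists>d. jpoly I d (\<lambda>z. F)"
proof -
  obtain m c where F: "F = peval m c" using assms unfolding xpoly_def by blast
  have "jpoly I m (\<lambda>z. F)"
  proof (rule jpolyI)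
    show "poly_fun I (\<lambda>z. if \<alpha> \<in> indices_below m then c \<alpha> else 0)" for \<alpha> by (rule poly_fun.const)
    show "F x = peval (Suc m) (\<lambda>\<alpha>. if \<alpha> \<in> indices_below m then c \<alpha> else 0) x" for x
      unfolding F by (rule peval_extend) simp
  qed
  then show ?thesis by blast
qed

lemma jpoly_imp_xpoly: "jpoly I d F \<Longrightarrow> xpoly (F z)"
  unfolding xpoly_def by (elim jpolyE) (auto simp: fun_eq_iff)

text \<open>Passing to \<open>jpoly\<close> with no coordinates and a dummy parameter supplies
  degree bounds, which can be made equal before adding.\<close>

lemma xpoly_add: "xpoly F \<Longrightarrow> xpoly G \<Longrightarrow> xpoly (\<lambda>x. F x + G x)"
proof -
  assume "xpoly F" "xpoly G"
  then obtain d e where "jpoly {} d (\<lambda>z::unit \<Rightarrow> real. F)" "jpoly {} e (\<lambda>z::unit \<Rightarrow> real. G)"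
    using xpoly_imp_jpoly by metis
  then have "jpoly {} (d + e) (\<lambda>z::unit \<Rightarrow> real. F)" "jpoly {} (d + e) (\<lambda>z::unit \<Rightarrow> real. G)"
    by (auto elim: jpoly_mono)
  then show ?thesis using jpoly_imp_xpoly[OF jpoly_add] by blast
qed

lemma xpoly_mult: "xpoly F \<Longrightarrow> xpoly G \<Longrightarrow> xpoly (\<lambda>x. F x * G x)"
proof -
  assume "xpoly F" "xpoly G"
  then obtain d e where "jpoly {} d (\<lambda>z::unit \<Rightarrow> real. F)" "jpoly {} e (\<lambda>z::unit \<Rightarrow> real. G)"
    using xpoly_imp_jpoly by metis
  then show ?thesis using jpoly_imp_xpoly[OF jpoly_mult] by blast
qed

lemma xpoly_const: "xpoly (\<lambda>_. a)"
  using jpoly_imp_xpoly[OF jpoly_const[OF poly_fun.const]] by blast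

lemma xpoly_sum: "(\<And>a. a \<in> A \<Longrightarrow> xpoly (F a)) \<Longrightarrow> xpoly (\<lambda>x. \<Sum>a\<in>A. F a x)"
  by (induction A rule: infinite_finite_induct) (auto intro: xpoly_add xpoly_const)

lemma sum_rotate: "(\<Sum>j\<in>A. \<Sum>k\<in>B. \<Sum>l\<in>C. f j k l) = (\<Sum>l\<in>C. \<Sum>j\<in>A. \<Sum>k\<in>B. f j k l)"
proof -
  have "(\<Sum>l\<in>C. \<Sum>j\<in>A. \<Sum>k\<in>B. f j k l) = (\<Sum>j\<in>A. \<Sum>l\<in>C. \<Sum>k\<in>B. f j k l)" by (rule sum.swap)
  also have "\<dots> = (\<Sum>j\<in>A. \<Sum>k\<in>B. \<Sum>l\<in>C. f j k l)" by (rule sum.cong[OF refl], rule sum.swap)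
  finally show ?thesis ..
qed

text \<open>
  The right-hand sides of the second assumption on \<open>G\<close>, with \<open>z\<close> in place of \<open>z0\<close>, have a matrix of
  coefficients that is the identity at \<open>z0\<close>, so for generic \<open>z\<close> they still span; and more than \<open>card B\<close>
  powers of \<open>x $ i\<close> must be dependent modulo the \<open>h g z\<close>.
\<close>

lemma generic_dependence:
  fixes h :: "'g::finite \<Rightarrow> ('i \<Rightarrow> real) \<Rightarrow> real^'n::finite \<Rightarrow> real"
  assumes h: "\<And>g. \<exists>d. jpoly I d (h g)" and B: "finite B" "card B \<le> s"
    and G: "\<And>\<gamma> g. xpoly (G \<gamma> g)"
      "\<And>\<gamma> x. xpow \<gamma> x = (\<Sum>g\<in>UNIV. G \<gamma> g x * h g z0 x) + (\<Sum>\<beta>\<in>B. b \<gamma> \<beta> * xpow \<beta> x)"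
  shows "\<exists>p. poly_fun I p \<and> p z0 \<noteq> 0 \<and> (\<forall>z. p z \<noteq> 0 \<longrightarrow> (\<forall>i. \<exists>a w m r.
    (\<exists>j\<le>s. a j \<noteq> 0) \<and> (\<forall>g. xpoly (w g)) \<and> (\<forall>\<gamma>\<in>indices_below (Suc s). r \<gamma> = 0) \<and>
    (\<forall>x. (\<Sum>j\<le>s. a j * x $ i ^ j) = (\<Sum>g\<in>UNIV. w g x * h g z x) + peval m r x)))"
proof -
  let ?S = "indices_below (Suc s) :: ('n \<Rightarrow> nat) set"
  define q where "q \<gamma> z x = (\<Sum>g\<in>UNIV. G \<gamma> g x * h g z x) + (\<Sum>\<beta>\<in>B. b \<gamma> \<beta> * xpow \<beta> x)" for \<gamma> z x
  have jq: "\<exists>d. jpoly I d (q \<gamma>)" for \<gamma>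
  proof -
    have ex: "\<exists>d. jpoly I d (\<lambda>z x. G \<gamma> g x * h g z x)" for g
    proof -
      obtain d where d: "jpoly I d (\<lambda>z :: 'i \<Rightarrow> real. G \<gamma> g)" using xpoly_imp_jpoly[OF G(1)] by (rule exE)
      obtain e where e: "jpoly I e (h g)" using h by (rule exE)
      show ?thesis using jpoly_mult[OF d e] by (rule exI)
    qed
    define d where "d g = (SOME d. jpoly I d (\<lambda>z x. G \<gamma> g x * h g z x))" for g
    have d: "jpoly I (d g) (\<lambda>z x. G \<gamma> g x * h g z x)" for g
      unfolding d_def by (rule someI_ex[OF ex])
    obtain e where e: "jpoly I e (\<lambda>z x. \<Sum>\<beta>\<in>B. b \<gamma> \<beta> * xpow \<beta> x)"
    proof
      show "jpoly I (\<Sum>\<beta>\<in>B. \<Sum>i\<in>UNIV. \<beta> i) (\<lambda>z x. \<Sum>\<beta>\<in>B. b \<gamma> \<beta> * xpow \<beta> x)"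
        by (intro jpoly_sum jpoly_cmult jpoly_xpow member_le_sum B(1)) auto
    qed
    let ?d = "(\<Sum>g\<in>UNIV. d g) + e"
    have "jpoly I ?d (\<lambda>z x. G \<gamma> g x * h g z x)" for g
      by (rule jpoly_mono[OF d]) (simp add: member_le_sum trans_le_add1)
    then have "jpoly I ?d (\<lambda>z x. (\<Sum>g\<in>UNIV. G \<gamma> g x * h g z x) + (\<Sum>\<beta>\<in>B. b \<gamma> \<beta> * xpow \<beta> x))"
      by (intro jpoly_add jpoly_sum jpoly_mono[OF e]) auto
    then have "jpoly I ?d (q \<gamma>)" unfolding q_def .
    then show ?thesis ..
  qed
  define d where "d \<gamma> = Suc (SOME d. jpoly I d (q \<gamma>))" for \<gamma>
  have "jpoly I (d \<gamma> - 1) (q \<gamma>)" for \<gamma>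
    unfolding d_def diff_Suc_1 by (rule someI_ex[OF jq])
  then have exc: "\<exists>c. (\<forall>\<alpha>. poly_fun I (c \<alpha>)) \<and> (\<forall>z x. q \<gamma> z x = peval (Suc (d \<gamma> - 1)) (\<lambda>\<alpha>. c \<alpha> z) x)" for \<gamma>
    unfolding jpoly_def .
  define c where "c \<gamma> = (SOME c. (\<forall>\<alpha>. poly_fun I (c \<alpha>)) \<and> (\<forall>z x. q \<gamma> z x = peval (Suc (d \<gamma> - 1)) (\<lambda>\<alpha>. c \<alpha> z) x))" for \<gamma>
  have cc: "(\<forall>\<alpha>. poly_fun I (c \<gamma> \<alpha>)) \<and> (\<forall>z x. q \<gamma> z x = peval (Suc (d \<gamma> - 1)) (\<lambda>\<alpha>. c \<gamma> \<alpha> z) x)" for \<gamma>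
    unfolding c_def by (rule someI_ex[OF exc])
  have c: "poly_fun I (c \<gamma> \<alpha>)" and qd: "q \<gamma> z x = peval (d \<gamma>) (\<lambda>\<alpha>. c \<gamma> \<alpha> z) x" for \<gamma> \<alpha> z x
    using cc[of \<gamma>] by (simp_all add: d_def)
  define D where "D = Suc s + (\<Sum>\<gamma>\<in>?S. d \<gamma>)"
  \<comment> \<open>Padding with zeros to the common bound D turns the coefficients of all q
    \<gamma> into one matrix. Only its block with both indices in ?S, that is of degree at most s,
    is inverted.\<close>
  define C where "C \<gamma> \<alpha> z = (if \<alpha> \<in> indices_below (d \<gamma>) then c \<gamma> \<alpha> z else 0)" for \<gamma> \<alpha> z
  have C: "poly_fun I (C \<gamma> \<alpha>)" for \<gamma> \<alpha>
    unfolding C_def using c by (cases "\<alpha> \<in> indices_below (d \<gamma>)") (auto intro: poly_fun.const)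
  have qC: "q \<gamma> z x = peval D (\<lambda>\<alpha>. C \<gamma> \<alpha> z) x" if "\<gamma> \<in> ?S" for \<gamma> z x
    unfolding qd C_def
    by (rule peval_extend) (use member_le_sum[OF that _ finite_indices_below, of d] in \<open>simp add: D_def\<close>)
  have SD: "?S \<subseteq> indices_below D" by (rule indices_below_mono) (simp add: D_def)
  have id: "C \<gamma> \<alpha> z0 = (if \<alpha> = \<gamma> then 1 else 0)" if "\<alpha> \<in> ?S" "\<gamma> \<in> ?S" for \<alpha> \<gamma>
  proof -
    have "peval D (\<lambda>\<alpha>. C \<gamma> \<alpha> z0 - (if \<alpha> = \<gamma> then 1 else 0)) x = 0" for x
    proof -
      have "q \<gamma> z0 x = xpow \<gamma> x" unfolding q_def using G(2)[of \<gamma> x] by simp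
      moreover have "(\<Sum>\<alpha>\<in>indices_below D. (if \<alpha> = \<gamma> then 1 else 0) * xpow \<alpha> x) = xpow \<gamma> x"
        using subsetD[OF SD that(2)]
        by (simp add: finite_indices_below if_distrib[of "\<lambda>u. u * _"] sum.delta cong: if_cong)
      ultimately show ?thesis
        using qC[OF that(2), of z0 x] unfolding peval_def left_diff_distrib sum_subtractf by simp
    qed
    then have "C \<gamma> \<alpha> z0 - (if \<alpha> = \<gamma> then 1 else 0) = 0"
      by (rule peval_eq_zero_imp) (use that(1) SD in blast)
    then show ?thesis by simp
  qed
  obtain p where p: "poly_fun I p" "p z0 \<noteq> 0"
    and solve: "\<And>z y. p z \<noteq> 0 \<Longrightarrow> \<exists>w. \<forall>\<alpha>\<in>?S. (\<Sum>\<gamma>\<in>?S. C \<gamma> \<alpha> z * w \<gamma>) = y \<alpha>"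
  proof -
    have "\<exists>p. poly_fun I p \<and> p z0 \<noteq> 0 \<and>
      (\<forall>z. p z \<noteq> 0 \<longrightarrow> (\<forall>y. \<exists>w. \<forall>\<alpha>\<in>?S. (\<Sum>\<gamma>\<in>?S. C \<gamma> \<alpha> z * w \<gamma>) = y \<alpha>))"
      by (rule generic_solvability[OF finite_indices_below C]) (rule id)
    then show ?thesis by (elim exE conjE) (rule that, auto)
  qed
  show ?thesis
  proof (rule exI[of _ p], intro conjI allI impI p)
    fix z i assume pz: "p z \<noteq> 0"
    \<comment> \<open>Weights for a combination of the q \<gamma> whose part of degree at most s is
      x i ^ j alone.\<close>
    define w where "w j = (SOME w. \<forall>\<alpha>\<in>?S. (\<Sum>\<gamma>\<in>?S. C \<gamma> \<alpha> z * w \<gamma>) = (if \<alpha> = single i j then 1 else 0))" for j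
    have "\<forall>\<alpha>\<in>?S. (\<Sum>\<gamma>\<in>?S. C \<gamma> \<alpha> z * w j \<gamma>) = (if \<alpha> = single i j then 1 else 0)" for j
      unfolding w_def by (rule someI_ex[OF solve[OF pz]])
    then have w: "(\<Sum>\<gamma>\<in>?S. C \<gamma> \<alpha> z * w j \<gamma>) = (if \<alpha> = single i j then 1 else 0)" if "\<alpha> \<in> ?S" for j \<alpha>
      using that by blast
    define bb where "bb \<beta> j = (\<Sum>\<gamma>\<in>?S. w j \<gamma> * b \<gamma> \<beta>)" for \<beta> j
    \<comment> \<open>There are s + 1 powers but at most s monomials in B, so some nontrivial
      combination a of the powers cancels all components along B.\<close>
    have "card B < card {..s}" using B(2) by simp
    from nontrivial_solution[OF B(1) finite_atMost this, of bb]
    obtain a where a: "\<exists>j\<le>s. a j \<noteq> 0" "\<And>\<beta>. \<beta> \<in> B \<Longrightarrow> (\<Sum>j\<le>s. bb \<beta> j * a j) = 0" by auto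
    define W where "W g x = (\<Sum>j\<le>s. a j * (\<Sum>\<gamma>\<in>?S. w j \<gamma> * G \<gamma> g x))" for g x
    define V where "V \<alpha> = (\<Sum>j\<le>s. a j * (\<Sum>\<gamma>\<in>?S. w j \<gamma> * C \<gamma> \<alpha> z))" for \<alpha>
    \<comment> \<open>The terms of order above s in the chosen combination, with the sign they get
      on the other side of the equation.\<close>
    define r where "r \<alpha> = (if \<alpha> \<in> ?S then 0 else - V \<alpha>)" for \<alpha>
    have "(\<Sum>j\<le>s. a j * x $ i ^ j) = (\<Sum>g\<in>UNIV. W g x * h g z x) + peval D r x" for x
    proof -
      have VS: "V \<alpha> = (\<Sum>j\<le>s. a j * (if \<alpha> = single i j then 1 else 0))" if "\<alpha> \<in> ?S" for \<alpha>
        unfolding V_def using w[OF that] by (simp add: mult.commute)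
      have "(\<Sum>j\<le>s. a j * (\<Sum>\<gamma>\<in>?S. w j \<gamma> * q \<gamma> z x)) = (\<Sum>j\<le>s. a j * (\<Sum>\<gamma>\<in>?S. w j \<gamma> * (\<Sum>\<alpha>\<in>indices_below D. C \<gamma> \<alpha> z * xpow \<alpha> x)))"
        by (intro sum.cong refl arg_cong2[where f = "\<lambda>u v. u * v"]) (simp add: qC peval_def)
      also have "\<dots> = (\<Sum>\<alpha>\<in>indices_below D. V \<alpha> * xpow \<alpha> x)"
        unfolding V_def sum_distrib_left sum_distrib_right
        by (subst sum_rotate) (simp add: mult_ac)
      also have "\<dots> = (\<Sum>\<alpha>\<in>indices_below D. (if \<alpha> \<in> ?S then V \<alpha> else 0) * xpow \<alpha> x) - peval D r x"
        unfolding peval_def sum_subtractf[symmetric] by (rule sum.cong) (auto simp: r_def)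
      also have "(\<Sum>\<alpha>\<in>indices_below D. (if \<alpha> \<in> ?S then V \<alpha> else 0) * xpow \<alpha> x) = (\<Sum>\<alpha>\<in>?S. V \<alpha> * xpow \<alpha> x)"
        by (rule sum.mono_neutral_cong_right[OF finite_indices_below SD]) auto
      also have "\<dots> = (\<Sum>\<alpha>\<in>?S. \<Sum>j\<le>s. a j * (if \<alpha> = single i j then xpow \<alpha> x else 0))"
      proof (rule sum.cong[OF refl])
        fix \<alpha> assume "\<alpha> \<in> ?S"
        then show "V \<alpha> * xpow \<alpha> x = (\<Sum>j\<le>s. a j * (if \<alpha> = single i j then xpow \<alpha> x else 0))"
          by (subst VS) (auto simp: sum_distrib_right intro!: sum.cong)
      qed
      also have "\<dots> = (\<Sum>j\<le>s. \<Sum>\<alpha>\<in>?S. a j * (if \<alpha> = single i j then xpow \<alpha> x else 0))"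
        by (rule sum.swap)
      also have "\<dots> = (\<Sum>j\<le>s. a j * x $ i ^ j)"
      proof (rule sum.cong[OF refl])
        fix j assume "j \<in> {..s}"
        then have "single i j \<in> ?S" by (simp add: indices_below_def sum_single)
        then show "(\<Sum>\<alpha>\<in>?S. a j * (if \<alpha> = single i j then xpow \<alpha> x else 0)) = a j * x $ i ^ j"
          unfolding sum_distrib_left[symmetric]
          by (simp add: finite_indices_below sum.delta xpow_single)
      qed
      finally have 1: "(\<Sum>j\<le>s. a j * (\<Sum>\<gamma>\<in>?S. w j \<gamma> * q \<gamma> z x)) = (\<Sum>j\<le>s. a j * x $ i ^ j) - peval D r x" .
      have "(\<Sum>j\<le>s. a j * (\<Sum>\<gamma>\<in>?S. w j \<gamma> * (\<Sum>g\<in>UNIV. G \<gamma> g x * h g z x))) = (\<Sum>g\<in>UNIV. W g x * h g z x)"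
        unfolding W_def sum_distrib_left sum_distrib_right
        by (subst sum_rotate) (simp add: mult_ac)
      moreover have "(\<Sum>j\<le>s. a j * (\<Sum>\<gamma>\<in>?S. w j \<gamma> * (\<Sum>\<beta>\<in>B. b \<gamma> \<beta> * xpow \<beta> x))) = (\<Sum>\<beta>\<in>B. (\<Sum>j\<le>s. bb \<beta> j * a j) * xpow \<beta> x)"
        unfolding bb_def sum_distrib_left sum_distrib_right
        by (subst sum_rotate) (simp add: mult_ac)
      moreover have "\<dots> = 0" using a(2) by simp
      ultimately have "(\<Sum>j\<le>s. a j * (\<Sum>\<gamma>\<in>?S. w j \<gamma> * q \<gamma> z x)) = (\<Sum>g\<in>UNIV. W g x * h g z x)"
        unfolding q_def distrib_left sum.distrib by simp
      then show ?thesis using 1 by simp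
    qed
    moreover have "xpoly (W g)" for g
      unfolding W_def by (intro xpoly_sum xpoly_mult xpoly_const G)
    moreover have "\<forall>\<gamma>\<in>?S. r \<gamma> = 0" by (simp add: r_def)
    ultimately show "\<exists>a w m r. (\<exists>j\<le>s. a j \<noteq> 0) \<and> (\<forall>g. xpoly (w g)) \<and> (\<forall>\<gamma>\<in>?S. r \<gamma> = 0) \<and>
        (\<forall>x. (\<Sum>j\<le>s. a j * x $ i ^ j) = (\<Sum>g\<in>UNIV. w g x * h g z x) + peval m r x)"
      using a(1) by (intro exI[of _ a] exI[of _ W] exI[of _ D] exI[of _ r]) auto
  qed
qed

section \<open>Reduction of monomials modulo the ideal of a perturbed jet\<close>

definition reducible :: "('g::finite \<Rightarrow> real^'n::finite \<Rightarrow> real) \<Rightarrow> ('n \<Rightarrow> nat) set \<Rightarrow> (real^'n \<Rightarrow> real) \<Rightarrow> bool" where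
  "reducible h B F \<longleftrightarrow> (\<exists>G b. (\<forall>g. xpoly (G g)) \<and>
     (\<forall>x. F x = (\<Sum>g\<in>UNIV. G g x * h g x) + (\<Sum>\<beta>\<in>B. b \<beta> * xpow \<beta> x)))"

lemma reducible_add:
  assumes "reducible h B F" "reducible h B F'"
  shows "reducible h B (\<lambda>x. F x + F' x)"
proof -
  from assms(1) obtain G b where 1: "\<forall>g. xpoly (G g)" "\<forall>x. F x = (\<Sum>g\<in>UNIV. G g x * h g x) + (\<Sum>\<beta>\<in>B. b \<beta> * xpow \<beta> x)"
    unfolding reducible_def by (elim exE conjE)
  from assms(2) obtain G' b' where 2: "\<forall>g. xpoly (G' g)" "\<forall>x. F' x = (\<Sum>g\<in>UNIV. G' g x * h g x) + (\<Sum>\<beta>\<in>B. b' \<beta> * xpow \<beta> x)"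
    unfolding reducible_def by (elim exE conjE)
  show ?thesis unfolding reducible_def
    by (rule exI[of _ "\<lambda>g x. G g x + G' g x"], rule exI[of _ "\<lambda>\<beta>. b \<beta> + b' \<beta>"])
      (simp add: 1 2 xpoly_add distrib_right sum.distrib)
qed

lemma reducible_zero: "reducible h B (\<lambda>_. 0)"
  unfolding reducible_def
  by (rule exI[of _ "\<lambda>g x. 0"], rule exI[of _ "\<lambda>\<beta>. 0"]) (simp add: xpoly_const)

lemma reducible_cmult:
  assumes "reducible h B F"
  shows "reducible h B (\<lambda>x. a * F x)"
proof -
  from assms obtain G b where 1: "\<forall>g. xpoly (G g)" "\<forall>x. F x = (\<Sum>g\<in>UNIV. G g x * h g x) + (\<Sum>\<beta>\<in>B. b \<beta> * xpow \<beta> x)"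
    unfolding reducible_def by (elim exE conjE)
  show ?thesis unfolding reducible_def
    by (rule exI[of _ "\<lambda>g x. a * G g x"], rule exI[of _ "\<lambda>\<beta>. a * b \<beta>"])
      (simp add: 1 xpoly_mult[OF xpoly_const] distrib_left sum_distrib_left mult.assoc)
qed

lemma reducible_sum: "(\<And>a. a \<in> A \<Longrightarrow> reducible h B (F a)) \<Longrightarrow> reducible h B (\<lambda>x. \<Sum>a\<in>A. F a x)"
proof (induction A rule: infinite_finite_induct)
  case (insert a A)
  then show ?case using reducible_add[of h B "F a" "\<lambda>x. \<Sum>a\<in>A. F a x"] by simp
qed (simp_all add: reducible_zero)

lemma reducible_generator:
  assumes "xpoly F"
  shows "reducible h B (\<lambda>x. F x * h g x)"
  unfolding reducible_def
proof (rule exI[of _ "\<lambda>g' x. (if g' = g then 1 else 0) * F x"], rule exI[of _ "\<lambda>\<beta>. 0"], intro conjI allI)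
  show "xpoly (\<lambda>x. (if g' = g then 1 else 0) * F x)" for g' by (intro xpoly_mult xpoly_const assms)
  show "F x * h g x = (\<Sum>g'\<in>UNIV. (if g' = g then 1 else 0) * F x * h g' x) + (\<Sum>\<beta>\<in>B. 0 * xpow \<beta> x)" for x
    by (simp add: if_distrib[of "\<lambda>u. u * _"] sum.delta cong: if_cong)
qed

lemma reducible_base:
  assumes "finite B" "\<beta> \<in> B"
  shows "reducible h B (xpow \<beta>)"
  unfolding reducible_def
proof (rule exI[of _ "\<lambda>g' x. 0"], rule exI[of _ "\<lambda>\<beta>'. if \<beta>' = \<beta> then 1 else 0"], intro conjI allI)
  show "xpow \<beta> x = (\<Sum>g'\<in>UNIV. 0 * h g' x) + (\<Sum>\<beta>'\<in>B. (if \<beta>' = \<beta> then 1 else 0) * xpow \<beta>' x)" for x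
    using assms by (simp add: if_distrib[of "\<lambda>u. u * _"] sum.delta cong: if_cong)
qed (rule xpoly_const)

lemma finite_exponent_box: "finite {\<beta> :: 'n::finite \<Rightarrow> nat. \<forall>i. \<beta> i < m}"
  by (rule finite_subset[of _ "PiE UNIV (\<lambda>_. {..<m})"]) (auto simp: finite_PiE)

text \<open>The indices \<open>Inr (i, j)\<close> give the 2 x 2 minors of the gradients of \<rho>
  and f. The functions d are separate from f so that the same formula serves a Taylor polynomial
  with formal derivatives and a smooth function with its partial derivatives.\<close>

definition gradient_generators ::
    "nat \<Rightarrow> (real^'n \<Rightarrow> real) \<Rightarrow> ('n::finite \<Rightarrow> real^'n \<Rightarrow> real) \<Rightarrow> 'n + 'n \<times> 'n \<Rightarrow> real^'n \<Rightarrow> real" where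
  "gradient_generators N f d g x = (case g of Inl l \<Rightarrow> f x * d l x
     | Inr (i, j) \<Rightarrow> x $ i ^ (N - 1) * d j x - x $ j ^ (N - 1) * d i x)"

text \<open>Up to lower degree, the minors put all x i ^ (N - 1) * x j ^ (N - 1) with i \<noteq> j
  into the ideal. Modulo these, the generator \<open>Inl i\<close> has the single leading term (c
  i)^2 / N * x i ^ (2 * N - 1). So a monomial outside the box can be traded for monomials of smaller
  total degree.\<close>

lemma reducible_xpow:
  fixes c :: "'n::finite \<Rightarrow> real" and lo :: "real^'n \<Rightarrow> real" and dl :: "'n \<Rightarrow> real^'n \<Rightarrow> real"
  assumes N: "2 \<le> N" and c: "inj c" "\<And>i. c i \<noteq> 0"
    and lo: "jpoly {} (N - 2) (\<lambda>z :: unit \<Rightarrow> real. lo)" and dl: "\<And>l. jpoly {} (N - 2) (\<lambda>z :: unit \<Rightarrow> real. dl l)"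
  shows "reducible (gradient_generators N (\<lambda>x. lo x + (\<Sum>j\<in>UNIV. c j / N * x $ j ^ N)) (\<lambda>l x. dl l x + c l * x $ l ^ (N - 1)))
    {\<beta>. \<forall>i. \<beta> i < 2 * N - 1} (xpow \<gamma>)"
proof -
  let ?J = "\<lambda>d F. jpoly {} d (\<lambda>z :: unit \<Rightarrow> real. F :: real^'n \<Rightarrow> real)"
  define g where "g x = (\<Sum>j\<in>UNIV. c j / N * x $ j ^ N)" for x :: "real^'n"
  define f where "f x = lo x + g x" for x
  define d where "d l x = dl l x + c l * x $ l ^ (N - 1)" for l x
  define h where "h = gradient_generators N f d"
  let ?B = "{\<beta> :: 'n \<Rightarrow> nat. \<forall>i. \<beta> i < 2 * N - 1}"
  have finB: "finite ?B" by (rule finite_exponent_box)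
  have Jg: "?J N g" unfolding g_def by (intro jpoly_sum jpoly_cmult jpoly_coord_power) simp
  have Jlo: "?J e lo" and Jdl: "?J e (dl l)" if "N - 2 \<le> e" for e l
    using jpoly_mono[OF lo that] jpoly_mono[OF dl that] by simp_all
  define R where "R i j x = x $ i ^ (N - 1) * dl j x - x $ j ^ (N - 1) * dl i x" for i j x
  have JR: "?J (2 * N - 3) (R i j)" for i j
  proof -
    have "?J ((N - 1) + (N - 2)) (\<lambda>x. x $ i ^ (N - 1) * dl j x)" for i j
      by (intro jpoly_mult jpoly_coord_power dl order_refl)
    moreover have "(N - 1) + (N - 2) = 2 * N - 3" using N by simp
    ultimately show ?thesis unfolding R_def by (intro jpoly_diff) simp_all
  qed
  \<comment> \<open>The mixed product is solved for from the minor; distinctness of the c i permits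
    the division. The error R has degree at most 2 * N - 3.\<close>
  have T: "x $ i ^ (N - 1) * x $ j ^ (N - 1) = (h (Inr (i, j)) x - R i j x) / (c j - c i)" if "j \<noteq> i" for i j x
  proof -
    have "h (Inr (i, j)) x = R i j x + (c j - c i) * (x $ i ^ (N - 1) * x $ j ^ (N - 1))"
      by (simp add: h_def gradient_generators_def R_def d_def algebra_simps)
    moreover have "c j - c i \<noteq> 0" using c(1) that by (simp add: inj_eq)
    ultimately show ?thesis by simp
  qed
  \<comment> \<open>Everything in the equation \<open>key\<close> apart from generators and the
    leading power. The products g * dl and x j * R reach degree 2 * N - 2, one less than that of the
    power being reduced.\<close>
  define low where "low i x = - (lo x * (dl i x + c i * x $ i ^ (N - 1)) + g x * dl i x)
     + (\<Sum>j\<in>UNIV - {i}. (c i * c j / (N * (c j - c i))) * (x $ j ^ 1 * R i j x))" for i x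
  have Jlow: "?J (2 * N - 2) (low i)" for i
  proof -
    have 1: "?J (2 * N - 2) (\<lambda>x. lo x * (dl i x + c i * x $ i ^ (N - 1)))"
      by (rule jpoly_mono[OF jpoly_mult[OF lo jpoly_add[OF Jdl jpoly_cmult[OF jpoly_coord_power]], of "N - 1"]]) (use N in auto)
    have 2: "?J (2 * N - 2) (\<lambda>x. g x * dl i x)"
      by (rule jpoly_mono[OF jpoly_mult[OF Jg dl]]) (use N in auto)
    have 3: "?J (2 * N - 2) (\<lambda>x. x $ j ^ 1 * R i j x)" for j
      by (rule jpoly_mono[OF jpoly_mult[OF jpoly_coord_power[OF order_refl] JR]]) (use N in auto)
    have "?J (2 * N - 2) (\<lambda>x. (- 1) * (lo x * (dl i x + c i * x $ i ^ (N - 1)) + g x * dl i x)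
       + (\<Sum>j\<in>UNIV - {i}. (c i * c j / (N * (c j - c i))) * (x $ j ^ 1 * R i j x)))"
      by (intro jpoly_add jpoly_cmult jpoly_sum 1 2 3)
    then show ?thesis unfolding low_def by simp
  qed
  have key: "(c i * c i / N) * x $ i ^ (2 * N - 1) = h (Inl i) x
      - (\<Sum>j\<in>UNIV - {i}. (c i * c j / (N * (c j - c i))) * (x $ j ^ 1 * h (Inr (i, j)) x)) + low i x" for i x
  proof -
    have N': "2 * N - 1 = (N - 1) + N" "N = Suc (N - 1)" using N by auto
    have "(c i * c i / N) * x $ i ^ (2 * N - 1) = c i * x $ i ^ (N - 1) * (c i / N * x $ i ^ N)"
      unfolding N'(1) power_add by simp
    also have "c i / N * x $ i ^ N = g x - (\<Sum>j\<in>UNIV - {i}. c j / N * x $ j ^ N)"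
      unfolding g_def by (simp add: sum.remove[of UNIV i])
    also have "c i * x $ i ^ (N - 1) * (g x - (\<Sum>j\<in>UNIV - {i}. c j / N * x $ j ^ N)) =
       c i * x $ i ^ (N - 1) * g x - (\<Sum>j\<in>UNIV - {i}. (c i * c j / N) * x $ j ^ 1 * (x $ i ^ (N - 1) * x $ j ^ (N - 1)))"
    proof -
      have "x $ j ^ N = x $ j * x $ j ^ (N - 1)" for j using N'(2) by (metis power_Suc)
      then show ?thesis by (simp add: right_diff_distrib sum_distrib_left mult_ac)
    qed
    also have "(\<Sum>j\<in>UNIV - {i}. (c i * c j / N) * x $ j ^ 1 * (x $ i ^ (N - 1) * x $ j ^ (N - 1))) =
       (\<Sum>j\<in>UNIV - {i}. (c i * c j / (N * (c j - c i))) * (x $ j ^ 1 * h (Inr (i, j)) x) -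
          (c i * c j / (N * (c j - c i))) * (x $ j ^ 1 * R i j x))"
    proof (rule sum.cong[OF refl])
      fix j assume "j \<in> UNIV - {i}"
      then have j: "j \<noteq> i" by simp
      show "(c i * c j / N) * x $ j ^ 1 * (x $ i ^ (N - 1) * x $ j ^ (N - 1)) =
        (c i * c j / (N * (c j - c i))) * (x $ j ^ 1 * h (Inr (i, j)) x) - (c i * c j / (N * (c j - c i))) * (x $ j ^ 1 * R i j x)"
        unfolding T[OF j] by (simp add: diff_divide_distrib right_diff_distrib)
    qed
    also have "c i * x $ i ^ (N - 1) * g x = h (Inl i) x - (lo x * (dl i x + c i * x $ i ^ (N - 1)) + g x * dl i x)"
      by (simp add: h_def gradient_generators_def f_def d_def algebra_simps)
    finally show ?thesis unfolding low_def sum_subtractf by simp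
  qed
  have "reducible h ?B (xpow \<gamma>)"
  \<comment> \<open>By total degree: replacing x i ^ (2 * N - 1) with \<open>low i\<close> lowers it
    by at least one, although single exponents may increase.\<close>
  proof (induction "\<Sum>i\<in>UNIV. \<gamma> i" arbitrary: \<gamma> rule: less_induct)
    case less
    show ?case
    proof (cases "\<gamma> \<in> ?B")
      case True
      then show ?thesis by (rule reducible_base[OF finB])
    next
      case False
      then obtain i where i: "2 * N - 1 \<le> \<gamma> i" by (auto simp: not_less)
      define \<gamma>' where "\<gamma>' = \<gamma>(i := \<gamma> i - (2 * N - 1))"
      have \<gamma>: "\<gamma> j = \<gamma>' j + single i (2 * N - 1) j" for j using i by (simp add: \<gamma>'_def single_def)
      have deg: "(\<Sum>j\<in>UNIV. \<gamma> j) = (\<Sum>j\<in>UNIV. \<gamma>' j) + (2 * N - 1)"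
        unfolding \<gamma> sum.distrib sum_single ..
      have xp: "xpow \<gamma> x = xpow \<gamma>' x * x $ i ^ (2 * N - 1)" for x
      proof -
        have "xpow \<gamma> x = xpow \<gamma>' x * xpow (single i (2 * N - 1)) x"
          unfolding xpow_def \<gamma> power_add prod.distrib ..
        then show ?thesis by (simp add: xpow_single)
      qed
      have X': "xpoly (xpow \<gamma>')"
        using jpoly_imp_xpoly[OF jpoly_xpow[OF order_refl]] .
      have "reducible h ?B (\<lambda>x. xpow \<gamma>' x * low i x)"
      proof -
        have "?J ((\<Sum>j\<in>UNIV. \<gamma>' j) + (2 * N - 2)) (\<lambda>x. xpow \<gamma>' x * low i x)"
          by (intro jpoly_mult Jlow jpoly_xpow order_refl)
        then obtain a where a: "\<And>(z :: unit \<Rightarrow> real) x. xpow \<gamma>' x * low i x = peval (Suc ((\<Sum>j\<in>UNIV. \<gamma>' j) + (2 * N - 2))) (\<lambda>\<alpha>. a \<alpha> z) x"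
          by (rule jpolyE) (rule that)
        have "reducible h ?B (\<lambda>x. \<Sum>\<alpha>\<in>indices_below (Suc ((\<Sum>j\<in>UNIV. \<gamma>' j) + (2 * N - 2))). a \<alpha> (\<lambda>_. 0) * xpow \<alpha> x)"
          by (intro reducible_sum reducible_cmult less.hyps) (use deg N in \<open>auto simp: indices_below_def\<close>)
        then show ?thesis unfolding a[of _ "\<lambda>_. 0"] peval_def .
      qed
      moreover have "reducible h ?B (\<lambda>x. xpow \<gamma>' x * h (Inl i) x)"
        by (rule reducible_generator[OF X'])
      moreover have "reducible h ?B (\<lambda>x. \<Sum>j\<in>UNIV - {i}. (- (c i * c j / (N * (c j - c i)))) * ((xpow \<gamma>' x * x $ j ^ 1) * h (Inr (i, j)) x))"
      proof (intro reducible_sum reducible_cmult reducible_generator xpoly_mult X')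
        show "xpoly (\<lambda>x. x $ j ^ 1)" for j
          using jpoly_imp_xpoly[OF jpoly_coord_power[OF order_refl]] .
      qed
      ultimately have "reducible h ?B (\<lambda>x. (N / (c i * c i)) * (xpow \<gamma>' x * low i x + (xpow \<gamma>' x * h (Inl i) x +
          (\<Sum>j\<in>UNIV - {i}. (- (c i * c j / (N * (c j - c i)))) * ((xpow \<gamma>' x * x $ j ^ 1) * h (Inr (i, j)) x)))))"
        by (intro reducible_cmult reducible_add)
      moreover have "(N / (c i * c i)) * (xpow \<gamma>' x * low i x + (xpow \<gamma>' x * h (Inl i) x +
          (\<Sum>j\<in>UNIV - {i}. (- (c i * c j / (N * (c j - c i)))) * ((xpow \<gamma>' x * x $ j ^ 1) * h (Inr (i, j)) x)))) = xpow \<gamma> x" for x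
      proof -
        let ?s = "\<Sum>j\<in>UNIV - {i}. (c i * c j / (N * (c j - c i))) * (x $ j ^ 1 * h (Inr (i, j)) x)"
        have "(\<Sum>j\<in>UNIV - {i}. (- (c i * c j / (N * (c j - c i)))) * ((xpow \<gamma>' x * x $ j ^ 1) * h (Inr (i, j)) x)) = - (xpow \<gamma>' x * ?s)"
          unfolding sum_distrib_left sum_negf[symmetric] by (rule sum.cong) auto
        then have "xpow \<gamma>' x * low i x + (xpow \<gamma>' x * h (Inl i) x +
          (\<Sum>j\<in>UNIV - {i}. (- (c i * c j / (N * (c j - c i)))) * ((xpow \<gamma>' x * x $ j ^ 1) * h (Inr (i, j)) x)))
          = xpow \<gamma>' x * (h (Inl i) x - ?s + low i x)" by (simp add: algebra_simps)
        also have "\<dots> = xpow \<gamma>' x * ((c i * c i / N) * x $ i ^ (2 * N - 1))" by (simp only: key)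
        finally show ?thesis using c(2)[of i] N by (simp add: xp)
      qed
      ultimately show ?thesis by (simp only:)
    qed
  qed
  then show ?thesis unfolding h_def f_def d_def g_def .
qed

text \<open>The generators for the Taylor polynomial of order m: the constant coefficient of z
  stands for f 0, and \<open>peval m (dcoeff l z)\<close> is the exact derivative of
  \<open>peval (Suc m) z\<close>.\<close>

definition jet_generators :: "nat \<Rightarrow> nat \<Rightarrow> 'n + 'n \<times> 'n \<Rightarrow> 'n::finite taylor_series \<Rightarrow> real^'n \<Rightarrow> real" where
  "jet_generators N m g z = gradient_generators N (\<lambda>x. peval (Suc m) z x - z (\<lambda>_. 0)) (\<lambda>l. peval m (dcoeff l z)) g"

lemma jpoly_jet_generators:
  fixes g :: "'n::finite + 'n \<times> 'n"
  shows "\<exists>d. jpoly (jet_indices m) d (jet_generators N m g)"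
proof -
  let ?I = "jet_indices m :: ('n \<Rightarrow> nat) set"
  have 1: "jpoly ?I m (\<lambda>z. peval (Suc m) z)"
  proof (rule jpolyI)
    show "poly_fun ?I (\<lambda>z. if \<alpha> \<in> ?I then z \<alpha> else 0)" for \<alpha>
      by (cases "\<alpha> \<in> ?I") (auto intro: poly_fun.intros)
  qed (auto intro!: peval_cong simp: jet_indices_eq)
  have 2: "jpoly ?I m (\<lambda>z. peval m (dcoeff l z))" for l
  proof (rule jpolyI)
    show "poly_fun ?I (\<lambda>z. if \<alpha> \<in> indices_below m then dcoeff l z \<alpha> else 0)" for \<alpha>
    proof (cases "\<alpha> \<in> indices_below m")
      case True
      then have "inc l \<alpha> \<in> ?I" by (simp add: jet_indices_eq indices_below_def sum_inc)
      then show ?thesis using True unfolding dcoeff_def by (auto intro: poly_fun_cmult poly_fun.coord)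
    qed (auto intro: poly_fun.const)
    show "peval m (dcoeff l z) x = peval (Suc m) (\<lambda>\<alpha>. if \<alpha> \<in> indices_below m then dcoeff l z \<alpha> else 0) x" for z x
      by (rule peval_extend) simp
  qed
  have 3: "jpoly ?I m (\<lambda>z x. peval (Suc m) z x - z (\<lambda>_. 0))"
    by (intro jpoly_diff 1 jpoly_const poly_fun.coord) (simp add: jet_indices_def)
  show ?thesis
  proof (cases g)
    case (Inl l)
    have "jpoly ?I (m + m) (\<lambda>z x. (peval (Suc m) z x - z (\<lambda>_. 0)) * peval m (dcoeff l z) x)"
      by (intro jpoly_mult 2 3)
    then show ?thesis unfolding Inl jet_generators_def gradient_generators_def by auto
  next
    case (Inr p)
    obtain i j where p: "p = (i, j)" by (cases p)
    have "jpoly ?I ((N - 1) + m) (\<lambda>z x. x $ i ^ (N - 1) * peval m (dcoeff j z) x - x $ j ^ (N - 1) * peval m (dcoeff i z) x)"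
      by (intro jpoly_diff jpoly_mult 2 jpoly_coord_power order_refl)
    then show ?thesis unfolding Inr p jet_generators_def gradient_generators_def by auto
  qed
qed

definition perturb :: "nat \<Rightarrow> nat \<Rightarrow> ('n \<Rightarrow> real) \<Rightarrow> 'n::finite taylor_series \<Rightarrow> 'n taylor_series" where
  "perturb k N c z = (\<lambda>\<alpha>. (if \<alpha> \<in> jet_indices k then z \<alpha> else 0) + (\<Sum>i\<in>UNIV. if \<alpha> = single i N then c i / N else 0))"

lemma perturb_eq:
  assumes "k < N" "\<alpha> \<in> jet_indices k"
  shows "perturb k N c z \<alpha> = z \<alpha>"
proof -
  have "\<alpha> \<noteq> single i N" for i using assms by (auto simp: jet_indices_def sum_single)
  then show ?thesis using assms(2) by (simp add: perturb_def)
qed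

lemma peval_perturb:
  fixes c :: "'n::finite \<Rightarrow> real"
  assumes "k < N" "N \<le> m"
  shows "peval (Suc m) (perturb k N c z) x = peval (Suc k) z x + (\<Sum>i\<in>UNIV. c i / N * x $ i ^ N)"
proof -
  have "peval (Suc m) (perturb k N c z) x =
    peval (Suc m) (\<lambda>\<alpha>. if \<alpha> \<in> indices_below (Suc k) then z \<alpha> else 0) x +
    (\<Sum>\<alpha>\<in>indices_below (Suc m). \<Sum>i\<in>UNIV. if \<alpha> = single i N then c i / N * xpow \<alpha> x else 0)"
    unfolding peval_def perturb_def distrib_right sum.distrib sum_distrib_right jet_indices_eq
    by (intro arg_cong2[where f = "(+)"] sum.cong refl) auto
  also have "(\<Sum>\<alpha>\<in>indices_below (Suc m). \<Sum>i\<in>UNIV. if \<alpha> = single i N then c i / N * xpow \<alpha> x else 0) =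
     (\<Sum>i\<in>UNIV. \<Sum>\<alpha>\<in>indices_below (Suc m). if \<alpha> = single i N then c i / N * xpow \<alpha> x else 0)"
    by (rule sum.swap)
  also have "\<dots> = (\<Sum>i\<in>UNIV. c i / N * x $ i ^ N)"
  proof (rule sum.cong[OF refl])
    fix i :: 'n
    have "single i N \<in> indices_below (Suc m)" using assms by (simp add: indices_below_def sum_single)
    then show "(\<Sum>\<alpha>\<in>indices_below (Suc m). if \<alpha> = single i N then c i / N * xpow \<alpha> x else 0) = c i / N * x $ i ^ N"
      by (simp add: finite_indices_below xpow_single)
  qed
  also have "peval (Suc m) (\<lambda>\<alpha>. if \<alpha> \<in> indices_below (Suc k) then z \<alpha> else 0) x = peval (Suc k) z x"
    using assms by (intro peval_extend[symmetric]) simp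
  finally show ?thesis .
qed

text \<open>Obtained by differentiating the identity \<open>peval_perturb\<close> of polynomial
  functions; the factor N cancels the denominator.\<close>

lemma peval_dcoeff_perturb:
  fixes c :: "'n::finite \<Rightarrow> real"
  assumes "k < N" "N \<le> m"
  shows "peval m (dcoeff l (perturb k N c z)) x = peval k (dcoeff l z) x + c l * x $ l ^ (N - 1)"
proof -
  have e: "peval (Suc m) (perturb k N c z) = (\<lambda>x. peval (Suc k) z x + (\<Sum>i\<in>UNIV. c i / N * x $ i ^ N))"
    by (rule ext) (rule peval_perturb[OF assms])
  have 1: "((\<lambda>x. c i / N * x $ i ^ N) has_derivative (\<lambda>v. c i / N * (real N * v $ i * x $ i ^ (N - 1)))) (at x)" for i
    by (intro has_derivative_mult_right has_derivative_power bounded_linear_imp_has_derivative bounded_linear_vec_nth)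
  have "(peval (Suc m) (perturb k N c z) has_derivative
     (\<lambda>v. (\<Sum>i\<in>UNIV. v $ i * peval k (dcoeff i z) x) + (\<Sum>i\<in>UNIV. c i / N * (real N * v $ i * x $ i ^ (N - 1))))) (at x)"
    unfolding e by (intro has_derivative_add has_derivative_peval has_derivative_sum 1)
  from frechet_derivative_at[OF this]
  have "partial_deriv l (peval (Suc m) (perturb k N c z)) x =
    (\<Sum>i\<in>UNIV. axis l 1 $ i * peval k (dcoeff i z) x) + (\<Sum>i\<in>UNIV. c i / N * (real N * axis l 1 $ i * x $ i ^ (N - 1)))"
    unfolding partial_deriv_def by (simp only: fun_eq_iff)
  also have "(\<Sum>i\<in>UNIV. axis l 1 $ i * peval k (dcoeff i z) x) = peval k (dcoeff l z) x"
    by (simp add: axis_def if_distrib[of "\<lambda>u. u * _"] cong: if_cong)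
  also have "(\<Sum>i\<in>UNIV. c i / N * (real N * axis l 1 $ i * x $ i ^ (N - 1))) = (\<Sum>i\<in>UNIV. if i = l then c i * x $ i ^ (N - 1) else 0)"
    using assms(1) by (intro sum.cong) (auto simp: axis_def)
  finally show ?thesis by (simp add: partial_deriv_peval)
qed

text \<open>The order of the quantifiers matters: s is the number of monomials with all exponents
  below 2 * N - 1, which does not depend on m, so that m can afterwards be chosen larger than
  s.\<close>

lemma generic_jet_dependence:
  assumes k: "k + 2 \<le> N"
  shows "\<exists>s. \<forall>m. N \<le> m \<longrightarrow> (\<forall>z0 :: 'n::finite taylor_series. \<exists>y p. (\<forall>\<alpha>\<in>jet_indices k. y \<alpha> = z0 \<alpha>) \<and>
    poly_fun (jet_indices m) p \<and> p y \<noteq> 0 \<and> (\<forall>z. p z \<noteq> 0 \<longrightarrow> (\<forall>i. \<exists>a w m' r.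
    (\<exists>j\<le>s. a j \<noteq> 0) \<and> (\<forall>g. xpoly (w g)) \<and> (\<forall>\<gamma>\<in>indices_below (Suc s). r \<gamma> = 0) \<and>
    (\<forall>x. (\<Sum>j\<le>s. a j * x $ i ^ j) = (\<Sum>g\<in>UNIV. w g x * jet_generators N m g z x) + peval m' r x))))"
proof -
  let ?B = "{\<beta> :: 'n \<Rightarrow> nat. \<forall>i. \<beta> i < 2 * N - 1}"
  have finB: "finite ?B" by (rule finite_exponent_box)
  \<comment> \<open>Any distinct nonzero numbers serve; they come from an injective numbering of the
    variables, shifted by one to avoid 0.\<close>
  obtain c :: "'n \<Rightarrow> real" where c: "inj c" "\<And>i. c i \<noteq> 0"
  proof -
    obtain e :: "'n \<Rightarrow> nat" where e: "inj e"
      using finite_imp_inj_to_nat_seg[of "UNIV :: 'n set"] by auto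
    show ?thesis
    proof (rule that[of "\<lambda>i. real (Suc (e i))"])
      show "inj (\<lambda>i. real (Suc (e i)))" using e by (auto simp: inj_on_def)
    qed (simp del: of_nat_Suc)
  qed
  show ?thesis
  proof (rule exI[of _ "card ?B"], intro allI impI)
    fix m and z0 :: "'n taylor_series" assume m: "N \<le> m"
    let ?y = "perturb k N c z0"
    have kN: "k < N" using k by simp
    let ?h = "\<lambda>g. jet_generators N m g ?y"
    have red: "reducible ?h ?B (xpow \<gamma>)" for \<gamma>
    proof -
      have y0: "?y (\<lambda>_. 0) = z0 (\<lambda>_. 0)"
        by (rule perturb_eq[OF kN]) (simp add: jet_indices_def)
      have h: "?h = gradient_generators N (\<lambda>x. (peval (Suc k) z0 x - z0 (\<lambda>_. 0)) + (\<Sum>j\<in>UNIV. c j / N * x $ j ^ N))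
          (\<lambda>l x. peval k (dcoeff l z0) x + c l * x $ l ^ (N - 1))"
        unfolding fun_eq_iff jet_generators_def gradient_generators_def y0
        by (simp add: peval_perturb[OF kN m] peval_dcoeff_perturb[OF kN m] split: sum.split)
      have J: "jpoly {} (N - 2) (\<lambda>z :: unit \<Rightarrow> real. peval (Suc k) c :: real^'n \<Rightarrow> real)" for c
        by (rule jpoly_mono[of _ k]) (use k in \<open>auto intro!: jpolyI[where c = "\<lambda>\<alpha> _. c \<alpha>"] poly_fun.const\<close>)
      have J': "jpoly {} (N - 2) (\<lambda>z :: unit \<Rightarrow> real. peval k c :: real^'n \<Rightarrow> real)" for c
      proof -
        have "peval k c = peval (Suc k) (\<lambda>\<alpha>. if \<alpha> \<in> indices_below k then c \<alpha> else 0)"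
          by (rule ext) (rule peval_extend, simp)
        then show ?thesis using J by (simp only:)
      qed
      show ?thesis unfolding h
        by (rule reducible_xpow) (use k in \<open>auto intro!: c J J' jpoly_diff jpoly_const poly_fun.const\<close>)
    qed
    define P where "P \<gamma> Gb \<longleftrightarrow> (\<forall>g. xpoly (fst Gb g)) \<and>
       (\<forall>x. xpow \<gamma> x = (\<Sum>g\<in>UNIV. fst Gb g x * ?h g x) + (\<Sum>\<beta>\<in>?B. snd Gb \<beta> * xpow \<beta> x))" for \<gamma> and Gb :: "_ \<times> (('n \<Rightarrow> nat) \<Rightarrow> real)"
    define Gb where "Gb \<gamma> = (SOME Gb. P \<gamma> Gb)" for \<gamma>
    have "\<exists>Gb. P \<gamma> Gb" for \<gamma>
    proof -
      from red[of \<gamma>] obtain G b where "(\<forall>g. xpoly (G g)) \<and>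
        (\<forall>x. xpow \<gamma> x = (\<Sum>g\<in>UNIV. G g x * ?h g x) + (\<Sum>\<beta>\<in>?B. b \<beta> * xpow \<beta> x))"
        unfolding reducible_def by (elim exE)
      then have "P \<gamma> (G, b)" by (simp add: P_def)
      then show ?thesis ..
    qed
    then have Gb: "P \<gamma> (Gb \<gamma>)" for \<gamma> unfolding Gb_def by (rule someI_ex)
    have "\<exists>p. poly_fun (jet_indices m) p \<and> p ?y \<noteq> 0 \<and> (\<forall>z. p z \<noteq> 0 \<longrightarrow> (\<forall>i. \<exists>a w m' r.
      (\<exists>j\<le>card ?B. a j \<noteq> 0) \<and> (\<forall>g. xpoly (w g)) \<and> (\<forall>\<gamma>\<in>indices_below (Suc (card ?B)). r \<gamma> = 0) \<and>
      (\<forall>x. (\<Sum>j\<le>card ?B. a j * x $ i ^ j) = (\<Sum>g\<in>UNIV. w g x * jet_generators N m g z x) + peval m' r x)))"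
    proof (rule generic_dependence[OF jpoly_jet_generators finB order_refl])
      show "xpoly (fst (Gb \<gamma>) g)" for \<gamma> g using Gb[of \<gamma>] by (simp add: P_def)
      show "xpow \<gamma> x = (\<Sum>g\<in>UNIV. fst (Gb \<gamma>) g x * ?h g x) + (\<Sum>\<beta>\<in>?B. snd (Gb \<gamma>) \<beta> * xpow \<beta> x)" for \<gamma> x
        using Gb[of \<gamma>] by (simp add: P_def)
    qed
    moreover have "\<forall>\<alpha>\<in>jet_indices k. ?y \<alpha> = z0 \<alpha>" by (intro ballI perturb_eq[OF kN])
    ultimately show "\<exists>y p. (\<forall>\<alpha>\<in>jet_indices k. y \<alpha> = z0 \<alpha>) \<and> poly_fun (jet_indices m) p \<and> p y \<noteq> 0 \<and>
      (\<forall>z. p z \<noteq> 0 \<longrightarrow> (\<forall>i. \<exists>a w m' r.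
      (\<exists>j\<le>card ?B. a j \<noteq> 0) \<and> (\<forall>g. xpoly (w g)) \<and> (\<forall>\<gamma>\<in>indices_below (Suc (card ?B)). r \<gamma> = 0) \<and>
      (\<forall>x. (\<Sum>j\<le>card ?B. a j * x $ i ^ j) = (\<Sum>g\<in>UNIV. w g x * jet_generators N m g z x) + peval m' r x)))"
      by (intro exI[of _ ?y]) simp
  qed
qed

section \<open>Nondegeneracy of functions with a generic jet\<close>

definition vanishes_to_order :: "nat \<Rightarrow> (real^'n::finite \<Rightarrow> real) \<Rightarrow> bool" where
  "vanishes_to_order m F \<longleftrightarrow> (\<exists>C. \<forall>\<^sub>F x in nhds 0. \<bar>F x\<bar> \<le> C * norm x ^ m)"

lemma vanishes_to_order_add:
  assumes "vanishes_to_order m F" "vanishes_to_order m G"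
  shows "vanishes_to_order m (\<lambda>x. F x + G x)"
proof -
  obtain C where C: "\<forall>\<^sub>F x in nhds 0. \<bar>F x\<bar> \<le> C * norm x ^ m" using assms(1) unfolding vanishes_to_order_def by (rule exE)
  obtain D where D: "\<forall>\<^sub>F x in nhds 0. \<bar>G x\<bar> \<le> D * norm x ^ m" using assms(2) unfolding vanishes_to_order_def by (rule exE)
  show ?thesis unfolding vanishes_to_order_def
    by (rule exI[of _ "C + D"], rule eventually_mono[OF eventually_conj[OF C D]]) (auto simp: distrib_right)
qed

lemma vanishes_to_order_mult:
  assumes "vanishes_to_order m F" "vanishes_to_order n G"
  shows "vanishes_to_order (m + n) (\<lambda>x. F x * G x)"
proof -
  obtain C where C: "\<forall>\<^sub>F x in nhds 0. \<bar>F x\<bar> \<le> C * norm x ^ m" using assms(1) unfolding vanishes_to_order_def by (rule exE)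
  obtain D where D: "\<forall>\<^sub>F x in nhds 0. \<bar>G x\<bar> \<le> D * norm x ^ n" using assms(2) unfolding vanishes_to_order_def by (rule exE)
  show ?thesis unfolding vanishes_to_order_def
  proof (rule exI[of _ "C * D"], rule eventually_mono[OF eventually_conj[OF C D]], elim conjE)
    fix x assume "\<bar>F x\<bar> \<le> C * norm x ^ m" "\<bar>G x\<bar> \<le> D * norm x ^ n"
    then have "\<bar>F x\<bar> * \<bar>G x\<bar> \<le> (C * norm x ^ m) * (D * norm x ^ n)"
      by (intro mult_mono) auto
    then show "\<bar>F x * G x\<bar> \<le> C * D * norm x ^ (m + n)" by (simp add: abs_mult power_add mult_ac)
  qed
qed

lemma vanishes_to_order_mono:
  assumes "vanishes_to_order n F" "m \<le> n"
  shows "vanishes_to_order m F"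
proof -
  obtain C where C: "\<forall>\<^sub>F x in nhds 0. \<bar>F x\<bar> \<le> C * norm x ^ n" using assms(1) unfolding vanishes_to_order_def by (rule exE)
  have "\<forall>\<^sub>F x in nhds (0 :: real^'a). norm x < 1"
    unfolding eventually_nhds_metric by (intro exI[of _ 1]) auto
  with C have "\<forall>\<^sub>F x in nhds 0. \<bar>F x\<bar> \<le> \<bar>C\<bar> * norm x ^ m"
  proof eventually_elim
    case (elim x)
    have "C * norm x ^ n \<le> \<bar>C\<bar> * norm x ^ n" by (intro mult_right_mono) auto
    also have "\<dots> \<le> \<bar>C\<bar> * norm x ^ m"
      using elim(2) assms(2) by (intro mult_left_mono power_decreasing) auto
    finally show ?case using elim(1) by simp
  qed
  then show ?thesis unfolding vanishes_to_order_def by (rule exI)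
qed

lemma vanishes_to_order_zero: "vanishes_to_order m (\<lambda>_. 0)"
  unfolding vanishes_to_order_def by (intro exI[of _ 0]) simp

lemma vanishes_to_order_sum:
  "(\<And>a. a \<in> A \<Longrightarrow> vanishes_to_order m (F a)) \<Longrightarrow> vanishes_to_order m (\<lambda>x. \<Sum>a\<in>A. F a x)"
proof (induction A rule: infinite_finite_induct)
  case (insert a A)
  then show ?case using vanishes_to_order_add[of m "F a" "\<lambda>x. \<Sum>a\<in>A. F a x"] by simp
qed (simp_all add: vanishes_to_order_zero)

lemma vanishes_to_order_isCont:
  fixes F :: "real^'n::finite \<Rightarrow> real"
  assumes "isCont F 0"
  shows "vanishes_to_order 0 F"
proof -
  obtain d where d: "d > 0" "\<And>y. dist y 0 < d \<Longrightarrow> dist (F y) (F 0) < 1"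
    using assms unfolding continuous_at_eps_delta using zero_less_one by blast
  have "\<forall>\<^sub>F x in nhds 0. \<bar>F x\<bar> \<le> (\<bar>F 0\<bar> + 1) * norm x ^ 0"
    unfolding eventually_nhds_metric
  proof (intro exI[of _ d] conjI allI impI d(1))
    fix y :: "real^'n" assume "dist y 0 < d"
    from d(2)[OF this] show "\<bar>F y\<bar> \<le> (\<bar>F 0\<bar> + 1) * norm y ^ 0" by (simp add: dist_real_def)
  qed
  then show ?thesis unfolding vanishes_to_order_def by (rule exI)
qed

lemma vanishes_to_order_cmult: "vanishes_to_order m F \<Longrightarrow> vanishes_to_order m (\<lambda>x. a * F x)"
  using vanishes_to_order_mult[OF vanishes_to_order_isCont[of "\<lambda>_. a"], of m F] by simp

lemma isCont_peval: "isCont (peval m c) x"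
proof -
  have e: "peval m c = peval (Suc m) (\<lambda>\<alpha>. if \<alpha> \<in> indices_below m then c \<alpha> else 0)"
    by (rule ext) (rule peval_extend, simp)
  show ?thesis
    unfolding e by (rule has_derivative_continuous[OF has_derivative_peval])
qed

lemma abs_xpow_le: "\<bar>xpow \<alpha> x\<bar> \<le> norm x ^ (\<Sum>i\<in>UNIV. \<alpha> i)"
proof -
  have "\<bar>xpow \<alpha> x\<bar> = (\<Prod>i\<in>UNIV. \<bar>x $ i\<bar> ^ \<alpha> i)" by (simp add: xpow_def abs_prod power_abs)
  also have "\<dots> \<le> (\<Prod>i\<in>UNIV. norm x ^ \<alpha> i)"
    by (intro prod_mono conjI power_mono component_le_norm_cart) auto
  finally show ?thesis by (simp add: power_sum)
qed

lemma vanishes_to_order_peval: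
  assumes "\<And>\<alpha>. \<alpha> \<in> indices_below s \<Longrightarrow> r \<alpha> = 0"
  shows "vanishes_to_order s (peval m r)"
proof -
  have "vanishes_to_order s (\<lambda>x. r \<alpha> * xpow \<alpha> x)" for \<alpha>
  proof (cases "\<alpha> \<in> indices_below s")
    case True
    then show ?thesis using assms vanishes_to_order_zero by simp
  next
    case False
    have "vanishes_to_order (\<Sum>i\<in>UNIV. \<alpha> i) (xpow \<alpha>)"
      unfolding vanishes_to_order_def by (rule exI[of _ 1]) (simp add: abs_xpow_le)
    then show ?thesis
      using False by (intro vanishes_to_order_cmult) (auto elim: vanishes_to_order_mono simp: indices_below_def)
  qed
  then show ?thesis unfolding peval_def[abs_def] by (intro vanishes_to_order_sum)
qed

text \<open>Near 0 the lowest nonzero term of the polynomial, of degree at most s, dominates any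
  multiple of the power s + 1.\<close>

lemma poly_not_small:
  fixes a :: "nat \<Rightarrow> real"
  assumes "\<exists>j\<le>s. a j \<noteq> 0"
  shows "\<forall>\<^sub>F t in nhds 0. t \<noteq> 0 \<longrightarrow> K * \<bar>t\<bar> ^ Suc s < \<bar>\<Sum>j\<le>s. a j * t ^ j\<bar>"
proof -
  define k where "k = (LEAST j. a j \<noteq> 0)"
  obtain j where j: "j \<le> s" "a j \<noteq> 0" using assms by blast
  have k: "a k \<noteq> 0" "k \<le> s" "\<And>i. i < k \<Longrightarrow> a i = 0"
  proof -
    show "a k \<noteq> 0" unfolding k_def by (rule LeastI[of "\<lambda>j. a j \<noteq> 0", OF j(2)])
    show "k \<le> s" using Least_le[of "\<lambda>j. a j \<noteq> 0", OF j(2)] j(1) unfolding k_def by (rule order_trans)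
    show "a i = 0" if "i < k" for i using not_less_Least[OF that[unfolded k_def]] by simp
  qed
  define q where "q t = (\<Sum>j\<le>s. a j * t ^ (j - k))" for t
  have q: "(\<Sum>j\<le>s. a j * t ^ j) = t ^ k * q t" for t
    unfolding q_def sum_distrib_left
  proof (rule sum.cong[OF refl])
    fix i show "a i * t ^ i = t ^ k * (a i * t ^ (i - k))"
    proof (cases "i < k")
      case False
      then have "t ^ i = t ^ k * t ^ (i - k)" by (simp add: power_add[symmetric])
      then show ?thesis by simp
    qed (simp add: k(3))
  qed
  have "q 0 = (\<Sum>j\<le>s. if j = k then a k else 0)"
    unfolding q_def
  proof (rule sum.cong[OF refl])
    fix i show "a i * 0 ^ (i - k) = (if i = k then a k else 0)"
      by (cases i k rule: linorder_cases) (simp_all add: k(3))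
  qed
  then have q0: "q 0 = a k" using k(2) by simp
  \<comment> \<open>After division by the lowest power of t. As k \<le> s, the exponent Suc s - k is
    positive, so v 0 is the modulus of a k.\<close>
  define v where "v t = \<bar>q t\<bar> - K * \<bar>t\<bar> ^ (Suc s - k)" for t
  have "isCont v 0"
    unfolding v_def q_def by (intro continuous_intros)
  then have "(v \<longlongrightarrow> v 0) (nhds 0)"
    unfolding isCont_def by (rule tendsto_at_iff_tendsto_nhds[THEN iffD1])
  moreover have "0 < v 0" using q0 k(1,2) by (simp add: v_def Suc_diff_le)
  ultimately have "\<forall>\<^sub>F t in nhds 0. 0 < v t"
    by (rule order_tendstoD(1))
  then show ?thesis
  proof eventually_elim
    case (elim t)
    show ?case
    proof
      assume t: "t \<noteq> 0"
      have "Suc s = k + (Suc s - k)" using k(2) by simp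
      then have "K * \<bar>t\<bar> ^ Suc s = \<bar>t\<bar> ^ k * (K * \<bar>t\<bar> ^ (Suc s - k))"
        by (metis mult.left_commute power_add)
      also have "\<dots> < \<bar>t\<bar> ^ k * \<bar>q t\<bar>"
        using elim t unfolding v_def by (intro mult_strict_left_mono) auto
      also have "\<dots> = \<bar>\<Sum>j\<le>s. a j * t ^ j\<bar>" by (simp add: q abs_mult power_abs)
      finally show "K * \<bar>t\<bar> ^ Suc s < \<bar>\<Sum>j\<le>s. a j * t ^ j\<bar>" .
    qed
  qed
qed

lemma vanishes_to_order_taylor:
  fixes f :: "real^'n \<Rightarrow> real"
  assumes "open U" "0 \<in> U" "smooth_on U f"
  shows "vanishes_to_order m (\<lambda>x. f x - peval m (taylor f) x)"
proof -
  obtain C d where d: "0 < d" "\<And>x. norm x < d \<Longrightarrow> \<bar>f x - peval m (taylor f) x\<bar> \<le> C * norm x ^ m"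
    using taylor_remainder[OF assms, of m] by blast
  have "\<forall>\<^sub>F x in nhds 0. \<bar>f x - peval m (taylor f) x\<bar> \<le> C * norm x ^ m"
    unfolding eventually_nhds_metric by (rule exI[of _ d]) (use d in auto)
  then show ?thesis unfolding vanishes_to_order_def by (rule exI)
qed

text \<open>Each difference of products is written as a sum of products in which one factor is a
  Taylor remainder of order m and the other is continuous at 0.\<close>

lemma generators_close_to_jet:
  fixes f :: "real^'n \<Rightarrow> real"
  assumes U: "open U" "0 \<in> U" and f: "smooth_on U f"
  shows "vanishes_to_order m (\<lambda>x. jet_generators N m g (taylor f) x -
    gradient_generators N (\<lambda>x. f x - f 0) (\<lambda>l. partial_deriv l f) g x)"
proof -
  have c: "isCont f 0" "isCont (partial_deriv l f) 0" for l
    using smooth_on_continuous_on[OF f] smooth_on_continuous_on[OF smooth_on_partial_deriv[OF f]] U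
    by (auto simp: continuous_on_eq_continuous_at)
  have 0: "vanishes_to_order m (\<lambda>x. (- 1) * (f x - peval m (taylor f) x))"
    if "smooth_on U f" for m and f :: "real^'n \<Rightarrow> real"
    using vanishes_to_order_cmult[OF vanishes_to_order_taylor[OF U that]] .
  have 1: "vanishes_to_order m (\<lambda>x. peval (Suc m) (taylor f) x - f x)"
    using vanishes_to_order_mono[OF 0[OF f, of "Suc m"], of m] by simp
  have 2: "vanishes_to_order m (\<lambda>x. peval m (dcoeff l (taylor f)) x - partial_deriv l f x)" for l
    using 0[OF smooth_on_partial_deriv[OF f], of m l] taylor_partial_deriv[OF U f] by simp
  have xp: "vanishes_to_order 0 (\<lambda>x. x $ i ^ (N - 1))" for i :: 'n
    by (rule vanishes_to_order_isCont) (intro continuous_intros)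
  show ?thesis
  proof (cases g)
    case (Inl l)
    have "vanishes_to_order m (\<lambda>x. (peval (Suc m) (taylor f) x - f 0) * (peval m (dcoeff l (taylor f)) x - partial_deriv l f x)
      + partial_deriv l f x * (peval (Suc m) (taylor f) x - f x))"
    proof (rule vanishes_to_order_add)
      have "vanishes_to_order 0 (\<lambda>x. peval (Suc m) (taylor f) x - f 0)"
        by (rule vanishes_to_order_isCont) (intro continuous_intros isCont_peval)
      from vanishes_to_order_mult[OF this 2[of l]]
      show "vanishes_to_order m (\<lambda>x. (peval (Suc m) (taylor f) x - f 0) * (peval m (dcoeff l (taylor f)) x - partial_deriv l f x))"
        by simp
      from vanishes_to_order_mult[OF vanishes_to_order_isCont[OF c(2)] 1]
      show "vanishes_to_order m (\<lambda>x. partial_deriv l f x * (peval (Suc m) (taylor f) x - f x))" by simp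
    qed
    then show ?thesis
      unfolding Inl jet_generators_def gradient_generators_def taylor_zero by (simp add: algebra_simps)
  next
    case (Inr p)
    obtain i j where p: "p = (i, j)" by (cases p)
    have "vanishes_to_order m (\<lambda>x. x $ i ^ (N - 1) * (peval m (dcoeff j (taylor f)) x - partial_deriv j f x)
      + (- 1) * (x $ j ^ (N - 1) * (peval m (dcoeff i (taylor f)) x - partial_deriv i f x)))"
      using vanishes_to_order_add[OF vanishes_to_order_mult[OF xp[of i] 2[of j]]
          vanishes_to_order_cmult[OF vanishes_to_order_mult[OF xp[of j] 2[of i]], of "- 1"]] by simp
    then show ?thesis
      unfolding Inr p jet_generators_def gradient_generators_def by (simp add: algebra_simps)
  qed
qed

text \<open>At a common zero x of the generators of f, those of the jet are of size norm x ^ m with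
  m > s, so the relation bounds the polynomial in x i by a multiple of norm x ^ Suc s. For the
  largest coordinate this contradicts \<open>poly_not_small\<close> unless x = 0.\<close>

lemma generators_nonzero_near_zero:
  fixes f :: "real^'n \<Rightarrow> real"
  assumes U: "open U" "0 \<in> U" and f: "smooth_on U f" and m: "s < m"
    and dep: "\<forall>i. \<exists>a w m' r. (\<exists>j\<le>s. a j \<noteq> 0) \<and> (\<forall>g. xpoly (w g)) \<and> (\<forall>\<gamma>\<in>indices_below (Suc s). r \<gamma> = 0) \<and>
    (\<forall>x. (\<Sum>j\<le>s. a j * x $ i ^ j) = (\<Sum>g\<in>UNIV. w g x * jet_generators N m g (taylor f) x) + peval m' r x)"
  shows "\<forall>\<^sub>F x in nhds 0. x \<noteq> 0 \<longrightarrow>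
    (\<exists>g. gradient_generators N (\<lambda>x. f x - f 0) (\<lambda>l. partial_deriv l f) g x \<noteq> 0)"
proof -
  let ?h = "gradient_generators N (\<lambda>x. f x - f 0) (\<lambda>l. partial_deriv l f)"
  let ?H = "\<lambda>g. jet_generators N m g (taylor f)"
  let ?n = "real CARD('n)"
  \<comment> \<open>The restriction to norm x \<le> n * \<bar>x i\<bar> converts the error from a
    power of norm x into the same power of x i, the variable of the polynomial.\<close>
  have step: "\<forall>\<^sub>F x in nhds 0. (\<forall>g. ?h g x = 0) \<longrightarrow> norm x \<le> ?n * \<bar>x $ i\<bar> \<longrightarrow> x $ i = 0" for i
  proof -
    from dep[rule_format, of i] obtain a w m' r where D: "(\<exists>j\<le>s. a j \<noteq> 0) \<and> (\<forall>g. xpoly (w g)) \<and>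
      (\<forall>\<gamma>\<in>indices_below (Suc s). r \<gamma> = 0) \<and>
      (\<forall>x. (\<Sum>j\<le>s. a j * x $ i ^ j) = (\<Sum>g\<in>UNIV. w g x * ?H g x) + peval m' r x)" by (elim exE)
    from D have a: "\<exists>j\<le>s. a j \<noteq> 0" by (rule conjunct1)
    from D have w: "\<forall>g. xpoly (w g)" by (elim conjE)
    from D have r: "\<forall>\<gamma>\<in>indices_below (Suc s). r \<gamma> = 0" by (elim conjE)
    from D have eq': "\<forall>x. (\<Sum>j\<le>s. a j * x $ i ^ j) = (\<Sum>g\<in>UNIV. w g x * ?H g x) + peval m' r x" by (elim conjE)
    have eq: "(\<Sum>j\<le>s. a j * x $ i ^ j) = (\<Sum>g\<in>UNIV. w g x * ?H g x) + peval m' r x" for x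
      using eq' by (rule spec)
    have wc: "vanishes_to_order 0 (w g)" for g
    proof -
      obtain m c where "w g = peval m c" using w[rule_format, of g] unfolding xpoly_def by (elim exE)
      then show ?thesis using vanishes_to_order_isCont[OF isCont_peval] by simp
    qed
    have "vanishes_to_order (Suc s) (\<lambda>x. (\<Sum>g\<in>UNIV. w g x * (?H g x - ?h g x)) + peval m' r x)"
    proof (intro vanishes_to_order_add vanishes_to_order_sum vanishes_to_order_peval)
      fix g
      have "vanishes_to_order (Suc s) (\<lambda>x. ?H g x - ?h g x)"
        by (rule vanishes_to_order_mono[OF generators_close_to_jet[OF U f]]) (use m in simp)
      from vanishes_to_order_mult[OF wc this]
      show "vanishes_to_order (Suc s) (\<lambda>x. w g x * (?H g x - ?h g x))" by simp
    qed (use r in blast)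
    then obtain C where C: "\<forall>\<^sub>F x in nhds 0. \<bar>(\<Sum>g\<in>UNIV. w g x * (?H g x - ?h g x)) + peval m' r x\<bar> \<le> C * norm x ^ Suc s"
      unfolding vanishes_to_order_def by (rule exE)
    have "((\<lambda>x::real^'n. x $ i) \<longlongrightarrow> 0 $ i) (nhds 0)"
      by (intro tendsto_vec_nth filterlim_ident)
    then have "\<forall>\<^sub>F x in nhds 0. x $ i \<noteq> 0 \<longrightarrow> \<bar>C\<bar> * ?n ^ Suc s * \<bar>x $ i\<bar> ^ Suc s < \<bar>\<Sum>j\<le>s. a j * x $ i ^ j\<bar>"
      using poly_not_small[OF a, of "\<bar>C\<bar> * ?n ^ Suc s"] unfolding filterlim_iff zero_index by blast
    with C show ?thesis
    proof eventually_elim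
      case (elim x)
      show ?case
      proof (intro impI, rule ccontr)
        assume h: "\<forall>g. ?h g x = 0" and nx: "norm x \<le> ?n * \<bar>x $ i\<bar>" and xi: "x $ i \<noteq> 0"
        have "\<bar>\<Sum>j\<le>s. a j * x $ i ^ j\<bar> \<le> C * norm x ^ Suc s" using elim(1) h unfolding eq by simp
        also have "\<dots> \<le> \<bar>C\<bar> * norm x ^ Suc s" by (intro mult_right_mono) auto
        also have "\<dots> \<le> \<bar>C\<bar> * (?n * \<bar>x $ i\<bar>) ^ Suc s" using nx by (intro mult_left_mono power_mono) auto
        also have "\<dots> = \<bar>C\<bar> * ?n ^ Suc s * \<bar>x $ i\<bar> ^ Suc s" by (simp only: power_mult_distrib mult.assoc)
        finally show False using elim(2) xi by simp
      qed
    qed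
  qed
  have "\<forall>\<^sub>F x in nhds 0. \<forall>i. (\<forall>g. ?h g x = 0) \<longrightarrow> norm x \<le> ?n * \<bar>x $ i\<bar> \<longrightarrow> x $ i = 0"
    using step by (rule eventually_all_finite)
  then show ?thesis
  proof eventually_elim
    case (elim x)
    show ?case
    proof (intro impI, rule ccontr)
      assume x: "x \<noteq> 0" and h: "\<not> (\<exists>g. ?h g x \<noteq> 0)"
      \<comment> \<open>A coordinate of largest modulus meets the restriction in
        \<open>step\<close>, because the norm is at most the sum of the n moduli.\<close>
      define M where "M = Max (range (\<lambda>i. \<bar>x $ i\<bar>))"
      have "M \<in> range (\<lambda>i. \<bar>x $ i\<bar>)" unfolding M_def by (rule Max_in) auto
      then obtain i where i: "M = \<bar>x $ i\<bar>" by blast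
      have le: "\<bar>x $ j\<bar> \<le> \<bar>x $ i\<bar>" for j unfolding i[symmetric] M_def by (rule Max_ge) auto
      have "norm x \<le> (\<Sum>j\<in>UNIV. \<bar>x $ j\<bar>)" by (rule norm_le_l1_cart)
      also have "\<dots> \<le> (\<Sum>j\<in>(UNIV :: 'n set). \<bar>x $ i\<bar>)" by (intro sum_mono le)
      finally have "norm x \<le> ?n * \<bar>x $ i\<bar>" by simp
      then have "x $ i = 0" using elim h by blast
      then have "x = 0" using le by (simp add: vec_eq_iff)
      then show False using x by blast
    qed
  qed
qed

text \<open>The polynomial depends on the jet z0 that is perturbed, so a whole set P is collected,
  and the exceptional jets are its common zeros.\<close>

lemma generic_jet_polynomials:
  "\<exists>m N P. k < m \<and> even N \<and> 2 \<le> N \<and> (\<forall>p\<in>P. poly_fun (jet_indices m) p) \<and>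
    (\<forall>z0 :: 'n::finite taylor_series. \<exists>y. \<exists>p\<in>P. (\<forall>\<alpha>\<in>jet_indices k. y \<alpha> = z0 \<alpha>) \<and> p y \<noteq> 0) \<and>
    (\<forall>(f :: real^'n \<Rightarrow> real) U. open U \<longrightarrow> 0 \<in> U \<longrightarrow> smooth_on U f \<longrightarrow> (\<exists>p\<in>P. p (taylor f) \<noteq> 0) \<longrightarrow>
      (\<forall>\<^sub>F x in nhds 0. x \<noteq> 0 \<longrightarrow> (\<exists>g. gradient_generators N (\<lambda>x. f x - f 0) (\<lambda>l. partial_deriv l f) g x \<noteq> 0)))"
proof -
  define N where "N = 2 * (k + 1)"
  have N: "k + 2 \<le> N" "even N" "2 \<le> N" by (simp_all add: N_def)
  let ?D = "\<lambda>s m z. \<forall>i. \<exists>a w m' r. (\<exists>j\<le>s. a j \<noteq> 0) \<and> (\<forall>g. xpoly (w g)) \<and> (\<forall>\<gamma>\<in>indices_below (Suc s). r \<gamma> = 0) \<and>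
    (\<forall>x :: real^'n. (\<Sum>j\<le>s. a j * x $ i ^ j) = (\<Sum>g\<in>UNIV. w g x * jet_generators N m g z x) + peval m' r x)"
  from generic_jet_dependence[OF N(1), where ?'n = 'n]
  obtain s where s: "\<forall>m. N \<le> m \<longrightarrow> (\<forall>z0 :: 'n taylor_series. \<exists>y p. (\<forall>\<alpha>\<in>jet_indices k. y \<alpha> = z0 \<alpha>) \<and>
    poly_fun (jet_indices m) p \<and> p y \<noteq> 0 \<and> (\<forall>z. p z \<noteq> 0 \<longrightarrow> ?D s m z))" by (rule exE)
  \<comment> \<open>At least N, so that the perturbation is visible in jets of order m, and greater
    than s, so that the Taylor error is of order at least s + 1.\<close>
  define m where "m = N + Suc s"
  define P where "P = {p. poly_fun (jet_indices m) p \<and> (\<forall>z :: 'n taylor_series. p z \<noteq> 0 \<longrightarrow> ?D s m z)}"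
  have 1: "\<exists>y. \<exists>p\<in>P. (\<forall>\<alpha>\<in>jet_indices k. y \<alpha> = z0 \<alpha>) \<and> p y \<noteq> 0" for z0 :: "'n taylor_series"
  proof -
    have "N \<le> m" by (simp add: m_def)
    from s[rule_format, OF this, of z0]
    obtain y p where yp: "(\<forall>\<alpha>\<in>jet_indices k. y \<alpha> = z0 \<alpha>) \<and>
      poly_fun (jet_indices m) p \<and> p y \<noteq> 0 \<and> (\<forall>z. p z \<noteq> 0 \<longrightarrow> ?D s m z)" by (elim exE)
    then have "p \<in> P" unfolding P_def by (intro CollectI conjI) (elim conjE, assumption)+
    then show ?thesis using yp by (intro exI[of _ y] bexI[of _ p]) auto
  qed
  have 2: "\<forall>\<^sub>F x in nhds 0. x \<noteq> 0 \<longrightarrow> (\<exists>g. gradient_generators N (\<lambda>x. f x - f 0) (\<lambda>l. partial_deriv l f) g x \<noteq> 0)"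
    if "open U" "0 \<in> U" "smooth_on U f" and ex: "\<exists>p\<in>P. p (taylor f) \<noteq> 0" for f :: "real^'n \<Rightarrow> real" and U
  proof (rule generators_nonzero_near_zero[OF that(1-3)])
    obtain p where p: "p \<in> P" "p (taylor f) \<noteq> 0" using ex by (rule bexE)
    have "\<forall>z. p z \<noteq> 0 \<longrightarrow> ?D s m z" using p(1) unfolding P_def by (elim CollectE conjE)
    then have "p (taylor f) \<noteq> 0 \<longrightarrow> ?D s m (taylor f)" by (rule spec)
    then show "?D s m (taylor f)" using p(2) by (rule mp)
    show "s < m" by (simp add: m_def)
  qed
  have 3: "\<forall>p\<in>P. poly_fun (jet_indices m) p" unfolding P_def by (intro ballI) (elim CollectE conjE)
  have 4: "k < m" using N by (simp add: m_def)
  show ?thesis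
    by (rule exI[of _ m], rule exI[of _ N], rule exI[of _ P], intro conjI allI impI)
      (rule 4 N 3 1 2, assumption?)+
qed

section \<open>Flows of Lipschitz vector fields\<close>

definition solves_on :: "('a::real_normed_vector \<Rightarrow> 'a) \<Rightarrow> real \<Rightarrow> (real \<Rightarrow> 'a) \<Rightarrow> bool" where
  "solves_on F T u \<longleftrightarrow> (\<forall>t\<in>{0..T}. (u has_vector_derivative F (u t)) (at t within {0..T}))"

lemma solves_on_subinterval:
  assumes "solves_on F T u" "S \<le> T"
  shows "solves_on F S u"
  unfolding solves_on_def
proof
  fix t assume "t \<in> {0..S}"
  then have "(u has_vector_derivative F (u t)) (at t within {0..T})"
    using assms by (simp add: solves_on_def)
  then show "(u has_vector_derivative F (u t)) (at t within {0..S})"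
    by (rule has_vector_derivative_within_subset) (use assms in auto)
qed

lemma solves_on_reverse:
  assumes "solves_on F T u"
  shows "solves_on (\<lambda>x. - F x) T (\<lambda>t. u (T - t))"
  unfolding solves_on_def
proof
  fix t assume t: "t \<in> {0..T}"
  have 1: "((\<lambda>t. T - t) has_vector_derivative (- 1)) (at t within {0..T})"
    by (auto intro!: derivative_eq_intros)
  have "(\<lambda>t. T - t) ` {0..T} \<subseteq> {0..T}" by auto
  moreover have "(u has_vector_derivative F (u (T - t))) (at (T - t) within {0..T})"
    using assms t unfolding solves_on_def by simp
  ultimately have "(u has_vector_derivative F (u (T - t))) (at (T - t) within (\<lambda>t. T - t) ` {0..T})"
    by (rule has_vector_derivative_within_subset[rotated])
  from vector_diff_chain_within[OF 1 this]
  show "((\<lambda>t. u (T - t)) has_vector_derivative - F (u (T - t))) (at t within {0..T})"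
    by (simp add: o_def)
qed

lemma solves_on_continuous: "solves_on F T u \<Longrightarrow> continuous_on {0..T} u"
  unfolding solves_on_def continuous_on_eq_continuous_within by (auto intro: has_vector_derivative_continuous)

lemma solves_on_at:
  assumes "solves_on F T u" "0 < t" "t < T"
  shows "(u has_vector_derivative F (u t)) (at t)"
proof -
  have "(u has_vector_derivative F (u t)) (at t within {0..T})"
    using assms by (simp add: solves_on_def)
  then show ?thesis using assms(2,3) by (simp add: at_within_Icc_at)
qed

lemma DERIV_compose_solves_on:
  fixes u :: "real \<Rightarrow> 'a::real_inner"
  assumes "solves_on F T u" "t \<in> {0<..<T}" "(p has_derivative (\<lambda>v. P \<bullet> v)) (at (u t))"
  shows "((\<lambda>t. p (u t)) has_real_derivative (P \<bullet> F (u t))) (at t)"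
proof -
  have "(u has_vector_derivative F (u t)) (at t)"
    using assms(1,2) by (auto intro: solves_on_at)
  then have "(u has_derivative (\<lambda>s. s *\<^sub>R F (u t))) (at t)" by (simp add: has_vector_derivative_def)
  from has_derivative_compose[OF this assms(3)] show ?thesis
    by (simp add: has_field_derivative_def mult_commute_abs)
qed

text \<open>Gronwall's argument: the squared distance of the two solutions times exp (- 2 * L * t)
  has nonpositive derivative and starts at 0.\<close>

lemma solves_on_unique:
  fixes u v :: "real \<Rightarrow> 'a::real_inner"
  assumes F: "\<And>x y. norm (F x - F y) \<le> L * norm (x - y)"
    and u: "solves_on F T u" and v: "solves_on F T v" and "u 0 = v 0" "t \<in> {0..T}"
  shows "u t = v t"
proof (cases "t = 0")
  case False
  then have t: "0 < t" "t \<le> T" using assms(5) by auto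
  let ?w = "\<lambda>t. ((u t - v t) \<bullet> (u t - v t)) * exp (- 2 * L * t)"
  let ?w' = "\<lambda>t. (2 * ((u t - v t) \<bullet> (F (u t) - F (v t))) - 2 * L * ((u t - v t) \<bullet> (u t - v t))) * exp (- 2 * L * t)"
  have cont: "continuous_on {0..t} ?w"
    using solves_on_continuous[OF u] solves_on_continuous[OF v] t
    by (intro continuous_intros) (auto elim: continuous_on_subset)
  have D: "(?w has_derivative (\<lambda>s. ?w' s0 * s)) (at s0)" if "0 < s0" "s0 < t" for s0
  proof -
    have "(u has_derivative (\<lambda>s. s *\<^sub>R F (u s0))) (at s0)" "(v has_derivative (\<lambda>s. s *\<^sub>R F (v s0))) (at s0)"
      using solves_on_at[OF u, of s0] solves_on_at[OF v, of s0] that t by (simp_all add: has_vector_derivative_def)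
    note [derivative_intros] = this
    show ?thesis
      by (rule has_derivative_eq_rhs, (rule derivative_intros)+)
        (auto simp: fun_eq_iff algebra_simps inner_commute)
  qed
  obtain s where s: "0 < s" "s < t" "?w t - ?w 0 = ?w' s * (t - 0)"
    using mvt[OF t(1) cont D] by auto
  have "(u s - v s) \<bullet> (F (u s) - F (v s)) \<le> norm (u s - v s) * norm (F (u s) - F (v s))"
    by (rule norm_cauchy_schwarz)
  also have "\<dots> \<le> norm (u s - v s) * (L * norm (u s - v s))" by (intro mult_left_mono F) auto
  also have "\<dots> = L * ((u s - v s) \<bullet> (u s - v s))" by (simp add: power2_norm_eq_inner[symmetric] power2_eq_square)
  finally have "?w' s \<le> 0" by (intro mult_nonpos_nonneg) auto
  then have "?w t \<le> 0" using s(3) t(1) assms(4) by (simp add: mult_nonpos_nonneg)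
  then have "(u t - v t) \<bullet> (u t - v t) \<le> 0" by (simp add: mult_le_0_iff)
  then have "u t - v t = 0" by (metis inner_eq_zero_iff inner_ge_zero order_antisym)
  then show ?thesis by simp
qed (use assms(4) in simp)

text \<open>Makes the domain of integration independent of t, so that continuity of the flow in
  starting point and time together becomes continuity of an integral in a parameter.\<close>

lemma integral_rescale:
  fixes g :: "real \<Rightarrow> 'a::euclidean_space"
  assumes "continuous_on {0..t} g" "0 \<le> t"
  shows "integral {0..1} (\<lambda>s. t *\<^sub>R g (t * s)) = integral {0..t} g"
proof -
  let ?K = "\<lambda>s. integral {0..s} g"
  have "((\<lambda>s. t *\<^sub>R g (t * s)) has_integral (?K (t * 1) - ?K (t * 0))) {0..1}"
  proof (rule fundamental_theorem_of_calculus)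
    fix s :: real assume s: "s \<in> {0..1}"
    have ts: "t * s \<in> {0..t}" using s assms(2) by (auto simp: mult_left_le)
    have im: "(\<lambda>s. t * s) ` {0..1} \<subseteq> {0..t}" using assms(2) by (auto simp: mult_left_le)
    have "(?K has_vector_derivative g (t * s)) (at (t * s) within {0..t})"
      by (rule integral_has_vector_derivative[OF assms(1) ts])
    then have K: "(?K has_vector_derivative g (t * s)) (at (t * s) within (\<lambda>s. t * s) ` {0..1})"
      using im by (rule has_vector_derivative_within_subset)
    have "((\<lambda>s. t * s) has_vector_derivative t) (at s within {0..1})" by (auto intro!: derivative_eq_intros)
    from vector_diff_chain_within[OF this K]
    show "((\<lambda>s. ?K (t * s)) has_vector_derivative t *\<^sub>R g (t * s)) (at s within {0..1})" by (simp add: o_def)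
  qed simp
  from integral_unique[OF this] show ?thesis by simp
qed

text \<open>
  Picard iteration on all of \<open>[0,\<infinity>)\<close>, in the sup norm weighted by \<open>exp (- 2 * L * t)\<close>. Doing it for
  functions of the starting point and time together yields joint continuity of the flow.
\<close>

lemma ex_flow:
  fixes F :: "'a::euclidean_space \<Rightarrow> 'a"
  assumes F: "\<And>x y. norm (F x - F y) \<le> L * norm (x - y)" and M: "\<And>x. norm (F x) \<le> M" and L: "0 < L"
  obtains \<phi> where "continuous_on (UNIV \<times> {0..}) (\<lambda>(x, t). \<phi> x t)" "\<And>x. \<phi> x 0 = x" "\<And>x T. solves_on F T (\<phi> x)"
proof -
  have M0: "0 \<le> M" using M[of 0] norm_ge_zero order_trans by blast
  have contF: "continuous_on UNIV F"
  proof -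
    have "L-lipschitz_on UNIV F" using F L by (auto intro!: lipschitz_onI simp: dist_norm)
    then show ?thesis by (rule lipschitz_on_continuous_on)
  qed
  \<comment> \<open>Here v is the displacement from the starting point divided by its weight: the
    flow will be x + exp (2 * L * t) * v (x, t). The absolute value extends the problem to all real
    t, since bounded continuous functions are total.\<close>
  define G where "G v x t s = F (x + exp (2 * L * (\<bar>t\<bar> * s)) *\<^sub>R apply_bcontfun v (x, \<bar>t\<bar> * s))"
    for v :: "('a \<times> real) \<Rightarrow>\<^sub>C 'a" and x and t s :: real
  have contG: "continuous_on UNIV (\<lambda>(p, s). G v (fst p) (snd p) s)" for v
    unfolding G_def split_def
    by (intro continuous_on_compose2[OF contF] continuous_intros continuous_on_compose2[OF continuous_on_apply_bcontfun[of UNIV v]]) auto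
  define T where "T v p = exp (- 2 * L * \<bar>snd p\<bar>) *\<^sub>R integral {0..1} (\<lambda>s. \<bar>snd p\<bar> *\<^sub>R G v (fst p) (snd p) s)"
    for v and p :: "'a \<times> real"
  have contG1: "continuous_on {0..1} (\<lambda>s. \<bar>t\<bar> *\<^sub>R G v x t s)" for v x t
  proof -
    have "continuous_on {0..1} (\<lambda>s. ((x, t), s))" by (intro continuous_intros)
    from continuous_on_compose2[OF contG[of v] this] show ?thesis
      by (intro continuous_intros) simp
  qed
  have int: "(\<lambda>s. \<bar>t\<bar> *\<^sub>R G v x t s) integrable_on {0..1}" for v x t
    using contG1 by (rule integrable_continuous_real)
  have Tc: "continuous_on UNIV (T v)" for v
  proof -
    have "continuous_on (UNIV \<times> cbox 0 1) (\<lambda>(p, s). \<bar>snd p\<bar> *\<^sub>R G v (fst p) (snd p) (s::real))"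
      using continuous_on_subset[OF contG[of v], of "UNIV \<times> cbox 0 1"] unfolding split_def
      by (intro continuous_intros) auto
    from integral_continuous_on_param[OF this]
    have "continuous_on UNIV (\<lambda>p. integral {0..1} (\<lambda>s. \<bar>snd p\<bar> *\<^sub>R G v (fst p) (snd p) s))" by simp
    then show ?thesis unfolding T_def by (intro continuous_intros)
  qed
  have Tb: "norm (T v p) \<le> M / L" for v p
  proof -
    obtain x t where p: "p = (x, t)" by (cases p)
    have "norm (integral {0..1} (\<lambda>s. \<bar>t\<bar> *\<^sub>R G v x t s)) \<le> integral {0..1} (\<lambda>s::real. \<bar>t\<bar> * M)"
      by (rule integral_norm_bound_integral[OF int]) (auto simp: G_def intro: mult_left_mono M)
    also have "\<dots> = \<bar>t\<bar> * M" by simp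
    finally have "norm (T v p) \<le> exp (- 2 * L * \<bar>t\<bar>) * (\<bar>t\<bar> * M)"
      by (simp add: T_def p)
    also have "\<dots> \<le> M / L"
    proof -
      have "L * \<bar>t\<bar> \<le> exp (L * \<bar>t\<bar>)" using exp_ge_add_one_self[of "L * \<bar>t\<bar>"] by linarith
      also have "\<dots> \<le> exp (2 * L * \<bar>t\<bar>)" using L by simp
      finally have "exp (- 2 * L * \<bar>t\<bar>) * (L * \<bar>t\<bar>) \<le> exp (- 2 * L * \<bar>t\<bar>) * exp (2 * L * \<bar>t\<bar>)"
        by (rule mult_left_mono) simp
      then have "exp (- 2 * L * \<bar>t\<bar>) * (L * \<bar>t\<bar>) \<le> 1" by (simp add: exp_add[symmetric])
      then have "exp (- 2 * L * \<bar>t\<bar>) * (L * \<bar>t\<bar>) * M \<le> 1 * M" using M0 by (rule mult_right_mono)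
      then show ?thesis using L by (simp add: field_simps)
    qed
    finally show ?thesis .
  qed
  have Tin: "T v \<in> bcontfun" for v by (rule bcontfun_normI[OF Tc Tb])
  define TT where "TT v = Bcontfun (T v)" for v
  have TT: "apply_bcontfun (TT v) = T v" for v unfolding TT_def using Tin by (rule Bcontfun_inverse)
  have contr: "dist (TT v) (TT w) \<le> (1/2) * dist v w" for v w
  proof (rule dist_bound)
    fix p :: "'a \<times> real"
    obtain x t where p: "p = (x, t)" by (cases p)
    let ?d = "dist v w"
    have ptw: "norm (\<bar>t\<bar> *\<^sub>R G v x t s - \<bar>t\<bar> *\<^sub>R G w x t s) \<le> \<bar>t\<bar> * (L * (exp (2 * L * (\<bar>t\<bar> * s)) * ?d))" for s
    proof -
      let ?e = "exp (2 * L * (\<bar>t\<bar> * s))"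
      have "norm (G v x t s - G w x t s) \<le> L * norm (?e *\<^sub>R apply_bcontfun v (x, \<bar>t\<bar> * s) - ?e *\<^sub>R apply_bcontfun w (x, \<bar>t\<bar> * s))"
        unfolding G_def by (rule order_trans[OF F]) simp
      also have "\<dots> = L * (?e * dist (apply_bcontfun v (x, \<bar>t\<bar> * s)) (apply_bcontfun w (x, \<bar>t\<bar> * s)))"
        by (simp add: dist_norm flip: scaleR_diff_right)
      also have "\<dots> \<le> L * (?e * ?d)"
        using L by (intro mult_left_mono dist_bounded) auto
      finally have "\<bar>t\<bar> * norm (G v x t s - G w x t s) \<le> \<bar>t\<bar> * (L * (?e * ?d))" by (intro mult_left_mono) auto
      then show ?thesis by (simp flip: scaleR_diff_right)
    qed
    \<comment> \<open>The contraction factor 1/2 arises here: the weight grows at rate 2 * L while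
      the field contributes the constant L.\<close>
    have I: "((\<lambda>s. \<bar>t\<bar> * (L * (exp (2 * L * (\<bar>t\<bar> * s)) * ?d))) has_integral
       (exp (2 * L * (\<bar>t\<bar> * 1)) * ?d / 2 - exp (2 * L * (\<bar>t\<bar> * 0)) * ?d / 2)) {0..1}"
    proof (rule fundamental_theorem_of_calculus)
      fix s :: real
      show "((\<lambda>s. exp (2 * L * (\<bar>t\<bar> * s)) * ?d / 2) has_vector_derivative \<bar>t\<bar> * (L * (exp (2 * L * (\<bar>t\<bar> * s)) * ?d))) (at s within {0..1})"
        unfolding has_real_derivative_iff_has_vector_derivative[symmetric]
        by (auto intro!: derivative_eq_intros)
    qed simp
    have "norm (integral {0..1} (\<lambda>s. \<bar>t\<bar> *\<^sub>R G v x t s) - integral {0..1} (\<lambda>s. \<bar>t\<bar> *\<^sub>R G w x t s)) =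
       norm (integral {0..1} (\<lambda>s. \<bar>t\<bar> *\<^sub>R G v x t s - \<bar>t\<bar> *\<^sub>R G w x t s))"
      by (simp add: integral_diff[OF int int])
    also have "\<dots> \<le> integral {0..1} (\<lambda>s. \<bar>t\<bar> * (L * (exp (2 * L * (\<bar>t\<bar> * s)) * ?d)))"
      by (rule integral_norm_bound_integral) (use I ptw in \<open>auto intro: integrable_diff int\<close>)
    also have "\<dots> \<le> exp (2 * L * \<bar>t\<bar>) * ?d / 2"
      using integral_unique[OF I] by simp
    finally have "exp (- 2 * L * \<bar>t\<bar>) * norm (integral {0..1} (\<lambda>s. \<bar>t\<bar> *\<^sub>R G v x t s) - integral {0..1} (\<lambda>s. \<bar>t\<bar> *\<^sub>R G w x t s))
       \<le> exp (- 2 * L * \<bar>t\<bar>) * (exp (2 * L * \<bar>t\<bar>) * ?d / 2)"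
      by (rule mult_left_mono) simp
    also have "\<dots> = ?d / 2" by (simp add: exp_minus)
    finally show "dist (apply_bcontfun (TT v) p) (apply_bcontfun (TT w) p) \<le> (1/2) * ?d"
      unfolding TT by (simp add: T_def p dist_norm flip: scaleR_diff_right)
  qed
  obtain v where v: "TT v = v" using banach_fix_type[of "1/2" TT] contr by auto
  define \<phi> where "\<phi> x t = x + exp (2 * L * t) *\<^sub>R apply_bcontfun v (x, t)" for x t
  have eq: "\<phi> x t = x + integral {0..t} (\<lambda>s. F (\<phi> x s))" if "0 \<le> t" for x t
  proof -
    have "continuous_on {0..t} (\<lambda>s. F (\<phi> x s))"
      unfolding \<phi>_def
      by (intro continuous_on_compose2[OF contF] continuous_intros continuous_on_compose2[OF continuous_on_apply_bcontfun[of UNIV v]]) auto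
    from integral_rescale[OF this that]
    have "integral {0..t} (\<lambda>s. F (\<phi> x s)) = integral {0..1} (\<lambda>s. \<bar>t\<bar> *\<^sub>R G v x t s)"
      using that by (simp add: G_def \<phi>_def)
    also have "\<dots> = exp (2 * L * t) *\<^sub>R T v (x, t)"
      using that by (simp add: T_def exp_minus)
    also have "T v (x, t) = apply_bcontfun v (x, t)" using TT[of v] v by simp
    finally show ?thesis by (simp add: \<phi>_def)
  qed
  show ?thesis
  proof (rule that)
    show "continuous_on (UNIV \<times> {0..}) (\<lambda>(x, t). \<phi> x t)"
      unfolding \<phi>_def split_def
      by (intro continuous_intros continuous_on_compose2[OF continuous_on_apply_bcontfun[of UNIV v]]) auto
    show "\<phi> x 0 = x" for x using eq[of 0 x] by simp
    show "solves_on F S (\<phi> x)" for x S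
      unfolding solves_on_def
    proof
      fix t assume t: "t \<in> {0..S}"
      have "continuous_on {0..S} (\<lambda>s. F (\<phi> x s))"
        unfolding \<phi>_def
        by (intro continuous_on_compose2[OF contF] continuous_intros continuous_on_compose2[OF continuous_on_apply_bcontfun[of UNIV v]]) auto
      from integral_has_vector_derivative[OF this t]
      have "((\<lambda>u. x + integral {0..u} (\<lambda>s. F (\<phi> x s))) has_vector_derivative F (\<phi> x t)) (at t within {0..S})"
        by (auto intro!: derivative_eq_intros)
      then show "(\<phi> x has_vector_derivative F (\<phi> x t)) (at t within {0..S})"
        by (rule has_vector_derivative_transform[OF t, rotated]) (use eq in auto)
    qed
  qed
qed

section \<open>Cones\<close>

text \<open>The map g factors through the cone as a continuous bijection onto V. Its inverse is
  continuous because closed subsets of B \<times> [0,1] are compact and have closed images.\<close>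

lemma cone_homeomorphism:
  fixes g :: "'a::t2_space \<times> real \<Rightarrow> 'a"
  assumes B: "compact B" and g: "continuous_on (B \<times> {0..1}) g"
    and g0: "\<And>b. b \<in> B \<Longrightarrow> g (b, 0) = x0"
    and V: "V = insert x0 (g ` (B \<times> {0..1}))"
    and inj: "inj_on g (B \<times> {0<..1})" and ne: "\<And>b t. b \<in> B \<Longrightarrow> t \<in> {0<..1} \<Longrightarrow> g (b, t) \<noteq> x0"
  shows "\<exists>h. homeomorphic_map (top_of_set V) (cone_topology B) h \<and> h x0 = None"
proof -
  define k where "k p = (case p of None \<Rightarrow> x0 | Some z \<Rightarrow> g z)" for p
  have kp: "k (cone_proj z) = g z" if "z \<in> B \<times> {0..1}" for z
    using that g0 by (auto simp: k_def cone_proj_def)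
  have pts: "cone_points B = insert None (Some ` (B \<times> {0<..1}))"
    by (auto simp: cone_points_def cone_proj_def image_iff split: if_splits)
  define S where "S = B \<times> {0<..1::real}"
  have injS: "inj_on g S" using inj by (simp add: S_def)
  have neS: "g z \<noteq> x0" if "z \<in> S" for z using ne[of "fst z" "snd z"] that by (auto simp: S_def)
  have injk: "inj_on k (cone_points B)"
    unfolding pts S_def[symmetric]
  proof (rule inj_onI)
    fix p q assume "p \<in> insert None (Some ` S)" "q \<in> insert None (Some ` S)" "k p = k q"
    then show "p = q"
      by (elim insertE imageE) (auto simp: k_def dest: neS neS[THEN not_sym] inj_onD[OF injS])
  qed
  have imk: "k ` cone_points B = V"
    unfolding cone_points_def V image_insert image_image using kp by (auto simp: k_def)
  define h where "h = the_inv_into (cone_points B) k"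
  have hk: "h (k p) = p" if "p \<in> cone_points B" for p
    unfolding h_def using injk that by (rule the_inv_into_f_f)
  have kh: "k (h x) = x" "h x \<in> cone_points B" if "x \<in> V" for x
    unfolding h_def using f_the_inv_into_f[OF injk] the_inv_into_into[OF injk _ order_refl] imk that by auto
  have ck: "continuous_map (cone_topology B) (top_of_set V) k"
    unfolding continuous_map_def
  proof (intro conjI allI impI)
    show "k \<in> topspace (cone_topology B) \<rightarrow> topspace (top_of_set V)"
      using imk by (auto simp: topspace_cone_topology)
    fix W assume "openin (top_of_set V) W"
    then obtain O' where O': "open O'" "W = V \<inter> O'" by (auto simp: openin_open)
    have "{z \<in> B \<times> {0..1}. cone_proj z \<in> {p \<in> topspace (cone_topology B). k p \<in> W}} = (B \<times> {0..1}) \<inter> g -` O'"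
    proof -
      have "z \<in> {z \<in> B \<times> {0..1}. cone_proj z \<in> {p \<in> topspace (cone_topology B). k p \<in> W}} \<longleftrightarrow>
          z \<in> (B \<times> {0..1}) \<inter> g -` O'" for z
      proof (cases "z \<in> B \<times> {0..1}")
        case True
        then have "cone_proj z \<in> cone_points B" "g z \<in> V" unfolding cone_points_def V by blast+
        with True kp[OF True] O'(2) show ?thesis by (simp add: topspace_cone_topology)
      qed simp
      then show ?thesis by blast
    qed
    moreover have "openin (top_of_set (B \<times> {0..1})) ((B \<times> {0..1}) \<inter> g -` O')"
      using continuous_openin_preimage_gen[OF g O'(1)] .
    ultimately show "openin (cone_topology B) {p \<in> topspace (cone_topology B). k p \<in> W}"
      unfolding openin_cone_topology by (simp add: topspace_cone_topology)
  qed
  have ch: "continuous_map (top_of_set V) (cone_topology B) h"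
    unfolding continuous_map_def
  proof (intro conjI allI impI)
    show "h \<in> topspace (top_of_set V) \<rightarrow> topspace (cone_topology B)"
      using kh by (auto simp: topspace_cone_topology)
    fix W assume "openin (cone_topology B) W"
    then have W: "openin (top_of_set (B \<times> {0..1})) {z \<in> B \<times> {0..1}. cone_proj z \<in> W}"
      by (simp add: openin_cone_topology)
    let ?C = "{z \<in> B \<times> {0..1}. cone_proj z \<notin> W}"
    have "closedin (top_of_set (B \<times> {0..1})) (B \<times> {0..1} - {z \<in> B \<times> {0..1}. cone_proj z \<in> W})"
      using W by (intro closedin_diff) auto
    moreover have "B \<times> {0..1} - {z \<in> B \<times> {0..1}. cone_proj z \<in> W} = ?C" by blast
    ultimately have cC: "closedin (top_of_set (B \<times> {0..1})) ?C" by simp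
    have "compact (B \<times> {0..1::real})" using B by (intro compact_Times) auto
    then have "compact ?C" using cC by (rule closedin_compact)
    then have "compact (g ` ?C)"
      using g by (intro compact_continuous_image) (auto elim: continuous_on_subset)
    \<comment> \<open>The vertex is treated separately, since for empty B it is not the image of any
      point of B \<times> [0,1].\<close>
    then have cl: "closed (g ` ?C \<union> (if None \<in> W then {} else {x0}))"
      by (auto intro: compact_imp_closed closed_Un)
    have "{x \<in> V. h x \<in> W} = V - (g ` ?C \<union> (if None \<in> W then {} else {x0}))"
    proof (intro set_eqI iffI)
      fix x assume "x \<in> {x \<in> V. h x \<in> W}"
      then have x: "x \<in> V" "h x \<in> W" by auto
      have "x \<notin> g ` ?C"
      proof
        assume "x \<in> g ` ?C"
        then obtain z where z': "z \<in> B \<times> {0..1}" "cone_proj z \<notin> W" "x = g z" by blast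
        have z: "z \<in> B \<times> {0..1}" "cone_proj z \<notin> W" "x = k (cone_proj z)"
          using z' kp[OF z'(1)] by simp_all
        then have "cone_proj z \<in> cone_points B" unfolding cone_points_def by blast
        then have "h x = cone_proj z" unfolding z(3) by (rule hk)
        then show False using x z by simp
      qed
      moreover have "None \<in> W" if "x = x0"
        using x hk[of None] that by (auto simp: k_def cone_points_def)
      ultimately show "x \<in> V - (g ` ?C \<union> (if None \<in> W then {} else {x0}))" using x by auto
    next
      fix x assume x: "x \<in> V - (g ` ?C \<union> (if None \<in> W then {} else {x0}))"
      then have hx: "h x \<in> insert None (cone_proj ` (B \<times> {0..1}))"
        using kh(2)[of x] unfolding cone_points_def by simp
      have "h x \<in> W"
      proof (cases "h x = None")
        case True
        then have "x = x0" using kh(1)[of x] x by (simp add: k_def)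
        then show ?thesis using x True by (auto split: if_splits)
      next
        case False
        have "h x \<in> cone_proj ` (B \<times> {0..1})" using hx False by (simp only: insert_iff simp_thms)
        then obtain z where z: "h x = cone_proj z" "z \<in> B \<times> {0..1}" by (rule imageE)
        then have "x = g z" using kh(1)[of x] x kp[OF z(2)] by simp
        then have "cone_proj z \<in> W" using x z(2) by blast
        then show ?thesis using z(1) by simp
      qed
      then show "x \<in> {x \<in> V. h x \<in> W}" using x by auto
    qed
    also have "openin (top_of_set V) \<dots>"
      using cl by (auto simp: openin_open Diff_eq intro!: exI[of _ "- (g ` ?C \<union> (if None \<in> W then {} else {x0}))"])
    finally show "openin (top_of_set V) {x \<in> topspace (top_of_set V). h x \<in> W}" by simp
  qed
  have "homeomorphic_maps (top_of_set V) (cone_topology B) h k"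
    unfolding homeomorphic_maps_def using ck ch kh(1) hk by (auto simp: topspace_cone_topology)
  then have "homeomorphic_map (top_of_set V) (cone_topology B) h" by (rule homeomorphic_maps_imp_map)
  moreover have "h x0 = None" using hk[of None] by (auto simp: k_def cone_points_def)
  ultimately show ?thesis by blast
qed

lemma mvt_along_solution:
  fixes u :: "real \<Rightarrow> 'a::real_inner"
  assumes u: "solves_on F T u" and st: "0 \<le> s" "s < t" "t \<le> T"
    and p: "\<And>\<xi>. s \<le> \<xi> \<Longrightarrow> \<xi> \<le> t \<Longrightarrow> (p has_derivative (\<lambda>v. P (u \<xi>) \<bullet> v)) (at (u \<xi>))"
  shows "\<exists>\<xi>. s < \<xi> \<and> \<xi> < t \<and> p (u t) - p (u s) = (t - s) * (P (u \<xi>) \<bullet> F (u \<xi>))"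
proof -
  have "continuous_on {s..t} (\<lambda>r. p (u r))"
    unfolding continuous_on_eq_continuous_within
  proof
    fix r assume r: "r \<in> {s..t}"
    have "continuous_on {s..t} u"
      using solves_on_continuous[OF u] by (rule continuous_on_subset) (use st in auto)
    then have "continuous (at r within {s..t}) u" using r by (simp add: continuous_on_eq_continuous_within)
    moreover have "isCont p (u r)" using p[of r] r by (auto intro: has_derivative_continuous)
    ultimately show "continuous (at r within {s..t}) (\<lambda>r. p (u r))"
      by (rule continuous_within_compose3[rotated])
  qed
  moreover have "((\<lambda>r. p (u r)) has_derivative (\<lambda>d. (P (u r) \<bullet> F (u r)) * d)) (at r)" if "s < r" "r < t" for r
    using DERIV_compose_solves_on[OF u, of r p "P (u r)"] p[of r] that st
    by (simp add: has_field_derivative_def)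
  ultimately obtain \<xi> where "s < \<xi>" "\<xi> < t" "p (u t) - p (u s) = (P (u \<xi>) \<bullet> F (u \<xi>)) * (t - s)"
    using mvt[OF st(2), of "\<lambda>r. p (u r)" "\<lambda>r d. (P (u r) \<bullet> F (u r)) * d"] by blast
  then show ?thesis by (auto simp: mult.commute)
qed

text \<open>
  The point of the level set at height \<open>t\<close> of the cone over \<open>b\<close> is reached from \<open>b\<close> by flowing along
  \<open>- F\<close> for the time \<open>1 / t - 1\<close>.
\<close>

lemma gradient_flow_cone:
  fixes F :: "'a::euclidean_space \<Rightarrow> 'a" and f \<rho> :: "'a \<Rightarrow> real"
  assumes Lip: "\<And>x y. norm (F x - F y) \<le> L * norm (x - y)" and bd: "\<And>x. norm (F x) \<le> M" and L: "0 < L"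
    and F0: "F 0 = 0"
    and \<rho>: "\<And>x. (\<rho> has_derivative (\<lambda>v. R x \<bullet> v)) (at x)" and up: "\<And>x. 0 \<le> R x \<bullet> F x"
    and \<rho>0: "\<rho> 0 = 0" "\<And>x. x \<noteq> 0 \<Longrightarrow> 0 < \<rho> x"
    and f: "\<And>x. \<rho> x \<le> \<epsilon> \<Longrightarrow> (f has_derivative (\<lambda>v. A x \<bullet> v)) (at x)"
    and tang: "\<And>x. \<rho> x \<le> \<epsilon> \<Longrightarrow> A x \<bullet> F x = 0"
    and \<epsilon>: "0 < \<epsilon>" and V: "V = {x. \<rho> x \<le> \<epsilon> \<and> f x = f 0}" and cV: "compact V"
    and pos: "\<And>x. x \<in> V \<Longrightarrow> x \<noteq> 0 \<Longrightarrow> 0 < R x \<bullet> F x" and cont: "continuous_on V (\<lambda>x. R x \<bullet> F x)"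
  shows "\<exists>h. homeomorphic_map (top_of_set V) (cone_topology {x \<in> V. \<rho> x = \<epsilon>}) h \<and> h 0 = None"
proof -
  have Lip': "norm (- F x - - F y) \<le> L * norm (x - y)" for x y
    using Lip[of x y] norm_minus_commute[of "F x" "F y"] by simp
  obtain \<phi> where \<phi>c: "continuous_on (UNIV \<times> {0..}) (\<lambda>(x, t). \<phi> x t)" and \<phi>0: "\<And>x. \<phi> x 0 = x"
    and \<phi>: "\<And>x T. solves_on (\<lambda>x. - F x) T (\<phi> x)"
    using ex_flow[of "\<lambda>x. - F x" L M] Lip' bd L by auto
  obtain \<psi> where "continuous_on (UNIV \<times> {0..}) (\<lambda>(x, t). \<psi> x t)" and \<psi>0: "\<And>x. \<psi> x 0 = x"
    and \<psi>: "\<And>x T. solves_on F T (\<psi> x)"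
    by (rule ex_flow[OF Lip bd L]) (rule that)
  have cont\<rho>: "continuous_on S \<rho>" for S
    using \<rho> by (auto intro!: continuous_at_imp_continuous_on has_derivative_continuous)
  have \<rho>nn: "0 \<le> \<rho> x" for x using \<rho>0(1) \<rho>0(2)[of x] by (cases "x = 0") (auto simp: less_imp_le)
  have V0: "0 \<in> V" using \<epsilon> by (simp add: V \<rho>0)
  have \<rho>mono: "\<rho> (u s) \<le> \<rho> (u t)" if "solves_on F T u" "0 \<le> s" "s \<le> t" "t \<le> T" for u s t T
  proof (cases "s = t")
    case False
    then have "s < t" using that by simp
    from mvt_along_solution[OF that(1,2) this that(4), of \<rho> R] \<rho>
    obtain \<xi> where "\<rho> (u t) - \<rho> (u s) = (t - s) * (R (u \<xi>) \<bullet> F (u \<xi>))" by blast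
    moreover have "0 \<le> (t - s) * (R (u \<xi>) \<bullet> F (u \<xi>))" using \<open>s < t\<close> up by simp
    ultimately show ?thesis by simp
  qed simp
  have \<rho>anti: "\<rho> (\<phi> x t) \<le> \<rho> (\<phi> x s)" if "0 \<le> s" "s \<le> t" for x s t
  proof (cases "s = t")
    case False
    then have "s < t" using that by simp
    from mvt_along_solution[OF \<phi> that(1) this order_refl, of \<rho> R] \<rho>
    obtain \<xi> where "\<rho> (\<phi> x t) - \<rho> (\<phi> x s) = (t - s) * (R (\<phi> x \<xi>) \<bullet> (- F (\<phi> x \<xi>)))" by blast
    moreover have "0 \<le> (t - s) * (R (\<phi> x \<xi>) \<bullet> F (\<phi> x \<xi>))" using \<open>s < t\<close> up by simp
    ultimately show ?thesis by simp
  qed simp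
  have fconst: "f (u t) = f (u 0)" if "solves_on G t u" "0 \<le> t" "\<And>s. 0 \<le> s \<Longrightarrow> s \<le> t \<Longrightarrow> \<rho> (u s) \<le> \<epsilon>"
    "\<And>x. \<rho> x \<le> \<epsilon> \<Longrightarrow> A x \<bullet> G x = 0" for u t G
  proof (cases "t = 0")
    case False
    then have "0 < t" using that by simp
    from mvt_along_solution[OF that(1) order_refl this order_refl, of f A] f that(3)
    obtain \<xi> where \<xi>: "0 < \<xi>" "\<xi> < t" "f (u t) - f (u 0) = (t - 0) * (A (u \<xi>) \<bullet> G (u \<xi>))" by blast
    then show ?thesis using that(3)[of \<xi>] that(4)[of "u \<xi>"] by simp
  qed simp
  have \<phi>V: "\<phi> x t \<in> V" if x: "x \<in> V" and t: "0 \<le> t" for x t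
  proof -
    have le: "\<rho> (\<phi> x s) \<le> \<epsilon>" if "0 \<le> s" for s
      using \<rho>anti[of 0 s x] that x by (simp add: V \<phi>0)
    have "f (\<phi> x t) = f (\<phi> x 0)"
      by (rule fconst[OF \<phi> t]) (use le tang in auto)
    then show ?thesis using le[OF t] x by (simp add: V \<phi>0)
  qed
  have \<psi>V: "\<psi> x t \<in> V" if x: "x \<in> V" and t: "0 \<le> t" "\<rho> (\<psi> x t) \<le> \<epsilon>" for x t
  proof -
    have "f (\<psi> x t) = f (\<psi> x 0)"
      by (rule fconst[OF \<psi> t(1)]) (use \<rho>mono[OF \<psi>, of _ t t x] t tang in \<open>auto intro: order_trans\<close>)
    then show ?thesis using t x by (simp add: V \<psi>0)
  qed
  have rev: "u (T - t) = v t" if "solves_on (\<lambda>x. - F x) T u" "solves_on F T v" "u T = v 0" "t \<in> {0..T}" for u v t T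
  proof -
    have "solves_on F T (\<lambda>t. u (T - t))" using solves_on_reverse[OF that(1)] by simp
    from solves_on_unique[OF Lip this that(2) _ that(4)] show ?thesis using that(3) by simp
  qed
  have zero: "solves_on F T (\<lambda>_. 0)" for T unfolding solves_on_def using F0 by simp
  \<comment> \<open>The origin is stationary, so by uniqueness of the reversed flow no other point
    reaches it in finite time.\<close>
  have \<phi>ne: "\<phi> x t \<noteq> 0" if x: "x \<noteq> 0" and t: "0 \<le> t" for x t
  proof
    assume "\<phi> x t = 0"
    from rev[OF \<phi> zero this, of t] t have "\<phi> x 0 = 0" by simp
    then show False using x \<phi>0 by simp
  qed
  have strict: "\<rho> (\<phi> x t) < \<rho> x" if x: "x \<in> V" "x \<noteq> 0" and t: "0 < t" for x t
  proof -
    from mvt_along_solution[OF \<phi> order_refl t order_refl, of \<rho> R] \<rho>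
    obtain \<xi> where \<xi>: "0 < \<xi>" "\<xi> < t" "\<rho> (\<phi> x t) - \<rho> (\<phi> x 0) = (t - 0) * (R (\<phi> x \<xi>) \<bullet> (- F (\<phi> x \<xi>)))" by blast
    have "0 < R (\<phi> x \<xi>) \<bullet> F (\<phi> x \<xi>)" using \<phi>V[OF x(1)] \<phi>ne[OF x(2)] \<xi>(1) by (intro pos) auto
    then have "0 < t * (R (\<phi> x \<xi>) \<bullet> F (\<phi> x \<xi>))" using t by simp
    then show ?thesis using \<xi>(3) by (simp add: \<phi>0)
  qed
  \<comment> \<open>Compactness makes the rate of change of \<rho> along the flow uniformly positive
    away from the vertex, which bounds the times in \<open>decay\<close> and
    \<open>reach\<close>.\<close>
  have low: "\<exists>m>0. \<forall>x\<in>V. \<eta> \<le> \<rho> x \<longrightarrow> m \<le> R x \<bullet> F x" if \<eta>: "0 < \<eta>" for \<eta>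
  proof (cases "{x \<in> V. \<eta> \<le> \<rho> x} = {}")
    case True
    then show ?thesis by (intro exI[of _ 1]) auto
  next
    case False
    have "closed {x. \<eta> \<le> \<rho> x}" using cont\<rho>[of UNIV] by (intro closed_Collect_le) auto
    then have "compact (V \<inter> {x. \<eta> \<le> \<rho> x})" using cV by (rule compact_Int_closed[rotated])
    then have K: "compact {x \<in> V. \<eta> \<le> \<rho> x}" by (simp add: Collect_conj_eq)
    have "continuous_on {x \<in> V. \<eta> \<le> \<rho> x} (\<lambda>x. R x \<bullet> F x)" using cont by (rule continuous_on_subset) auto
    from continuous_attains_inf[OF K False this] obtain x where x: "x \<in> V" "\<eta> \<le> \<rho> x"
      "\<And>y. y \<in> V \<Longrightarrow> \<eta> \<le> \<rho> y \<Longrightarrow> R x \<bullet> F x \<le> R y \<bullet> F y" by blast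
    have "x \<noteq> 0" using x(2) \<eta> \<rho>0(1) by auto
    then show ?thesis using pos[OF x(1)] x(3) by (intro exI[of _ "R x \<bullet> F x"]) auto
  qed
  \<comment> \<open>As long as \<rho> is at least \<eta> it falls at rate at least m from a value of
    at most \<epsilon>, so the time \<epsilon> / m is enough for all b at once. This uniformity
    gives continuity of g at the vertex.\<close>
  have decay: "\<exists>T\<ge>0. \<forall>b\<in>V. \<forall>t>T. \<rho> (\<phi> b t) < \<eta>" if \<eta>: "0 < \<eta>" for \<eta>
  proof -
    obtain m where m: "0 < m" "\<And>x. x \<in> V \<Longrightarrow> \<eta> \<le> \<rho> x \<Longrightarrow> m \<le> R x \<bullet> F x" using low[OF \<eta>] by blast
    have "\<rho> (\<phi> b t) < \<eta>" if b: "b \<in> V" and t: "\<epsilon> / m < t" for b t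
    proof (rule ccontr)
      assume n: "\<not> \<rho> (\<phi> b t) < \<eta>"
      have t0: "0 < t" using t m(1) \<epsilon> by (meson divide_pos_pos less_trans)
      from mvt_along_solution[OF \<phi> order_refl t0 order_refl, of \<rho> R] \<rho>
      obtain \<xi> where \<xi>: "0 < \<xi>" "\<xi> < t" "\<rho> (\<phi> b t) - \<rho> (\<phi> b 0) = (t - 0) * (R (\<phi> b \<xi>) \<bullet> (- F (\<phi> b \<xi>)))" by blast
      have "\<rho> (\<phi> b t) \<le> \<rho> (\<phi> b \<xi>)" using \<xi> by (intro \<rho>anti) auto
      then have "m \<le> R (\<phi> b \<xi>) \<bullet> F (\<phi> b \<xi>)" using n \<xi>(1) by (intro m(2) \<phi>V b) auto
      then have "t * m \<le> t * (R (\<phi> b \<xi>) \<bullet> F (\<phi> b \<xi>))" using t0 by simp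
      moreover have "\<epsilon> < t * m" using t m(1) by (simp add: field_simps)
      moreover have "\<rho> b \<le> \<epsilon>" using b by (simp add: V)
      ultimately have "\<rho> (\<phi> b t) < 0" using \<xi>(3) by (simp add: \<phi>0)
      then show False using \<rho>nn[of "\<phi> b t"] by simp
    qed
    moreover have "0 \<le> \<epsilon> / m" using m(1) \<epsilon> by simp
    ultimately show ?thesis by blast
  qed
  have small: "\<exists>\<eta>>0. \<forall>x\<in>V. \<rho> x < \<eta> \<longrightarrow> norm x < e" if e: "0 < e" for e
  proof (cases "V - ball 0 e = {}")
    case True
    then show ?thesis by (intro exI[of _ 1]) (auto simp: dist_norm)
  next
    case False
    have K: "compact (V - ball 0 e)" using cV by (intro compact_diff) auto
    from continuous_attains_inf[OF K False cont\<rho>] obtain x where x: "x \<in> V - ball 0 e"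
      "\<And>y. y \<in> V - ball 0 e \<Longrightarrow> \<rho> x \<le> \<rho> y" by blast
    have "0 < \<rho> x" using x(1) e by (intro \<rho>0) auto
    moreover have "norm y < e" if "y \<in> V" "\<rho> y < \<rho> x" for y
      using x(2)[of y] that by (auto simp: dist_norm not_le)
    ultimately show ?thesis by blast
  qed
  \<comment> \<open>Flowing outwards, \<rho> stays above its initial value and so rises at rate at
    least m, until it attains \<epsilon> no later than at time \<epsilon> / m.\<close>
  have reach: "\<exists>T\<ge>0. \<rho> (\<psi> x T) = \<epsilon>" if x: "x \<in> V" "x \<noteq> 0" for x
  proof (rule ccontr)
    assume n: "\<not> (\<exists>T\<ge>0. \<rho> (\<psi> x T) = \<epsilon>)"
    have lt: "\<rho> (\<psi> x T) < \<epsilon>" if T: "0 \<le> T" for T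
    proof (rule ccontr)
      assume "\<not> \<rho> (\<psi> x T) < \<epsilon>"
      then have "\<epsilon> \<le> \<rho> (\<psi> x T)" by simp
      moreover have "\<rho> (\<psi> x 0) \<le> \<epsilon>" using x by (simp add: \<psi>0 V)
      moreover have "continuous_on {0..T} (\<lambda>t. \<rho> (\<psi> x t))"
        by (rule continuous_on_compose2[OF cont\<rho>[of UNIV] solves_on_continuous[OF \<psi>]]) auto
      ultimately obtain t where "0 \<le> t" "\<rho> (\<psi> x t) = \<epsilon>" using IVT'[of "\<lambda>t. \<rho> (\<psi> x t)" 0 \<epsilon> T] T by auto
      then show False using n by blast
    qed
    obtain m where m: "0 < m" "\<And>y. y \<in> V \<Longrightarrow> \<rho> x \<le> \<rho> y \<Longrightarrow> m \<le> R y \<bullet> F y"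
      using low[OF \<rho>0(2)[OF x(2)]] by blast
    define T where "T = \<epsilon> / m"
    have T: "0 < T" using m(1) \<epsilon> by (simp add: T_def)
    from mvt_along_solution[OF \<psi> order_refl T order_refl, of \<rho> R] \<rho>
    obtain \<xi> where \<xi>: "0 < \<xi>" "\<xi> < T" "\<rho> (\<psi> x T) - \<rho> (\<psi> x 0) = (T - 0) * (R (\<psi> x \<xi>) \<bullet> F (\<psi> x \<xi>))" by blast
    have "\<rho> (\<psi> x 0) \<le> \<rho> (\<psi> x \<xi>)" using \<xi> by (intro \<rho>mono[OF \<psi>]) auto
    then have "m \<le> R (\<psi> x \<xi>) \<bullet> F (\<psi> x \<xi>)"
      using \<xi>(1) lt[of \<xi>] by (intro m(2) \<psi>V x) (auto simp: \<psi>0)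
    then have "T * m \<le> T * (R (\<psi> x \<xi>) \<bullet> F (\<psi> x \<xi>))" using T by simp
    moreover have "T * m = \<epsilon>" using m(1) by (simp add: T_def)
    ultimately have "\<epsilon> \<le> \<rho> (\<psi> x T)" using \<xi>(3) \<rho>nn[of x] by (simp add: \<psi>0)
    then show False using lt[of T] T by simp
  qed
  let ?B = "{x \<in> V. \<rho> x = \<epsilon>}"
  define g where "g z = (if snd z = 0 then 0 else \<phi> (fst z) (1 / snd z - 1))" for z :: "'a \<times> real"
  have Bne: "b \<noteq> 0" if "b \<in> ?B" for b using that \<rho>0(1) \<epsilon> by auto
  have tau: "0 \<le> 1 / t - 1" if "t \<in> {0<..1}" for t :: real using that by (simp add: field_simps)
  have cB: "compact ?B"
  proof -
    have "closed {x. \<rho> x = \<epsilon>}" using cont\<rho>[of UNIV] by (intro closed_Collect_eq) auto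
    then have "compact (V \<inter> {x. \<rho> x = \<epsilon>})" using cV by (rule compact_Int_closed[rotated])
    then show ?thesis by (simp add: Collect_conj_eq)
  qed
  show ?thesis
  proof (rule cone_homeomorphism[OF cB, of g])
    show "g (b, 0) = 0" for b by (simp add: g_def)
    show "g (b, t) \<noteq> 0" if "b \<in> ?B" "t \<in> {0<..1}" for b t
      using \<phi>ne[OF Bne[OF that(1)] tau[OF that(2)]] that(2) by (simp add: g_def)
    show "inj_on g (?B \<times> {0<..1})"
    proof -
      \<comment> \<open>If two flow lines from ?B meet, running back for the shorter time puts b on
        the line of b'; as \<rho> = \<epsilon> at both and \<rho> decreases strictly, no time can
        remain.\<close>
      have main: "T = T' \<and> b = b'" if b: "b \<in> ?B" "b' \<in> ?B" and T: "0 \<le> T" "T \<le> T'" and eq: "\<phi> b T = \<phi> b' T'" for b b' T T'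
      proof -
        have "solves_on (\<lambda>x. - F x) T (\<phi> b)" by (rule \<phi>)
        moreover have "solves_on F T (\<lambda>t. \<phi> b' (T' - t))"
          using solves_on_subinterval[OF solves_on_reverse[OF \<phi>] T(2), of b'] by simp
        ultimately have "\<phi> b (T - T) = \<phi> b' (T' - T)"
          by (rule rev) (use eq T in auto)
        then have e: "b = \<phi> b' (T' - T)" by (simp add: \<phi>0)
        have "T' = T"
        proof (rule ccontr)
          assume "T' \<noteq> T"
          then have "\<rho> (\<phi> b' (T' - T)) < \<rho> b'" using b T Bne by (intro strict) auto
          then show False using b e by auto
        qed
        then show ?thesis using e by (simp add: \<phi>0)
      qed
      show ?thesis
      proof (rule inj_onI)
        fix z w assume z: "z \<in> ?B \<times> {0<..1}" and w: "w \<in> ?B \<times> {0<..1}" and eq: "g z = g w"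
        have z': "fst z \<in> ?B" "snd z \<in> {0<..1}" and w': "fst w \<in> ?B" "snd w \<in> {0<..1}"
          using z w by (auto simp: mem_Times_iff)
        have e: "\<phi> (fst z) (1 / snd z - 1) = \<phi> (fst w) (1 / snd w - 1)"
          using eq z' w' by (simp add: g_def)
        have "1 / snd z - 1 = 1 / snd w - 1 \<and> fst z = fst w"
        proof (cases "1 / snd z - 1 \<le> 1 / snd w - 1")
          case True
          then show ?thesis using main[OF z'(1) w'(1) tau[OF z'(2)] True e] by simp
        next
          case False
          then have "1 / snd w - 1 \<le> 1 / snd z - 1" by simp
          from main[OF w'(1) z'(1) tau[OF w'(2)] this e[symmetric]] show ?thesis by simp
        qed
        then show "z = w" using z'(2) w'(2) by (simp add: prod_eq_iff)
      qed
    qed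
    show "V = insert 0 (g ` (?B \<times> {0..1}))"
    proof (intro subset_antisym subsetI)
      fix x assume x: "x \<in> V"
      show "x \<in> insert 0 (g ` (?B \<times> {0..1}))"
      proof (cases "x = 0")
        case False
        obtain T where T: "0 \<le> T" "\<rho> (\<psi> x T) = \<epsilon>" using reach[OF x False] by blast
        have b: "\<psi> x T \<in> ?B" using \<psi>V[OF x T(1)] T(2) by simp
        have "solves_on (\<lambda>y. - F y) T (\<phi> (\<psi> x T))" by (rule \<phi>)
        moreover have "solves_on (\<lambda>y. - F y) T (\<lambda>t. \<psi> x (T - t))" by (rule solves_on_reverse[OF \<psi>])
        ultimately have "\<phi> (\<psi> x T) T = \<psi> x (T - T)"
          by (rule solves_on_unique[OF Lip']) (use T \<phi>0 in auto)
        then have e: "\<phi> (\<psi> x T) T = x" by (simp add: \<psi>0)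
        have gx: "x = g (\<psi> x T, 1 / (1 + T))" using T(1) e by (simp add: g_def)
        have "(\<psi> x T, 1 / (1 + T)) \<in> ?B \<times> {0..1}" using b T(1) by simp
        then have "g (\<psi> x T, 1 / (1 + T)) \<in> g ` (?B \<times> {0..1})" by (rule imageI)
        then show ?thesis unfolding gx[symmetric] by (rule insertI2)
      qed simp
    next
      fix x assume "x \<in> insert 0 (g ` (?B \<times> {0..1}))"
      then show "x \<in> V"
      proof (elim insertE imageE)
        fix z assume x: "x = g z" and "z \<in> ?B \<times> {0..1}"
        then have z: "fst z \<in> V" "snd z \<in> {0..1}" by (auto simp: mem_Times_iff)
        show "x \<in> V"
        proof (cases "snd z = 0")
          case False
          then have "0 \<le> 1 / snd z - 1" using z(2) by (intro tau) auto
          from \<phi>V[OF z(1) this] show ?thesis using False by (simp add: x g_def)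
        qed (simp add: x g_def V0)
      qed (simp add: V0)
    qed
    show "continuous_on (?B \<times> {0..1}) g"
      unfolding continuous_on_def
    proof
      fix p assume p: "p \<in> ?B \<times> {0..1::real}"
      show "(g \<longlongrightarrow> g p) (at p within ?B \<times> {0..1})"
      proof (cases "snd p = 0")
        case False
        then have p1: "p \<in> ?B \<times> {0<..1}" using p by (auto simp: mem_Times_iff)
        have "continuous_on (?B \<times> {0<..1}) (\<lambda>z. (\<lambda>(x, t). \<phi> x t) (fst z, 1 / snd z - 1))"
          by (rule continuous_on_compose2[OF \<phi>c]) (use tau in \<open>auto intro!: continuous_intros\<close>)
        then have "continuous_on (?B \<times> {0<..1}) g"
          by (rule continuous_on_eq) (auto simp: g_def)
        then have "(g \<longlongrightarrow> g p) (at p within ?B \<times> {0<..1})" using p1 unfolding continuous_on_def by blast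
        moreover have "at p within ?B \<times> {0..1} = at p within ?B \<times> {0<..1}"
          by (rule at_within_nhd[of p "UNIV \<times> {0<..}"]) (use p1 in \<open>auto intro: open_Times\<close>)
        ultimately show ?thesis by simp
      next
        case True
        then have gp: "g p = 0" by (simp add: g_def)
        show ?thesis unfolding gp tendsto_iff
        proof (intro allI impI)
          fix e :: real assume "0 < e"
          then obtain \<eta> where \<eta>: "0 < \<eta>" "\<And>x. x \<in> V \<Longrightarrow> \<rho> x < \<eta> \<Longrightarrow> norm x < e" using small by blast
          obtain T where T: "0 \<le> T" "\<And>b t. b \<in> V \<Longrightarrow> T < t \<Longrightarrow> \<rho> (\<phi> b t) < \<eta>" using decay[OF \<eta>(1)] by blast
          \<comment> \<open>Heights below d correspond to flow times above T + 1.\<close>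
          define d where "d = 1 / (T + 2)"
          have d: "0 < d" using T(1) by (simp add: d_def)
          have "dist (g z) 0 < e" if z: "z \<in> ?B \<times> {0..1}" and near: "dist z p < d" for z
          proof (cases "snd z = 0")
            case False
            have z': "fst z \<in> V" "snd z \<in> {0<..1}" using z False by (auto simp: mem_Times_iff)
            have "dist (snd z) (snd p) < d" using dist_snd_le[of z p] near by simp
            then have "snd z < d" using True z' by (simp add: dist_real_def)
            then have "T + 2 < 1 / snd z" using z' T(1) d by (simp add: d_def field_simps)
            then have "\<rho> (\<phi> (fst z) (1 / snd z - 1)) < \<eta>" using z' by (intro T(2)) auto
            then have "norm (\<phi> (fst z) (1 / snd z - 1)) < e" using \<phi>V[OF z'(1) tau[OF z'(2)]] by (intro \<eta>(2))
            then show ?thesis using False by (simp add: g_def)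
          qed (simp add: g_def \<open>0 < e\<close>)
          then show "\<forall>\<^sub>F z in at p within ?B \<times> {0..1}. dist (g z) 0 < e"
            unfolding eventually_at using d by blast
        qed
      qed
    qed
  qed
qed

section \<open>Charts of a level set with boundary\<close>

text \<open>The derivative at q vanishes along all axes except i, so G changes sign in direction i.
  By continuity the sign change persists on a parallel segment shifted to negative y j, where the
  intermediate value theorem produces a zero outside the half-hyperplane.\<close>

lemma no_half_hyperplane_zero_set:
  fixes G :: "real^'n \<Rightarrow> real"
  assumes ij: "i \<noteq> j" and S: "open S" "q \<in> S" and G: "continuous_on S G"
    and D: "(G has_derivative D) (at q)" "D w \<noteq> 0" and q: "q $ i = 0" "q $ j = 0"
    and zero: "\<And>y. y \<in> S \<Longrightarrow> G y = 0 \<longleftrightarrow> y $ i = 0 \<and> 0 \<le> y $ j"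
  shows False
proof -
  obtain r where r: "0 < r" "ball q r \<subseteq> S" using S open_contains_ball by blast
  have inS: "q + s *\<^sub>R axis l 1 \<in> S" if "\<bar>s\<bar> < r" for s l
    using r(2) that by (auto simp: subset_iff dist_norm)
  have DERIV: "((\<lambda>s. c * G (q + s *\<^sub>R axis l 1)) has_real_derivative c * D (axis l 1)) (at 0)" for c l
  proof -
    have "((\<lambda>s. q + s *\<^sub>R axis l (1::real)) has_derivative (\<lambda>s. s *\<^sub>R axis l 1)) (at 0)"
      by (auto intro!: derivative_eq_intros)
    from has_derivative_compose[OF this, of G D] D(1)
    have "((\<lambda>s. G (q + s *\<^sub>R axis l 1)) has_derivative (\<lambda>s. D (s *\<^sub>R axis l 1))) (at 0)" by simp
    then have "((\<lambda>s. G (q + s *\<^sub>R axis l 1)) has_real_derivative D (axis l 1)) (at 0)"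
      unfolding has_field_derivative_def
      by (rule has_derivative_eq_rhs) (simp add: fun_eq_iff linear_cmul[OF has_derivative_linear[OF D(1)]])
    then show ?thesis by (rule DERIV_cmult)
  qed
  have Gq: "G q = 0" using zero[OF S(2)] q by simp
  \<comment> \<open>For small positive h the point q + h * axis l 1 lies in the half-hyperplane,
    also for l = j, so G vanishes along a ray from q.\<close>
  have flat: "D (axis l 1) = 0" if "l \<noteq> i" for l
  proof (rule ccontr)
    assume ne: "D (axis l 1) \<noteq> 0"
    then have "0 < D (axis l 1) * D (axis l 1)" using not_real_square_gt_zero by blast
    from DERIV_pos_inc_right[OF DERIV this] obtain d where d: "0 < d"
      "\<And>h. 0 < h \<Longrightarrow> h < d \<Longrightarrow> D (axis l 1) * G (q + 0 *\<^sub>R axis l 1) < D (axis l 1) * G (q + (0 + h) *\<^sub>R axis l 1)" by blast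
    define h where "h = min d r / 2"
    have h: "0 < h" "h < d" "h < r" using d(1) r(1) by (auto simp: h_def)
    have "G (q + h *\<^sub>R axis l 1) = 0"
      using zero[OF inS[of h l]] h that q by (auto simp: axis_def)
    then show False using d(2)[OF h(1,2)] Gq by simp
  qed
  define c where "c = D (axis i 1)"
  have "D w = (\<Sum>l\<in>UNIV. w $ l *\<^sub>R D (axis l 1))" by (rule linear_sum_axis[OF has_derivative_linear[OF D(1)]])
  also have "\<dots> = (\<Sum>l\<in>UNIV. if l = i then w $ i * c else 0)" by (rule sum.cong) (auto simp: flat c_def)
  finally have "c \<noteq> 0" using D(2) by auto
  \<comment> \<open>Multiplying G by c fixes the direction of the sign change, so that the two signs
    of c need no separate treatment.\<close>
  then have cc: "0 < c * D (axis i 1)" unfolding c_def[symmetric] using not_real_square_gt_zero by blast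
  from DERIV_pos_inc_right[OF DERIV cc] obtain d1 where d1: "0 < d1"
    "\<And>h. 0 < h \<Longrightarrow> h < d1 \<Longrightarrow> c * G (q + 0 *\<^sub>R axis i 1) < c * G (q + (0 + h) *\<^sub>R axis i 1)" by blast
  from DERIV_pos_inc_left[OF DERIV cc] obtain d2 where d2: "0 < d2"
    "\<And>h. 0 < h \<Longrightarrow> h < d2 \<Longrightarrow> c * G (q + (0 - h) *\<^sub>R axis i 1) < c * G (q + 0 *\<^sub>R axis i 1)" by blast
  define s where "s = min d1 (min d2 r) / 2"
  have s: "0 < s" "s < d1" "s < d2" "s < r" "s \<le> r / 2" using d1(1) d2(1) r(1) by (auto simp: s_def)
  have right: "0 < c * G (q + s *\<^sub>R axis i 1)" using d1(2)[OF s(1,2)] Gq by simp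
  have left: "c * G (q + (- s) *\<^sub>R axis i 1) < 0" using d2(2)[OF s(1,3)] Gq by simp
  have contG: "((\<lambda>t. c * G (q + a *\<^sub>R axis i 1 - t *\<^sub>R axis j 1)) \<longlongrightarrow> c * G (q + a *\<^sub>R axis i 1)) (nhds 0)"
    if "\<bar>a\<bar> < r" for a
  proof -
    have "isCont G (q + a *\<^sub>R axis i 1 - 0 *\<^sub>R axis j 1)"
      using G S(1) inS[OF that, of i] by (simp add: continuous_on_eq_continuous_at)
    then have "isCont (\<lambda>t. G (q + a *\<^sub>R axis i 1 - t *\<^sub>R axis j 1)) 0"
      by (intro isCont_o2[of 0 "\<lambda>t. q + a *\<^sub>R axis i 1 - t *\<^sub>R axis j 1" G]) (auto intro!: continuous_intros)
    then have "isCont (\<lambda>t. c * G (q + a *\<^sub>R axis i 1 - t *\<^sub>R axis j 1)) 0" by (intro continuous_intros)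
    from this[unfolded isCont_def, THEN tendsto_at_iff_tendsto_nhds[THEN iffD1]] show ?thesis by simp
  qed
  have "\<forall>\<^sub>F t in nhds 0. 0 < c * G (q + s *\<^sub>R axis i 1 - t *\<^sub>R axis j 1)"
    by (rule order_tendstoD(1)[OF contG right]) (use s in simp)
  moreover have "\<forall>\<^sub>F t in nhds 0. c * G (q + (- s) *\<^sub>R axis i 1 - t *\<^sub>R axis j 1) < 0"
    by (rule order_tendstoD(2)[OF contG left]) (use s in simp)
  ultimately have "\<forall>\<^sub>F t in nhds 0. 0 < c * G (q + s *\<^sub>R axis i 1 - t *\<^sub>R axis j 1) \<and>
      c * G (q + (- s) *\<^sub>R axis i 1 - t *\<^sub>R axis j 1) < 0" by (rule eventually_conj)
  then obtain e where e: "0 < e" "\<And>t. dist t 0 < e \<Longrightarrow> 0 < c * G (q + s *\<^sub>R axis i 1 - t *\<^sub>R axis j 1) \<and>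
      c * G (q + (- s) *\<^sub>R axis i 1 - t *\<^sub>R axis j 1) < 0" unfolding eventually_nhds_metric by blast
  define t where "t = min e r / 4"
  have t: "0 < t" "t < e" "t < r / 2" using e(1) r(1) by (auto simp: t_def)
  let ?y = "\<lambda>a. q + a *\<^sub>R axis i 1 - t *\<^sub>R axis j 1"
  have yS: "?y a \<in> S" if "a \<in> {-s..s}" for a
  proof -
    have "norm (a *\<^sub>R axis i 1 - t *\<^sub>R axis j (1::real)) \<le> \<bar>a\<bar> + \<bar>t\<bar>"
      using norm_triangle_ineq4[of "a *\<^sub>R axis i (1::real)" "t *\<^sub>R axis j 1"] by simp
    also have "\<dots> < r" using that s(5) t by auto
    finally have "dist q (?y a) < r" by (simp add: dist_norm norm_minus_commute)
    then show ?thesis using r(2) by auto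
  qed
  have "continuous_on {-s..s} (\<lambda>a. c * G (?y a))"
    by (intro continuous_on_mult_left continuous_on_compose2[OF G] continuous_intros image_subsetI yS)
  moreover have "c * G (?y (- s)) \<le> 0" "0 \<le> c * G (?y s)" using e(2)[of t] t by auto
  ultimately have "\<exists>a. - s \<le> a \<and> a \<le> s \<and> c * G (?y a) = 0"
    using IVT'[of "\<lambda>a. c * G (?y a)" "- s" 0 s] s(1) by simp
  then obtain a where a: "a \<in> {-s..s}" "c * G (?y a) = 0" by auto
  then have "G (?y a) = 0" using \<open>c \<noteq> 0\<close> by simp
  then have "0 \<le> ?y a $ j" using zero[OF yS[OF a(1)]] by simp
  then show False using ij q t(1) by (simp add: axis_def)
qed

section \<open>Charts with prescribed coordinate functions\<close>

lemma smooth_on_vec_lambda: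
  fixes f :: "'n::finite \<Rightarrow> 'a::real_normed_vector \<Rightarrow> real"
  shows "open U \<Longrightarrow> (\<And>i. smooth_on U (f i)) \<Longrightarrow> smooth_on U (\<lambda>x. \<chi> i. f i x)"
  unfolding smooth_on_def by (intro allI Ck_on_vec_lambda) auto

lemma smooth_on_coord: "open U \<Longrightarrow> smooth_on U (\<lambda>x. x $ i)"
  unfolding smooth_on_def by (intro allI Ck_on_linear bounded_linear_vec_nth)

lemma smooth_on_const: "open U \<Longrightarrow> smooth_on U (\<lambda>x. c)"
  unfolding smooth_on_def by (intro allI Ck_on_const) auto

lemma smooth_on_diff: "open U \<Longrightarrow> smooth_on U f \<Longrightarrow> smooth_on U g \<Longrightarrow> smooth_on U (\<lambda>x. f x - g x)"
  unfolding smooth_on_def by (intro allI Ck_on_diff) auto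

lemma smooth_on_mult:
  fixes f g :: "'a::real_normed_vector \<Rightarrow> real"
  shows "open U \<Longrightarrow> smooth_on U f \<Longrightarrow> smooth_on U g \<Longrightarrow> smooth_on U (\<lambda>x. f x * g x)"
  unfolding smooth_on_def by (intro allI Ck_on_mult) auto

lemma smooth_on_sum:
  "open U \<Longrightarrow> (\<And>a. a \<in> A \<Longrightarrow> smooth_on U (f a)) \<Longrightarrow> smooth_on U (\<lambda>x. \<Sum>a\<in>A. f a x)"
  unfolding smooth_on_def by (intro allI Ck_on_sum) auto

lemma smooth_on_power:
  fixes f :: "'a::real_normed_vector \<Rightarrow> real"
  shows "open U \<Longrightarrow> smooth_on U f \<Longrightarrow> smooth_on U (\<lambda>x. f x ^ n)"
  unfolding smooth_on_def by (intro allI Ck_on_power) auto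

lemma smooth_chart:
  fixes u :: "'n::finite \<Rightarrow> real^'n \<Rightarrow> real"
  assumes U: "open U" "p \<in> U" and u: "\<And>k. smooth_on U (u k)"
    and D: "\<And>k. (u k has_derivative D k) (at p)" and inj: "\<And>v. (\<And>k. D k v = 0) \<Longrightarrow> v = 0"
  obtains N N' \<psi> where "p \<in> N" "N \<subseteq> U" "diffeomorphism N N' (\<lambda>x. \<chi> k. u k x) \<psi>" "(\<lambda>x. \<chi> k. u k x) ` N = N'"
proof -
  let ?\<phi> = "\<lambda>x. \<chi> k. u k x"
  have s: "smooth_on U ?\<phi>" by (rule smooth_on_vec_lambda[OF U(1) u])
  have "v = 0" if v: "frechet_derivative ?\<phi> (at p) v = 0" for v
  proof (rule inj)
    fix k
    have "((\<lambda>x. ?\<phi> x $ k) has_derivative (\<lambda>v. frechet_derivative ?\<phi> (at p) v $ k)) (at p)"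
      by (rule bounded_linear.has_derivative[OF bounded_linear_vec_nth smooth_on_has_derivative[OF s U(2)]])
    then have "(u k has_derivative (\<lambda>v. frechet_derivative ?\<phi> (at p) v $ k)) (at p)" by simp
    then have "(\<lambda>v. frechet_derivative ?\<phi> (at p) v $ k) = D k" using D has_derivative_unique by blast
    then show "D k v = 0" using v by (metis zero_index)
  qed
  from smooth_inverse_function[OF U(1) s U(2) this] show ?thesis using that by blast
qed

lemma has_derivative_coord: "((\<lambda>x. x $ k) has_derivative (\<lambda>v. v $ k)) (at p)"
  by (rule bounded_linear_imp_has_derivative[OF bounded_linear_vec_nth])

lemma interior_point_level_set:
  fixes f :: "real^'n \<Rightarrow> real"
  assumes U: "open U" "p \<in> U" and f: "smooth_on U f" and ne: "partial_deriv i f p \<noteq> 0"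
    and M: "M \<inter> U = {x \<in> U. f x = c}"
  shows "hypersurface_interior_point M p"
proof -
  let ?u = "\<lambda>k x. if k = i then f x - c else x $ k"
  have Df: "(f has_derivative (\<lambda>v. \<Sum>l\<in>UNIV. v $ l * partial_deriv l f p)) (at p)"
    using smooth_on_has_derivative[OF f U(2)] has_derivative_partial_deriv[OF smooth_on_has_derivative[OF f U(2)]]
    by (rule has_derivative_eq_rhs[OF _ ext])
  obtain N N' \<psi> where N: "p \<in> N" "N \<subseteq> U" "diffeomorphism N N' (\<lambda>x. \<chi> k. ?u k x) \<psi>" "(\<lambda>x. \<chi> k. ?u k x) ` N = N'"
  proof (rule smooth_chart[OF U, of ?u])
    show "smooth_on U (?u k)" for k
      by (cases "k = i") (simp_all add: smooth_on_diff smooth_on_const smooth_on_coord U f)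
    show "(?u k has_derivative (\<lambda>v. if k = i then \<Sum>l\<in>UNIV. v $ l * partial_deriv l f p else v $ k)) (at p)" for k
      by (cases "k = i") (auto intro!: derivative_eq_intros Df has_derivative_coord)
    fix v :: "real^'n"
    assume v: "\<And>k. (if k = i then \<Sum>l\<in>UNIV. v $ l * partial_deriv l f p else v $ k) = 0"
    have vk: "v $ k = 0" if "k \<noteq> i" for k using v[of k] that by simp
    have "(\<Sum>l\<in>UNIV. v $ l * partial_deriv l f p) = (\<Sum>l\<in>UNIV. if l = i then v $ i * partial_deriv i f p else 0)"
      by (rule sum.cong) (auto simp: vk)
    then have "v $ i * partial_deriv i f p = 0" using v[of i] by simp
    then show "v = 0" using vk ne by (metis mult_eq_0_iff vec_eq_iff zero_index)
  qed (rule that)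
  have "(\<lambda>x. \<chi> k. ?u k x) ` (N \<inter> M) = {y \<in> N'. y $ i = 0}"
  proof -
    have "N \<inter> M = {x \<in> N. f x = c}" using M N(2) by blast
    then show ?thesis unfolding N(4)[symmetric] by auto
  qed
  then show ?thesis unfolding hypersurface_interior_point_def using N(1,3) by blast
qed

text \<open>The coordinates i and j are exchanged for f - c and e - r; the nonzero minor makes the
  differentials independent. The sign of e - r turns r \<le> e into the half-space required of a
  boundary chart.\<close>

lemma boundary_point_level_set:
  fixes f r :: "real^'n \<Rightarrow> real"
  assumes U: "open U" "p \<in> U" and f: "smooth_on U f" and r: "smooth_on U r"
    and ne: "partial_deriv i f p * partial_deriv j r p \<noteq> partial_deriv j f p * partial_deriv i r p"
    and M: "M \<inter> U = {x \<in> U. f x = c \<and> r x \<le> e}" and p: "r p = e"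
  shows "hypersurface_boundary_point M p"
proof -
  have ij: "i \<noteq> j" using ne by auto
  let ?u = "\<lambda>k x. if k = i then f x - c else if k = j then e - r x else x $ k"
  have D: "(g has_derivative (\<lambda>v. \<Sum>l\<in>UNIV. v $ l * partial_deriv l g p)) (at p)" if "smooth_on U g" for g :: "real^'n \<Rightarrow> real"
    using smooth_on_has_derivative[OF that U(2)] has_derivative_partial_deriv[OF smooth_on_has_derivative[OF that U(2)]]
    by (rule has_derivative_eq_rhs[OF _ ext])
  obtain N N' \<psi> where N: "p \<in> N" "N \<subseteq> U" "diffeomorphism N N' (\<lambda>x. \<chi> k. ?u k x) \<psi>" "(\<lambda>x. \<chi> k. ?u k x) ` N = N'"
  proof (rule smooth_chart[OF U, of ?u])
    show "smooth_on U (?u k)" for k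
      by (cases "k = i"; cases "k = j") (simp_all add: smooth_on_diff smooth_on_const smooth_on_coord U f r)
    show "(?u k has_derivative (\<lambda>v. if k = i then \<Sum>l\<in>UNIV. v $ l * partial_deriv l f p
        else if k = j then - (\<Sum>l\<in>UNIV. v $ l * partial_deriv l r p) else v $ k)) (at p)" for k
      by (cases "k = i"; cases "k = j") (auto intro!: derivative_eq_intros D f r has_derivative_coord)
    fix v :: "real^'n"
    assume v: "\<And>k. (if k = i then \<Sum>l\<in>UNIV. v $ l * partial_deriv l f p
        else if k = j then - (\<Sum>l\<in>UNIV. v $ l * partial_deriv l r p) else v $ k) = 0"
    have vk: "v $ k = 0" if "k \<noteq> i" "k \<noteq> j" for k using v[of k] that by simp
    have two: "(\<Sum>l\<in>UNIV. v $ l * w l) = v $ i * w i + v $ j * w j" for w :: "'n \<Rightarrow> real"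
    proof -
      have "(\<Sum>l\<in>UNIV. v $ l * w l) = (\<Sum>l\<in>UNIV. (if l = i then v $ i * w i else 0) + (if l = j then v $ j * w j else 0))"
        by (rule sum.cong) (use ij in \<open>auto simp: vk\<close>)
      then show ?thesis by (simp add: sum.distrib)
    qed
    have 1: "v $ i * partial_deriv i f p + v $ j * partial_deriv j f p = 0" using v[of i] by (simp add: two)
    have 2: "v $ i * partial_deriv i r p + v $ j * partial_deriv j r p = 0" using v[of j] ij by (simp add: two)
    let ?d = "partial_deriv i f p * partial_deriv j r p - partial_deriv j f p * partial_deriv i r p"
    have "v $ i * ?d = (v $ i * partial_deriv i f p + v $ j * partial_deriv j f p) * partial_deriv j r p
       - (v $ i * partial_deriv i r p + v $ j * partial_deriv j r p) * partial_deriv j f p" by (simp add: algebra_simps)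
    then have "v $ i * ?d = 0" using 1 2 by simp
    moreover have "v $ j * ?d = (v $ i * partial_deriv i r p + v $ j * partial_deriv j r p) * partial_deriv i f p
       - (v $ i * partial_deriv i f p + v $ j * partial_deriv j f p) * partial_deriv i r p" by (simp add: algebra_simps)
    then have "v $ j * ?d = 0" using 1 2 by simp
    ultimately have "v $ i = 0" "v $ j = 0" using ne by simp_all
    then have "v $ k = 0" for k using vk[of k] by (cases "k = i"; cases "k = j") auto
    then show "v = 0" by (simp add: vec_eq_iff)
  qed (rule that)
  have "(\<lambda>x. \<chi> k. ?u k x) ` (N \<inter> M) = {y \<in> N'. y $ i = 0 \<and> 0 \<le> y $ j}"
  proof -
    have "N \<inter> M = {x \<in> N. f x = c \<and> r x \<le> e}" using M N(2) by blast
    then show ?thesis unfolding N(4)[symmetric] using ij by auto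
  qed
  moreover have "(\<lambda>x. \<chi> k. ?u k x) p $ j = 0" using ij p by simp
  ultimately have "i \<noteq> j \<and> p \<in> N \<and> diffeomorphism N N' (\<lambda>x. \<chi> k. ?u k x) \<psi> \<and>
    (\<lambda>x. \<chi> k. ?u k x) ` (N \<inter> M) = {y \<in> N'. y $ i = 0 \<and> 0 \<le> y $ j} \<and> (\<lambda>x. \<chi> k. ?u k x) p $ j = 0"
    using N(1,3) ij by blast
  then show ?thesis unfolding hypersurface_boundary_point_def
    by - (rule exI[of _ N], rule exI[of _ N'], rule exI[of _ "\<lambda>x. \<chi> k. ?u k x"], rule exI[of _ \<psi>],
        rule exI[of _ i], rule exI[of _ j])
qed

text \<open>The two kinds of points are defined by existence of charts and are not exclusive by
  definition, while the base of the cone is the set of all boundary points. A boundary chart would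
  carry f - c to a function with nonzero derivative whose zero set is a half-hyperplane.\<close>

lemma interior_point_not_boundary_point:
  fixes f :: "real^'n \<Rightarrow> real"
  assumes U: "open U" "p \<in> U" and f: "smooth_on U f" and ne: "partial_deriv l f p \<noteq> 0"
    and M: "M \<inter> U = {x \<in> U. f x = c}" and p: "p \<in> M"
  shows "\<not> hypersurface_boundary_point M p"
proof
  assume "hypersurface_boundary_point M p"
  then obtain N and N' :: "(real^'n) set" and \<phi> \<psi> i j where ij: "i \<noteq> j" and pN: "p \<in> N"
    and d: "diffeomorphism N N' \<phi> \<psi>" and im: "\<phi> ` (N \<inter> M) = {y \<in> N'. y $ i = 0 \<and> 0 \<le> y $ j}" and pj: "\<phi> p $ j = 0"
    unfolding hypersurface_boundary_point_def by (elim exE conjE) (rule that)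
  have N: "open N" "open N'" "smooth_on N \<phi>" "smooth_on N' \<psi>" "\<phi> ` N \<subseteq> N'" "\<psi> ` N' \<subseteq> N"
    "\<And>x. x \<in> N \<Longrightarrow> \<psi> (\<phi> x) = x" "\<And>y. y \<in> N' \<Longrightarrow> \<phi> (\<psi> y) = y"
    using d unfolding diffeomorphism_def by auto
  let ?q = "\<phi> p"
  have q: "?q \<in> N'" "?q $ i = 0" using im pN p by auto
  have \<psi>q: "\<psi> ?q = p" using N(7)[OF pN] .
  define S where "S = N' \<inter> \<psi> -` U"
  have cont: "continuous_on N' \<psi>" using N(4) by (rule smooth_on_continuous_on)
  have S: "open S" unfolding S_def using cont N(2) U(1) by (rule continuous_open_preimage)
  have qS: "?q \<in> S" using q \<psi>q U(2) by (simp add: S_def)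
  let ?G = "\<lambda>y. f (\<psi> y) - c"
  have D\<psi>: "(\<psi> has_derivative frechet_derivative \<psi> (at ?q)) (at ?q)" by (rule smooth_on_has_derivative[OF N(4) q(1)])
  have D\<phi>: "(\<phi> has_derivative frechet_derivative \<phi> (at p)) (at p)" by (rule smooth_on_has_derivative[OF N(3) pN])
  have Df: "(f has_derivative frechet_derivative f (at p)) (at p)" by (rule smooth_on_has_derivative[OF f U(2)])
  let ?D = "\<lambda>v. frechet_derivative f (at p) (frechet_derivative \<psi> (at ?q) v)"
  have D: "(?G has_derivative ?D) (at ?q)"
    using has_derivative_compose[OF D\<psi>, of f] Df \<psi>q by (auto intro!: derivative_eq_intros)
  have "frechet_derivative \<psi> (at ?q) (frechet_derivative \<phi> (at p) v) = v" for v
  proof -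
    have "((\<lambda>x. \<psi> (\<phi> x)) has_derivative (\<lambda>v. frechet_derivative \<psi> (at ?q) (frechet_derivative \<phi> (at p) v))) (at p)"
      by (rule has_derivative_compose[OF D\<phi> D\<psi>])
    then have "((\<lambda>x. x) has_derivative (\<lambda>v. frechet_derivative \<psi> (at ?q) (frechet_derivative \<phi> (at p) v))) (at p)"
      by (rule has_derivative_transform_within_open[OF _ N(1) pN]) (use N(7) in auto)
    then have "(\<lambda>v. frechet_derivative \<psi> (at ?q) (frechet_derivative \<phi> (at p) v)) = (\<lambda>v. v)"
      using has_derivative_ident has_derivative_unique by blast
    then show ?thesis by (rule fun_cong)
  qed
  then have Dne: "?D (frechet_derivative \<phi> (at p) (axis l 1)) \<noteq> 0" using ne by (simp add: partial_deriv_def)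
  show False
  proof (rule no_half_hyperplane_zero_set[OF ij S qS _ D Dne q(2) pj])
    show "continuous_on S ?G"
      by (intro continuous_intros continuous_on_compose2[OF smooth_on_continuous_on[OF f]] continuous_on_subset[OF cont])
        (auto simp: S_def)
    fix y assume y: "y \<in> S"
    then have y': "y \<in> N'" "\<psi> y \<in> N" "\<psi> y \<in> U" using N(6) by (auto simp: S_def)
    have "?G y = 0 \<longleftrightarrow> \<psi> y \<in> M" using M y'(3) by auto
    also have "\<dots> \<longleftrightarrow> y \<in> \<phi> ` (N \<inter> M)"
    proof
      assume "\<psi> y \<in> M"
      then show "y \<in> \<phi> ` (N \<inter> M)" using y' N(8)[OF y'(1)] by (intro image_eqI[of _ _ "\<psi> y"]) auto
    next
      assume "y \<in> \<phi> ` (N \<inter> M)"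
      then show "\<psi> y \<in> M" using N(7) by auto
    qed
    also have "\<dots> \<longleftrightarrow> y $ i = 0 \<and> 0 \<le> y $ j" using im y'(1) by auto
    finally show "?G y = 0 \<longleftrightarrow> y $ i = 0 \<and> 0 \<le> y $ j" .
  qed
qed

section \<open>Cone-likeness of nondegenerate critical points\<close>

lemma smooth_on_imp_lipschitz:
  fixes Y :: "real^'n \<Rightarrow> 'b::real_normed_vector"
  assumes "smooth_on U Y" "compact K" "convex K" "K \<subseteq> U"
  shows "\<exists>L>0. \<forall>x\<in>K. \<forall>y\<in>K. norm (Y x - Y y) \<le> L * norm (x - y)"
proof -
  let ?D = "\<lambda>x. frechet_derivative Y (at x)"
  have "\<exists>B. \<forall>x\<in>K. norm (?D x (axis i 1)) \<le> B" for i
  proof -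
    have "continuous_on K (\<lambda>x. ?D x (axis i 1))"
      using smooth_on_continuous_on[OF smooth_on_frechet_derivative[OF assms(1)]] assms(4) by (rule continuous_on_subset)
    then have "bounded ((\<lambda>x. ?D x (axis i 1)) ` K)"
      using assms(2) by (intro compact_imp_bounded compact_continuous_image)
    then show ?thesis by (auto simp: bounded_iff)
  qed
  then obtain B where B: "\<And>i x. x \<in> K \<Longrightarrow> norm (?D x (axis i 1)) \<le> B i" by metis
  define L where "L = (\<Sum>i\<in>UNIV. \<bar>B i\<bar>) + 1"
  have L: "0 < L" unfolding L_def by (intro add_nonneg_pos sum_nonneg) auto
  have D: "(Y has_derivative ?D x) (at x)" if "x \<in> K" for x
    using smooth_on_has_derivative[OF assms(1)] assms(4) that by blast
  have "onorm (?D x) \<le> L" if x: "x \<in> K" for x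
  proof (rule onorm_le)
    fix v
    have "norm (?D x v) = norm (\<Sum>i\<in>UNIV. v $ i *\<^sub>R ?D x (axis i 1))"
      using linear_sum_axis[OF has_derivative_linear[OF D[OF x]], of v] by simp
    also have "\<dots> \<le> (\<Sum>i\<in>UNIV. norm v * \<bar>B i\<bar>)"
    proof (rule sum_norm_le)
      fix i
      have "norm (?D x (axis i 1)) \<le> \<bar>B i\<bar>" using B[OF x, of i] by linarith
      then show "norm (v $ i *\<^sub>R ?D x (axis i 1)) \<le> norm v * \<bar>B i\<bar>"
        by (simp add: mult_mono component_le_norm_cart)
    qed
    also have "\<dots> \<le> L * norm v" unfolding L_def sum_distrib_left[symmetric] distrib_right by (simp add: mult.commute)
    finally show "norm (?D x v) \<le> L * norm v" .
  qed
  then have "norm (Y x - Y y) \<le> L * norm (x - y)" if "x \<in> K" "y \<in> K" for x y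
    using that D by (intro differentiable_bound[OF assms(3)]) (auto intro: has_derivative_at_withinI)
  then show ?thesis using L by blast
qed

text \<open>Outside the ball the nearest-point projection is radial; the extended vector field below
  is thereby evaluated at a positive multiple of x.\<close>

lemma closest_point_cball:
  fixes x :: "'a::euclidean_space"
  assumes "0 < d" "d < norm x"
  shows "closest_point (cball 0 d) x = (d / norm x) *\<^sub>R x"
proof (rule closest_point_unique[symmetric])
  show "(d / norm x) *\<^sub>R x \<in> cball 0 d" using assms by simp
  show "\<forall>z\<in>cball 0 d. dist x ((d / norm x) *\<^sub>R x) \<le> dist x z"
  proof
    fix z :: 'a assume "z \<in> cball 0 d"
    then have z: "norm z \<le> d" by simp
    have "x - (d / norm x) *\<^sub>R x = (1 - d / norm x) *\<^sub>R x" by (simp add: algebra_simps)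
    then have "dist x ((d / norm x) *\<^sub>R x) = \<bar>1 - d / norm x\<bar> * norm x" by (simp add: dist_norm)
    also have "\<bar>1 - d / norm x\<bar> = 1 - d / norm x"
    proof -
      have "0 < norm x" using assms by linarith
      then have "d / norm x \<le> 1" using assms(2) by (simp add: divide_le_eq)
      then show ?thesis by simp
    qed
    also have "(1 - d / norm x) * norm x = norm x - d" using assms by (auto simp: left_diff_distrib)
    also have "\<dots> \<le> norm (x - z)" using z norm_triangle_ineq2[of x z] by simp
    finally show "dist x ((d / norm x) *\<^sub>R x) \<le> dist x z" by (simp add: dist_norm)
  qed
qed auto

text \<open>
  The projection \<open>Y = |a|\<^sup>2 r - \<langle>a, r\<rangle> a\<close>, with \<open>a = \<nabla>f\<close> and \<open>r = \<nabla>\<rho>\<close> for \<open>\<rho> = \<Sum>x i ^ N / N\<close>, is tangent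
  to the level sets of \<open>f\<close> and satisfies \<open>\<langle>r, Y\<rangle> = |a|\<^sup>2 |r|\<^sup>2 - \<langle>a, r\<rangle>\<^sup>2 \<ge> 0\<close>. Since it has no
  denominators it vanishes smoothly at the origin, and \<open>- Y\<close> retracts the level set to it.
\<close>

lemma nondegenerate_imp_cone_like:
  fixes f :: "real^'n \<Rightarrow> real"
  assumes U: "open U" "0 \<in> U" and f: "smooth_on U f" and crit: "critical_point f 0"
    and N: "even N" "2 \<le> N"
    and nd: "\<forall>\<^sub>F x in nhds 0. x \<noteq> 0 \<longrightarrow> (\<exists>g. gradient_generators N (\<lambda>x. f x - f 0) (\<lambda>l. partial_deriv l f) g x \<noteq> 0)"
  shows "cone_like U f 0"
proof -
  define \<rho> where "\<rho> x = (\<Sum>i\<in>UNIV. x $ i ^ N / N)" for x :: "real^'n"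
  define R where "R x = (\<chi> i. x $ i ^ (N - 1))" for x :: "real^'n"
  define A where "A x = (\<chi> i. partial_deriv i f x)" for x
  define Y where "Y x = (A x \<bullet> A x) *\<^sub>R R x - (A x \<bullet> R x) *\<^sub>R A x" for x
  obtain d0 where d0: "0 < d0" "\<And>x. dist x 0 < d0 \<Longrightarrow> x \<noteq> 0 \<Longrightarrow>
      (\<exists>g. gradient_generators N (\<lambda>x. f x - f 0) (\<lambda>l. partial_deriv l f) g x \<noteq> 0)"
    using nd unfolding eventually_nhds_metric by blast
  obtain d1 where d1: "0 < d1" "ball 0 d1 \<subseteq> U" using U open_contains_ball by blast
  define \<delta> where "\<delta> = min d0 d1 / 2"
  have \<delta>: "0 < \<delta>" "\<delta> < d0" "\<delta> < d1" using d0(1) d1(1) by (auto simp: \<delta>_def)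
  have ballU: "x \<in> U" if "norm x \<le> \<delta>" for x using that \<delta> d1(2) by (auto simp: subset_iff)
  have gen: "\<exists>g. gradient_generators N (\<lambda>x. f x - f 0) (\<lambda>l. partial_deriv l f) g x \<noteq> 0"
    if "norm x \<le> \<delta>" "x \<noteq> 0" for x using d0(2)[of x] that \<delta>(2) by simp
  have A0: "\<exists>l. partial_deriv l f x \<noteq> 0" if x: "norm x \<le> \<delta>" "x \<noteq> 0" for x
  proof (rule ccontr)
    assume "\<not> (\<exists>l. partial_deriv l f x \<noteq> 0)"
    then have "gradient_generators N (\<lambda>x. f x - f 0) (\<lambda>l. partial_deriv l f) g x = 0" for g
      by (cases g) (auto simp: gradient_generators_def)
    then show False using gen[OF x] by simp
  qed
  \<comment> \<open>On the level set of f the generators \<open>Inl l\<close> vanish, so the nonzero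
    one must be a minor.\<close>
  have T: "\<exists>i j. x $ i ^ (N - 1) * partial_deriv j f x \<noteq> x $ j ^ (N - 1) * partial_deriv i f x"
    if x: "norm x \<le> \<delta>" "x \<noteq> 0" "f x = f 0" for x
  proof (rule ccontr)
    assume "\<not> (\<exists>i j. x $ i ^ (N - 1) * partial_deriv j f x \<noteq> x $ j ^ (N - 1) * partial_deriv i f x)"
    then have "gradient_generators N (\<lambda>x. f x - f 0) (\<lambda>l. partial_deriv l f) g x = 0" for g
      using x(3) by (cases g) (auto simp: gradient_generators_def)
    then show False using gen[OF x(1,2)] by simp
  qed
  have RY: "R x \<bullet> Y x = (A x \<bullet> A x) * (R x \<bullet> R x) - (A x \<bullet> R x) * (A x \<bullet> R x)" for x
    by (simp add: Y_def inner_diff_right inner_commute)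
  have AY: "A x \<bullet> Y x = 0" for x by (simp add: Y_def inner_diff_right)
  \<comment> \<open>Because of this identity, R x \<bullet> Y x = 0 forces Y x = 0: it is the
    equality case of Cauchy-Schwarz, in which R x is a multiple of A x if A x \<noteq> 0.\<close>
  have YY: "Y x \<bullet> Y x = (A x \<bullet> A x) * (R x \<bullet> Y x)" for x
    using AY[of x] by (simp add: Y_def inner_diff_left inner_diff_right algebra_simps inner_commute)
  have RYnn: "0 \<le> R x \<bullet> Y x" for x
    using Cauchy_Schwarz_ineq[of "A x" "R x"] unfolding RY by (simp add: power2_eq_square)
  have RYpos: "0 < R x \<bullet> Y x" if x: "norm x \<le> \<delta>" "x \<noteq> 0" "f x = f 0" for x
  proof (rule ccontr)
    assume "\<not> 0 < R x \<bullet> Y x"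
    then have "R x \<bullet> Y x = 0" using RYnn[of x] by simp
    then have "Y x \<bullet> Y x = 0" using YY[of x] by simp
    then have "(A x \<bullet> A x) *\<^sub>R R x = (A x \<bullet> R x) *\<^sub>R A x" by (simp add: Y_def)
    then have "((A x \<bullet> A x) *\<^sub>R R x) $ i = ((A x \<bullet> R x) *\<^sub>R A x) $ i" for i by (simp only:)
    then have e: "(A x \<bullet> A x) * R x $ i = (A x \<bullet> R x) * A x $ i" for i
      unfolding vector_scaleR_component real_scaleR_def .
    have "A x \<noteq> 0" using A0[OF x(1,2)] by (auto simp: A_def vec_eq_iff)
    then have AA: "A x \<bullet> A x \<noteq> 0" by simp
    obtain i j where ij: "x $ i ^ (N - 1) * partial_deriv j f x \<noteq> x $ j ^ (N - 1) * partial_deriv i f x" using T[OF x] by blast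
    have "(A x \<bullet> A x) * (R x $ i * A x $ j) = ((A x \<bullet> R x) * A x $ i) * A x $ j" by (simp only: e[symmetric] mult.assoc)
    also have "\<dots> = ((A x \<bullet> R x) * A x $ j) * A x $ i" by (simp only: mult_ac)
    also have "\<dots> = (A x \<bullet> A x) * (R x $ j * A x $ i)" by (simp only: e[symmetric] mult.assoc)
    finally have "(A x \<bullet> A x) * (R x $ i * A x $ j) = (A x \<bullet> A x) * (R x $ j * A x $ i)" .
    then have "R x $ i * A x $ j = R x $ j * A x $ i" using AA by simp
    then show False using ij by (simp add: R_def A_def)
  qed
  have sf: "smooth_on U (partial_deriv l f)" for l by (rule smooth_on_partial_deriv[OF f])
  have sR: "smooth_on U (\<lambda>x. x $ i ^ (N - 1))" for i by (intro smooth_on_power smooth_on_coord U)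
  have sY: "smooth_on U Y"
  proof -
    have "smooth_on U (\<lambda>x. \<chi> i. (\<Sum>l\<in>UNIV. partial_deriv l f x * partial_deriv l f x) * x $ i ^ (N - 1)
        - (\<Sum>l\<in>UNIV. partial_deriv l f x * x $ l ^ (N - 1)) * partial_deriv i f x)"
      by (intro smooth_on_vec_lambda smooth_on_diff smooth_on_mult smooth_on_sum sf sR U)
    moreover have "Y = (\<lambda>x. \<chi> i. (\<Sum>l\<in>UNIV. partial_deriv l f x * partial_deriv l f x) * x $ i ^ (N - 1)
        - (\<Sum>l\<in>UNIV. partial_deriv l f x * x $ l ^ (N - 1)) * partial_deriv i f x)"
      by (simp add: fun_eq_iff Y_def A_def R_def inner_vec_def vec_eq_iff)
    ultimately show ?thesis by simp
  qed
  have KU: "cball 0 \<delta> \<subseteq> U" using ballU by auto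
  let ?P = "closest_point (cball (0 :: real^'n) \<delta>)"
  have P: "?P x \<in> cball 0 \<delta>" for x using \<delta>(1) by (intro closest_point_in_set) auto
  have Pid: "?P x = x" if "norm x \<le> \<delta>" for x using that by (intro closest_point_self) simp
  have Plip: "norm (?P x - ?P y) \<le> norm (x - y)" for x y
    using closest_point_lipschitz[of "cball 0 \<delta>" x y] \<delta>(1) by (simp add: dist_norm)
  \<comment> \<open>The flow needs a globally bounded Lipschitz field; composing with the projection
    achieves this without changing Y in the ball.\<close>
  define F where "F x = Y (?P x)" for x
  have FY: "F x = Y x" if "norm x \<le> \<delta>" for x using Pid[OF that] by (simp add: F_def)
  obtain L where L: "0 < L" "\<And>x y. x \<in> cball 0 \<delta> \<Longrightarrow> y \<in> cball 0 \<delta> \<Longrightarrow> norm (Y x - Y y) \<le> L * norm (x - y)"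
    using smooth_on_imp_lipschitz[OF sY compact_cball convex_cball KU] by blast
  have Lip: "norm (F x - F y) \<le> L * norm (x - y)" for x y
  proof -
    have "norm (F x - F y) \<le> L * norm (?P x - ?P y)" unfolding F_def by (intro L(2) P)
    also have "\<dots> \<le> L * norm (x - y)" using Plip L(1) by (intro mult_left_mono) auto
    finally show ?thesis .
  qed
  have "bounded (Y ` cball 0 \<delta>)"
    using smooth_on_continuous_on[OF sY] KU
    by (intro compact_imp_bounded compact_continuous_image) (auto elim: continuous_on_subset)
  then obtain M where M: "\<forall>y\<in>Y ` cball 0 \<delta>. norm y \<le> M" unfolding bounded_iff by (rule exE)
  have FM: "norm (F x) \<le> M" for x unfolding F_def by (intro M[rule_format] imageI P)
  have R0: "R 0 = 0" using N by (simp add: R_def vec_eq_iff)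
  have F0: "F 0 = 0" using FY[of 0] \<delta>(1) by (simp add: Y_def R0)
  have D\<rho>: "(\<rho> has_derivative (\<lambda>v. R x \<bullet> v)) (at x)" for x
  proof -
    have "(\<rho> has_derivative (\<lambda>v. \<Sum>i\<in>UNIV. (real N * v $ i * x $ i ^ (N - 1)) / real N)) (at x)"
      unfolding \<rho>_def[abs_def]
      by (intro has_derivative_sum bounded_linear.has_derivative[OF bounded_linear_divide]
          has_derivative_power has_derivative_coord)
    then show ?thesis
      by (rule has_derivative_eq_rhs) (use N in \<open>auto simp: fun_eq_iff R_def inner_vec_def mult.commute\<close>)
  qed
  have RF: "0 \<le> R x \<bullet> F x" for x
  proof (cases "norm x \<le> \<delta>")
    case True
    then show ?thesis using RYnn FY by simp
  next
    case False
    \<comment> \<open>R is homogeneous of degree N - 1, so the sign of R \<bullet> F at x agrees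
      with that of R \<bullet> Y at the projected point.\<close>
    let ?s = "\<delta> / norm x"
    have "0 < norm x" using False \<delta>(1) by linarith
    then have s: "0 < ?s" using \<delta>(1) by simp
    have Px: "?P x = ?s *\<^sub>R x" by (rule closest_point_cball) (use False \<delta>(1) in auto)
    have "R (?P x) = (?s ^ (N - 1)) *\<^sub>R R x"
      unfolding Px R_def vec_eq_iff by (simp add: power_mult_distrib power_divide)
    then have "0 \<le> ?s ^ (N - 1) * (R x \<bullet> F x)" using RYnn[of "?P x"] by (simp add: F_def)
    moreover have "0 < ?s ^ (N - 1)" using s by (rule zero_less_power)
    ultimately show ?thesis by (simp only: zero_le_mult_iff) auto
  qed
  have \<rho>nn: "0 \<le> x $ i ^ N / N" for x :: "real^'n" and i using N(1) by (simp add: zero_le_even_power)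
  have \<rho>0: "\<rho> 0 = 0" using N by (simp add: \<rho>_def)
  have \<rho>pos: "0 < \<rho> x" if x: "x \<noteq> 0" for x
  proof -
    obtain i where i: "x $ i \<noteq> 0" using x by (auto simp: vec_eq_iff)
    have "0 < x $ i ^ N / N" using i N by (simp add: zero_less_power_eq)
    also have "\<dots> \<le> \<rho> x" unfolding \<rho>_def using \<rho>nn by (intro member_le_sum) auto
    finally show ?thesis .
  qed
  let ?n = "real CARD('n)"
  \<comment> \<open>If \<rho> x \<le> \<epsilon>, each coordinate has modulus at most b, so norm x
    is at most n * b = \<delta> / 2.\<close>
  define b where "b = \<delta> / (2 * ?n)"
  have b: "0 < b" using \<delta>(1) by (simp add: b_def)
  define \<epsilon> where "\<epsilon> = b ^ N / N"
  have \<epsilon>: "0 < \<epsilon>" using b N by (simp add: \<epsilon>_def)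
  have small: "norm x < \<delta>" if "\<rho> x \<le> \<epsilon>" for x
  proof -
    have "\<bar>x $ i\<bar> \<le> b" for i
    proof -
      have "x $ i ^ N / N \<le> \<rho> x" unfolding \<rho>_def using \<rho>nn by (intro member_le_sum) auto
      then have "x $ i ^ N / N \<le> b ^ N / N" using that by (simp add: \<epsilon>_def)
      then have "x $ i ^ N \<le> b ^ N" using N by (simp add: divide_le_cancel)
      then have "\<bar>x $ i\<bar> ^ N \<le> b ^ N" using N(1) by (simp add: power_even_abs)
      then show ?thesis using b N by (intro power_mono_iff[THEN iffD1, of "\<bar>x $ i\<bar>" b N]) auto
    qed
    then have "(\<Sum>i\<in>UNIV. \<bar>x $ i\<bar>) \<le> (\<Sum>i\<in>(UNIV :: 'n set). b)" by (intro sum_mono)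
    also have "\<dots> = \<delta> / 2" by (simp add: b_def)
    finally show ?thesis using norm_le_l1_cart[of x] \<delta>(1) by simp
  qed
  define V where "V = {x. \<rho> x \<le> \<epsilon> \<and> f x = f 0}"
  have Df: "(f has_derivative (\<lambda>v. A x \<bullet> v)) (at x)" if "\<rho> x \<le> \<epsilon>" for x
  proof -
    have "x \<in> U" using small[OF that] by (intro ballU) simp
    from smooth_on_has_derivative[OF f this] show ?thesis
      by (rule has_derivative_eq_rhs)
        (simp add: fun_eq_iff has_derivative_partial_deriv[OF smooth_on_has_derivative[OF f \<open>x \<in> U\<close>]] A_def inner_vec_def mult.commute)
  qed
  have cont\<rho>: "continuous_on UNIV \<rho>"
    using D\<rho> by (auto intro!: continuous_at_imp_continuous_on has_derivative_continuous)
  have Vn: "norm x \<le> \<delta>" if "x \<in> V" for x using small[of x] that by (simp add: V_def)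
  have cV: "compact V"
  proof -
    have cf: "continuous_on (cball 0 \<delta>) f" using smooth_on_continuous_on[OF f] KU by (rule continuous_on_subset)
    have "closed {x \<in> cball 0 \<delta>. f x = f 0}"
      by (rule continuous_closed_preimage_constant[OF cf closed_cball])
    moreover have "closed {x. \<rho> x \<le> \<epsilon>}" using cont\<rho> by (intro closed_Collect_le) auto
    ultimately have "compact (cball 0 \<delta> \<inter> ({x \<in> cball 0 \<delta>. f x = f 0} \<inter> {x. \<rho> x \<le> \<epsilon>}))"
      by (intro compact_Int_closed compact_cball closed_Int)
    moreover have "cball 0 \<delta> \<inter> ({x \<in> cball 0 \<delta>. f x = f 0} \<inter> {x. \<rho> x \<le> \<epsilon>}) = V"
      using Vn by (auto simp: V_def)
    ultimately show ?thesis by simp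
  qed
  have hom: "\<exists>h. homeomorphic_map (top_of_set V) (cone_topology {x \<in> V. \<rho> x = \<epsilon>}) h \<and> h 0 = None"
  proof (rule gradient_flow_cone[OF Lip FM L(1) F0 D\<rho> RF \<rho>0 \<rho>pos Df _ \<epsilon> V_def cV])
    show "A x \<bullet> F x = 0" if "\<rho> x \<le> \<epsilon>" for x using FY[of x] small[OF that] AY by simp
    show "0 < R x \<bullet> F x" if "x \<in> V" "x \<noteq> 0" for x
      using RYpos[OF Vn[OF that(1)] that(2)] FY[OF Vn[OF that(1)]] that(1) by (simp add: V_def)
    have "continuous_on V F"
      using Lip L(1) by (intro lipschitz_on_continuous_on[of L] lipschitz_onI) (auto simp: dist_norm)
    moreover have "continuous_on V R" unfolding R_def by (intro continuous_intros)
    ultimately show "continuous_on V (\<lambda>x. R x \<bullet> F x)" by (intro continuous_intros)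
  qed
  have sr: "smooth_on S \<rho>" if "open S" for S
  proof -
    have "smooth_on S (\<lambda>x. \<Sum>i\<in>UNIV. (1 / N) * x $ i ^ N)"
      by (intro smooth_on_sum smooth_on_mult smooth_on_const smooth_on_power smooth_on_coord that)
    then show ?thesis unfolding \<rho>_def[abs_def] by simp
  qed
  have pr: "partial_deriv i \<rho> x = x $ i ^ (N - 1)" for i x
    unfolding partial_deriv_def frechet_derivative_at[OF D\<rho>, symmetric] by (simp add: inner_axis R_def)
  have opn: "open {x. \<rho> x < \<epsilon>}" using cont\<rho> by (intro open_Collect_less) auto
  let ?M = "V - {0}"
  have inner_pt: "hypersurface_interior_point ?M p \<and> \<not> hypersurface_boundary_point ?M p"
    if p: "p \<in> ?M" "\<rho> p < \<epsilon>" for p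
  proof -
    let ?S = "{x. \<rho> x < \<epsilon>} - {0}"
    have S: "open ?S" "p \<in> ?S" using opn p by (simp_all add: open_delete)
    have SU: "?S \<subseteq> U"
    proof
      fix x assume "x \<in> ?S"
      then have "norm x < \<delta>" by (intro small) simp
      then show "x \<in> U" by (intro ballU) simp
    qed
    have "norm p \<le> \<delta>" "p \<noteq> 0" using Vn p by simp_all
    from A0[OF this] obtain l where l: "partial_deriv l f p \<noteq> 0" by (rule exE)
    have M: "?M \<inter> ?S = {x \<in> ?S. f x = f 0}" by (auto simp: V_def)
    show ?thesis
      by (rule conjI[OF interior_point_level_set[OF S smooth_on_subset[OF f SU] l M]
        interior_point_not_boundary_point[OF S smooth_on_subset[OF f SU] l M p(1)]])
  qed
  have bd_pt: "hypersurface_boundary_point ?M p" if p: "p \<in> ?M" "\<rho> p = \<epsilon>" for p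
  proof -
    let ?S = "ball 0 \<delta> - {0 :: real^'n}"
    have S: "open ?S" "p \<in> ?S" using small[of p] p by (simp_all add: open_delete)
    have SU: "?S \<subseteq> U"
    proof
      fix x assume "x \<in> ?S"
      then show "x \<in> U" by (intro ballU) simp
    qed
    have "norm p \<le> \<delta>" "p \<noteq> 0" "f p = f 0" using Vn p by (simp_all add: V_def)
    from T[OF this] obtain i j where ij: "p $ i ^ (N - 1) * partial_deriv j f p \<noteq> p $ j ^ (N - 1) * partial_deriv i f p"
      by (elim exE)
    show ?thesis
    proof (rule boundary_point_level_set[OF S smooth_on_subset[OF f SU] sr[OF S(1)], of i j])
      show "partial_deriv i f p * partial_deriv j \<rho> p \<noteq> partial_deriv j f p * partial_deriv i \<rho> p"
        using ij by (simp add: pr mult.commute)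
      show "?M \<inter> ?S = {x \<in> ?S. f x = f 0 \<and> \<rho> x \<le> \<epsilon>}" by (auto simp: V_def)
    qed (rule p(2))
  qed
  have hyp: "hypersurface_with_boundary ?M"
    unfolding hypersurface_with_boundary_def
  proof
    fix p assume p: "p \<in> ?M"
    then have "\<rho> p < \<epsilon> \<or> \<rho> p = \<epsilon>" by (auto simp: V_def)
    then show "hypersurface_interior_point ?M p \<or> hypersurface_boundary_point ?M p"
      using inner_pt[OF p] bd_pt[OF p] by blast
  qed
  have bdry: "hypersurface_boundary ?M = {x \<in> V. \<rho> x = \<epsilon>}"
  proof (intro set_eqI iffI)
    fix p assume "p \<in> hypersurface_boundary ?M"
    then have p: "p \<in> ?M" "hypersurface_boundary_point ?M p" by (auto simp: hypersurface_boundary_def)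
    then have "\<not> \<rho> p < \<epsilon>" using inner_pt by blast
    then show "p \<in> {x \<in> V. \<rho> x = \<epsilon>}" using p(1) by (auto simp: V_def)
  next
    fix p assume p: "p \<in> {x \<in> V. \<rho> x = \<epsilon>}"
    then have "p \<in> ?M" using \<rho>0 \<epsilon> by auto
    then show "p \<in> hypersurface_boundary ?M" using bd_pt p by (auto simp: hypersurface_boundary_def)
  qed
  have "isolated_critical_point U f 0"
    unfolding isolated_critical_point_def
  proof (intro conjI U crit exI[of _ "ball 0 \<delta>"] ballI impI)
    fix x assume x: "x \<in> ball 0 \<delta> \<inter> U" and "critical_point f x"
    then have "frechet_derivative f (at x) = (\<lambda>_. 0)"
      unfolding critical_point_def using frechet_derivative_at by metis
    then have "partial_deriv l f x = 0" for l by (simp add: partial_deriv_def)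
    then show "x = 0" using A0[of x] x by (auto simp: less_imp_le)
  qed (use \<delta>(1) in auto)
  moreover have "cone_neighborhood {x \<in> U. f x = f 0} 0 V"
    unfolding cone_neighborhood_def bdry
  proof (intro conjI cV hyp hom)
    show "V \<subseteq> {x \<in> U. f x = f 0}" using Vn ballU by (auto simp: V_def)
    show "\<exists>W. open W \<and> 0 \<in> W \<and> {x \<in> U. f x = f 0} \<inter> W \<subseteq> V"
      by (rule exI[of _ "{x. \<rho> x < \<epsilon>}"]) (use opn \<epsilon> \<rho>0 in \<open>auto simp: V_def\<close>)
  qed
  ultimately show ?thesis unfolding cone_like_def by blast
qed

text \<open>One nonzero value among the polynomials of any stage makes every germ with that series
  cone-like, so the series of a bad germ is a common zero of all stages.\<close>

theorem corollary25:
  shows "\<exists>X :: 'n::finite taylor_series set.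
    proalgebraic_of_codim X \<infinity> \<and>
    {taylor f | (f :: real^'n \<Rightarrow> real) U.
       open U \<and> 0 \<in> U \<and> smooth_on U f \<and> critical_point f 0 \<and> \<not> cone_like U f 0} \<subseteq> X"
proof -
  define Q where "Q k t \<longleftrightarrow> k < fst t \<and> (\<forall>p\<in>snd t. poly_fun (jet_indices (fst t)) p) \<and>
    (\<forall>z0 :: 'n taylor_series. \<exists>y. \<exists>p\<in>snd t. (\<forall>\<alpha>\<in>jet_indices k. y \<alpha> = z0 \<alpha>) \<and> p y \<noteq> 0) \<and>
    (\<forall>(f :: real^'n \<Rightarrow> real) U. open U \<longrightarrow> 0 \<in> U \<longrightarrow> smooth_on U f \<longrightarrow> (\<exists>p\<in>snd t. p (taylor f) \<noteq> 0) \<longrightarrow>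
       critical_point f 0 \<longrightarrow> cone_like U f 0)"
    for k :: nat and t :: "nat \<times> ('n taylor_series \<Rightarrow> real) set"
  have ex: "\<exists>t. Q k t" for k
  proof -
    obtain m N P where g: "k < m \<and> even N \<and> 2 \<le> N \<and> (\<forall>p\<in>P. poly_fun (jet_indices m) p) \<and>
      (\<forall>z0 :: 'n taylor_series. \<exists>y. \<exists>p\<in>P. (\<forall>\<alpha>\<in>jet_indices k. y \<alpha> = z0 \<alpha>) \<and> p y \<noteq> 0) \<and>
      (\<forall>(f :: real^'n \<Rightarrow> real) U. open U \<longrightarrow> 0 \<in> U \<longrightarrow> smooth_on U f \<longrightarrow> (\<exists>p\<in>P. p (taylor f) \<noteq> 0) \<longrightarrow>
        (\<forall>\<^sub>F x in nhds 0. x \<noteq> 0 \<longrightarrow> (\<exists>g. gradient_generators N (\<lambda>x. f x - f 0) (\<lambda>l. partial_deriv l f) g x \<noteq> 0)))"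
      using generic_jet_polynomials[of k, where ?'n = 'n] by (elim exE)
    then have "Q k (m, P)"
      unfolding Q_def fst_conv snd_conv
      by (elim conjE, intro conjI allI impI) (assumption | blast intro: nondegenerate_imp_cone_like)+
    then show ?thesis ..
  qed
  define t where "t k = (SOME t. Q k t)" for k
  have t: "Q k (t k)" for k unfolding t_def by (rule someI_ex[OF ex])
  \<comment> \<open>The orders are linked: \<open>kk (Suc j)\<close> is the order of the jets on
    which \<open>P j\<close> is defined and at the same time the base order of the next
    stage.\<close>
  define kk where "kk j = ((\<lambda>k. fst (t k)) ^^ j) 0" for j
  define P where "P j = snd (t (kk j))" for j
  have kkS: "kk (Suc j) = fst (t (kk j))" for j by (simp add: kk_def)
  have "proalgebraic_of_codim {z. \<forall>j. \<forall>p\<in>P j. p z = 0} \<infinity>"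
  proof (rule proalgebraic_of_codim_infinity)
    show "strict_mono kk" unfolding strict_mono_Suc_iff kkS using t by (simp add: Q_def)
    show "poly_fun (jet_indices (kk (Suc j))) p" if "p \<in> P j" for j p
      using t[of "kk j"] that unfolding Q_def P_def kkS by blast
    show "\<exists>y. \<exists>p\<in>P j. (\<forall>i\<in>jet_indices (kk j). y i = x i) \<and> p y \<noteq> 0" for j x
      using t[of "kk j"] unfolding Q_def P_def by blast
  qed
  moreover have "taylor f \<in> {z. \<forall>j. \<forall>p\<in>P j. p z = 0}"
    if "open U" "0 \<in> U" "smooth_on U f" "critical_point f 0" "\<not> cone_like U f 0" for f :: "real^'n \<Rightarrow> real" and U
  proof (intro CollectI allI ballI, rule ccontr)
    fix j p assume p: "p \<in> P j" "p (taylor f) \<noteq> 0"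
    then have "\<exists>p\<in>snd (t (kk j)). p (taylor f) \<noteq> 0" unfolding P_def by blast
    then have "cone_like U f 0" using t[of "kk j"] that(1-4) unfolding Q_def by blast
    then show False using that(5) by blast
  qed
  ultimately show ?thesis by (intro exI[of _ "{z. \<forall>j. \<forall>p\<in>P j. p z = 0}"]) blast
qed

end
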